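(* Let a finite group $G = G_1 \times \dots \times G_n$ be the (internal) direct product of its subgroups $G_i$, $i = 1, \dots, n$. Then for every complete class $\mathfrak{X}$ of finite groups, $$\mathrm{sm}_{\mathfrak{X}}(G) = \{ \langle H_1, \dots, H_n \rangle \mid H_i \in \mathrm{sm}_{\mathfrak{X}}(G_i),\ i = 1, \dots, n \}.$$
   Context: All groups are finite. A nonempty class $\mathfrak{X}$ of finite groups is called complete if it is closed under taking subgroups, homomorphic images and extensions, where closure under extensions means that $G \in \mathfrak{X}$ whenever $G$ contains a normal subgroup $A \in \mathfrak{X}$ with $G/A \in \mathfrak{X}$. An $\mathfrak{X}$-subgroup is a subgroup belonging to $\mathfrak{X}$; $\mathrm{m}_{\mathfrak{X}}(G)$ denotes the set of subgroups of $G$ maximal by inclusion among the $\mathfrak{X}$-subgroups of $G$. A subgroup $H$ of $G$ is subnormal, written $H \unlhd\unlhd G$, if there is a series from $G$ down to $H$ in which each term is normal in the preceding one. A subgroup $H$ of $G$ is called a submaximal $\mathfrak{X}$-subgroup of $G$, written $H \in \mathrm{sm}_{\mathfrak{X}}(G)$, if there exists an embedding $\phi : G \hookrightarrow G^*$ into some finite group $G^*$ such that $G^\phi \unlhd\unlhd G^*$ and $H^\phi = X \cap G^\phi$ for some $X \in \mathrm{m}_{\mathfrak{X}}(G^* )$. *)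

theory Defs
  imports "HOL-Algebra.Algebra"
begin

text \<open>A class of finite groups is represented by a set of groups whose elements are natural
  numbers. Every finite group has an isomorphic copy of this kind (lemma
  finite_group_nat_copy), and a complete class is closed under isomorphism, so such a set
  determines the class. A group over any other type belongs to the class iff it is isomorphic
  to one of the members.\<close>

definition in_class :: "('a, 'b) monoid_scheme \<Rightarrow> nat monoid set \<Rightarrow> bool" where
  "in_class G \<XX> \<longleftrightarrow> group G \<and> finite (carrier G) \<and> (\<exists>K\<in>\<XX>. G \<cong> K)"

text \<open>The last clause uses in_class because the quotient has elements of type nat set.\<close>

definition complete_class :: "nat monoid set \<Rightarrow> bool" where
  "complete_class \<XX> \<longleftrightarrow>
     \<XX> \<noteq> {} \<and>
     (\<forall>G\<in>\<XX>. group G \<and> finite (carrier G)) \<and>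
     (\<forall>G\<in>\<XX>. \<forall>H. subgroup H G \<longrightarrow> G\<lparr>carrier := H\<rparr> \<in> \<XX>) \<and>
     (\<forall>G\<in>\<XX>. \<forall>K. group K \<and> epi G K \<noteq> {} \<longrightarrow> K \<in> \<XX>) \<and>
     (\<forall>G A. group G \<and> finite (carrier G) \<and> A \<lhd> G \<and>
            G\<lparr>carrier := A\<rparr> \<in> \<XX> \<and> in_class (G Mod A) \<XX> \<longrightarrow> G \<in> \<XX>)"

definition class_subgroup :: "nat monoid set \<Rightarrow> ('a, 'b) monoid_scheme \<Rightarrow> 'a set \<Rightarrow> bool" where
  "class_subgroup \<XX> G H \<longleftrightarrow> subgroup H G \<and> in_class (G\<lparr>carrier := H\<rparr>) \<XX>"

definition maximal_class_subgroups :: "nat monoid set \<Rightarrow> ('a, 'b) monoid_scheme \<Rightarrow> 'a set set" where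
  "maximal_class_subgroups \<XX> G =
     {H. class_subgroup \<XX> G H \<and> (\<forall>K. class_subgroup \<XX> G K \<and> H \<subseteq> K \<longrightarrow> K = H)}"

inductive subnormal :: "'a set \<Rightarrow> ('a, 'b) monoid_scheme \<Rightarrow> bool" where
  whole: "subnormal (carrier G) G"
| step: "subnormal K G \<Longrightarrow> H \<lhd> G\<lparr>carrier := K\<rparr> \<Longrightarrow> subnormal H G"

text \<open>Up to isomorphism, the overgroup may be taken to have natural numbers as elements.\<close>

definition submaximal_class_subgroups :: "nat monoid set \<Rightarrow> ('a, 'b) monoid_scheme \<Rightarrow> 'a set set" where
  "submaximal_class_subgroups \<XX> G =
     {H. subgroup H G \<and>
         (\<exists>(G' :: nat monoid) \<phi> M.
            group G' \<and> finite (carrier G') \<and> \<phi> \<in> mon G G' \<and>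
            subnormal (\<phi> ` carrier G) G' \<and>
            M \<in> maximal_class_subgroups \<XX> G' \<and> \<phi> ` H = M \<inter> \<phi> ` carrier G)}"

definition internal_direct_product :: "('a, 'b) monoid_scheme \<Rightarrow> 'i set \<Rightarrow> ('i \<Rightarrow> 'a set) \<Rightarrow> bool" where
  "internal_direct_product G I D \<longleftrightarrow>
     (\<forall>i\<in>I. D i \<lhd> G) \<and>
     generate G (\<Union>i\<in>I. D i) = carrier G \<and>
     (\<forall>i\<in>I. D i \<inter> generate G (\<Union>j\<in>I - {i}. D j) = {\<one>\<^bsub>G\<^esub>})"

lemma finite_group_nat_copy:
  fixes G :: "('a, 'b) monoid_scheme"
  assumes "group G" and "finite (carrier G)"
  obtains K :: "nat monoid" where "group K" and "finite (carrier K)" and "G \<cong> K"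
proof -
  interpret group G by fact
  obtain f where f: "bij_betw f (carrier G) {0..<card (carrier G)}"
    using assms(2) ex_bij_betw_finite_nat by blast
  define g where "g = inv_into (carrier G) f"
  define K :: "nat monoid" where
    "K = \<lparr>carrier = {0..<card (carrier G)}, monoid.mult = (\<lambda>x y. f (g x \<otimes>\<^bsub>G\<^esub> g y)), one = f \<one>\<^bsub>G\<^esub>\<rparr>"
  have "g (f x) = x" if "x \<in> carrier G" for x
    using f that by (simp add: g_def bij_betw_inv_into_left)
  moreover have "f x \<in> carrier K" if "x \<in> carrier G" for x
    using f that by (auto simp: K_def bij_betw_def)
  ultimately have iso: "f \<in> iso G K"
    using f by (auto simp: iso_def hom_def K_def)
  have "group (K\<lparr>carrier := f ` carrier G, one := f \<one>\<^bsub>G\<^esub>\<rparr>)"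
    using iso by (intro hom_imp_img_group) (simp add: iso_def)
  moreover have "K\<lparr>carrier := f ` carrier G, one := f \<one>\<^bsub>G\<^esub>\<rparr> = K"
    using f by (simp add: K_def bij_betw_def)
  ultimately have "group K" by simp
  moreover have "finite (carrier K)" by (simp add: K_def)
  moreover have "G \<cong> K" using iso by (auto simp: is_iso_def)
  ultimately show thesis by (rule that)
qed

lemma in_class_nat_iff:
  fixes G :: "nat monoid"
  assumes "complete_class \<XX>"
  shows "in_class G \<XX> \<longleftrightarrow> G \<in> \<XX>"
proof
  assume "in_class G \<XX>"
  then obtain K where G: "group G" and K: "K \<in> \<XX>" and "G \<cong> K"
    unfolding in_class_def by blast
  then have "K \<cong> G" using group.iso_sym by blast
  then obtain h where "h \<in> iso K G" unfolding is_iso_def by blast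
  then have "h \<in> epi K G" by (simp add: iso_def epi_def bij_betw_def)
  then show "G \<in> \<XX>" using assms G K unfolding complete_class_def by blast
next
  assume "G \<in> \<XX>"
  moreover have "group G" and "finite (carrier G)"
    using assms \<open>G \<in> \<XX>\<close> unfolding complete_class_def by blast+
  ultimately show "in_class G \<XX>"
    unfolding in_class_def using iso_refl by blast
qed

end

theory Submission
  imports Defs
begin

text \<open>
Fix an embedding of \<open>G\<close> as a subnormal subgroup of \<open>G'\<close> and a maximal \<open>\<XX>\<close>-subgroup \<open>M\<close> of
\<open>G'\<close>, and let \<open>H = M \<inter> G\<close>. Each factor \<open>G\<^sub>i\<close> is normal in \<open>G\<close>, hence subnormal in \<open>G'\<close>, so
\<open>H \<inter> G\<^sub>i = M \<inter> G\<^sub>i\<close> is submaximal in \<open>G\<^sub>i\<close>. What has to be shown is that \<open>H\<close> is generated by these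
intersections, that is, that \<open>H\<close> contains the components of each of its elements. This is
\<open>factor_of_product_in_maximal_class_subgroup\<close>: if \<open>A\<close> and \<open>B\<close> are subnormal subgroups of
a finite group that commute elementwise, \<open>a \<in> A\<close>, \<open>b \<in> B\<close>, \<open>a b \<in> M\<close>, and the order of \<open>a\<close> divides
the order of a group of the class, then \<open>a \<in> M\<close>. Here \<open>A \<inter> B\<close> may be nontrivial, because
the proof passes to quotients.

The proof is by induction on the order of the ambient group \<open>G\<close>. Since \<open>M\<close> stays maximal in
every subgroup that contains it, one may assume \<open>G = \<langle>M, a\<rangle>\<close>. Let \<open>N\<close> be a minimal normal
subgroup. If the image of \<open>M\<close> in \<open>G/N\<close> is again maximal, then induction gives \<open>a \<in> M N\<close>. There are
two ways to get there.

If \<open>N\<close> is an \<open>\<XX>\<close>-group, then \<open>N \<subseteq> M\<close> and \<open>a \<in> M N = M\<close>.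

If \<open>N\<close> is abelian and its order is coprime to the orders of all \<open>\<XX>\<close>-groups, then maximality
passes to \<open>G/N\<close> by a version of the Schur-Zassenhaus theorem in which the complement
contains a given subgroup (\<open>complement_above\<close>). Writing \<open>a = x m\<close> with \<open>x \<in> M\<close> and \<open>m \<in> N\<close>,
coprimality and subnormality force \<open>x \<in> A\<close> and \<open>m \<in> B\<close>, so \<open>x\<close> and \<open>m\<close> commute; comparing
orders gives \<open>m = 1\<close>.

One of the two cases always occurs. An abelian \<open>N\<close> whose order shares a prime with that of an
\<open>\<XX>\<close>-group is generated by subgroups of that prime order, so it is an \<open>\<XX>\<close>-group. If
\<open>N\<close> is nonabelian, it is generated by commuting conjugates of a nonabelian simple group \<open>S\<close>,
and a subnormal subgroup either contains or centralizes each of them. So on each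
conjugate \<open>a\<close> acts trivially or as \<open>a b \<in> M\<close> does, according to whether \<open>A\<close> centralizes it or
contains it. As \<open>G = \<langle>M, a\<rangle>\<close>, every element of \<open>G\<close>, in particular every element of \<open>S\<close>, acts on
\<open>S\<close> as some element of \<open>M\<close>. Because \<open>S\<close> has trivial centre, it is a homomorphic image of a
subgroup of \<open>M\<close>; so \<open>S\<close>, and with it \<open>N\<close>, is an \<open>\<XX>\<close>-group.

For the other inclusion, the direct product of overgroups of the factors is an overgroup of \<open>G\<close>, in
which \<open>G\<close> is again subnormal, and a product of maximal \<open>\<XX>\<close>-subgroups is a maximal \<open>\<XX>\<close>-subgroup, since its
overgroups project into the factors.
\<close>

section \<open>Groups of a complete class over arbitrary types\<close>

lemma in_class_epi_image:
  fixes G :: "('a, 'b) monoid_scheme" and K :: "('c, 'd) monoid_scheme"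
  assumes X: "complete_class \<XX>" and G: "in_class G \<XX>"
    and K: "group K" and f: "f \<in> epi G K"
  shows "in_class K \<XX>"
proof -
  obtain C where C: "C \<in> \<XX>" "G \<cong> C" and gG: "group G" and fG: "finite (carrier G)"
    using G unfolding in_class_def by blast
  obtain h where h: "h \<in> iso C G"
    using C(2) gG group.iso_sym unfolding is_iso_def by blast
  have fK: "finite (carrier K)"
    using f fG unfolding epi_def by (metis (mono_tags, lifting) finite_imageI mem_Collect_eq)
  obtain N :: "nat monoid" where N: "group N" "K \<cong> N"
    using finite_group_nat_copy[OF K fK] by blast
  then obtain k where k: "k \<in> iso K N" unfolding is_iso_def by blast
  have "k \<circ> (f \<circ> h) \<in> epi C N"
    using h f k epi_compose iso_iff_mon_epi by metis
  then have "N \<in> \<XX>" using X C(1) N(1) unfolding complete_class_def by blast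
  then show ?thesis using K fK N(2) unfolding in_class_def by blast
qed

lemma in_class_iso:
  assumes "complete_class \<XX>" and "in_class G \<XX>" and "group K" and "G \<cong> K"
  shows "in_class K \<XX>"
  using assms in_class_epi_image iso_iff_mon_epi unfolding is_iso_def by blast

lemma in_class_subgroup:
  fixes G :: "('a, 'b) monoid_scheme"
  assumes X: "complete_class \<XX>" and G: "in_class G \<XX>" and H: "subgroup H G"
  shows "in_class (G\<lparr>carrier := H\<rparr>) \<XX>"
proof -
  obtain C where C: "C \<in> \<XX>" "G \<cong> C" and gG: "group G"
    using G unfolding in_class_def by blast
  then obtain h where h: "h \<in> iso G C" unfolding is_iso_def by blast
  have gC: "group C" using X C(1) unfolding complete_class_def by blast
  have "subgroup (h ` H) C" using subgroup.iso_subgroup[OF H gG gC h] .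
  then have "C\<lparr>carrier := h ` H\<rparr> \<in> \<XX>" using X C(1) unfolding complete_class_def by blast
  moreover have "C\<lparr>carrier := h ` H\<rparr> \<cong> G\<lparr>carrier := H\<rparr>"
    using is_isoI[OF iso_restrict[OF h gG gC H]] group.iso_sym group.subgroup_imp_group[OF gG H]
    by blast
  ultimately show ?thesis
    using X in_class_iso in_class_nat_iff group.subgroup_imp_group[OF gG H] by blast
qed

lemma class_subgroup_hom_image:
  assumes X: "complete_class \<XX>" and f: "group_hom G K f"
    and H: "class_subgroup \<XX> G H"
  shows "class_subgroup \<XX> K (f ` H)"
proof -
  interpret group_hom G K f by fact
  have sH: "subgroup H G" and cH: "in_class (G\<lparr>carrier := H\<rparr>) \<XX>"
    using H unfolding class_subgroup_def by auto
  have sub: "subgroup (f ` H) K" using subgroup_img_is_subgroup[OF sH] .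
  have "f \<in> hom (G\<lparr>carrier := H\<rparr>) (K\<lparr>carrier := f ` H\<rparr>)"
    using subgroup.mem_carrier[OF sH] by (auto simp: hom_def)
  then have "f \<in> epi (G\<lparr>carrier := H\<rparr>) (K\<lparr>carrier := f ` H\<rparr>)" by (simp add: epi_def)
  then show ?thesis
    using in_class_epi_image[OF X cH] H.subgroup_imp_group[OF sub] sub
    unfolding class_subgroup_def by blast
qed

lemma class_subgroup_mono:
  assumes X: "complete_class \<XX>" and G: "group G" and H: "class_subgroup \<XX> G H"
    and K: "subgroup K G" "K \<subseteq> H"
  shows "class_subgroup \<XX> G K"
proof -
  have "subgroup K (G\<lparr>carrier := H\<rparr>)"
    using G H K group.subgroup_incl unfolding class_subgroup_def by blast
  then show ?thesis
    using in_class_subgroup[OF X, of "G\<lparr>carrier := H\<rparr>" K] H K unfolding class_subgroup_def by simp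
qed

lemma class_subgroup_finite: "class_subgroup \<XX> G H \<Longrightarrow> finite H"
  unfolding class_subgroup_def in_class_def by simp

text \<open>Extension closure is postulated for groups on natural numbers only, so the argument is carried out on
a numeric copy of the group, whose quotient by the kernel is a copy of the image.\<close>

lemma in_class_extension:
  fixes G :: "('a, 'b) monoid_scheme" and K :: "('c, 'd) monoid_scheme"
  assumes X: "complete_class \<XX>" and f: "group_hom G K f" and fin: "finite (carrier G)"
    and ker: "in_class (G\<lparr>carrier := kernel G K f\<rparr>) \<XX>"
    and img: "in_class (K\<lparr>carrier := f ` carrier G\<rparr>) \<XX>"
  shows "in_class G \<XX>"
proof -
  interpret group_hom G K f by fact
  obtain N :: "nat monoid" where N: "group N" "finite (carrier N)" "G \<cong> N"
    using finite_group_nat_copy[OF G.is_group fin] by blast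
  then obtain h where h: "h \<in> iso N G" using G.iso_sym unfolding is_iso_def by blast
  have hh: "h \<in> hom N G" and bij: "bij_betw h (carrier N) (carrier G)"
    using h by (auto simp: iso_def)
  have fh: "group_hom N K (f \<circ> h)"
    using N(1) H.is_group Group.hom_compose[OF hh homh] by (simp add: group_hom_def group_hom_axioms_def)
  interpret c: group_hom N K "f \<circ> h" by fact
  let ?A = "kernel N K (f \<circ> h)"
  have A: "?A \<lhd> N" by (rule c.normal_kernel)
  have hA: "h ` ?A = kernel G K f"
  proof
    show "h ` ?A \<subseteq> kernel G K f" using hh by (auto simp: kernel_def hom_def)
    show "kernel G K f \<subseteq> h ` ?A"
    proof
      fix x assume x: "x \<in> kernel G K f"
      then have "x \<in> h ` carrier N" using bij by (auto simp: kernel_def bij_betw_def)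
      then show "x \<in> h ` ?A" using x by (auto simp: kernel_def)
    qed
  qed
  have sA: "subgroup ?A N" using A by (rule normal_imp_subgroup)
  have "N\<lparr>carrier := ?A\<rparr> \<cong> G\<lparr>carrier := kernel G K f\<rparr>"
    using is_isoI[OF iso_restrict[OF h N(1) G.is_group sA]] hA by simp
  then have "in_class (N\<lparr>carrier := ?A\<rparr>) \<XX>"
    using in_class_iso[OF X ker] c.subgroup_imp_group[OF sA] group.iso_sym by blast
  then have 1: "N\<lparr>carrier := ?A\<rparr> \<in> \<XX>" using X in_class_nat_iff by blast
  have im: "(f \<circ> h) ` carrier N = f ` carrier G" using bij by (metis bij_betw_def image_comp)
  have sI: "subgroup (f ` carrier G) K" by (rule img_is_subgroup)
  have "f \<circ> h \<in> hom N (K\<lparr>carrier := f ` carrier G\<rparr>)"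
    using c.homh im by (auto simp: hom_def)
  then interpret d: group_hom N "K\<lparr>carrier := f ` carrier G\<rparr>" "f \<circ> h"
    using N(1) H.subgroup_imp_group[OF sI] by (simp add: group_hom_def group_hom_axioms_def)
  have "N Mod ?A \<cong> K\<lparr>carrier := f ` carrier G\<rparr>"
    using d.FactGroup_iso im by (simp add: kernel_def)
  moreover have "group (N Mod ?A)" using A by (rule normal.factorgroup_is_group)
  ultimately have 2: "in_class (N Mod ?A) \<XX>"
    using in_class_iso[OF X img] group.iso_sym by blast
  have "N \<in> \<XX>" using X N A 1 2 unfolding complete_class_def by blast
  then show ?thesis unfolding in_class_def using N fin G.is_group by blast
qed

lemma in_class_trivial:
  fixes G :: "('a, 'b) monoid_scheme"
  assumes X: "complete_class \<XX>" and G: "group G" and tr: "carrier G = {\<one>\<^bsub>G\<^esub>}"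
  shows "in_class G \<XX>"
proof -
  obtain C where C: "C \<in> \<XX>" using X unfolding complete_class_def by blast
  then have gC: "group C" using X unfolding complete_class_def by blast
  have "in_class C \<XX>" using C X in_class_nat_iff by blast
  moreover have "(\<lambda>x. \<one>\<^bsub>G\<^esub>) \<in> epi C G"
    using group.is_monoid[OF gC] tr group.is_monoid[OF G]
    by (auto simp: epi_def hom_def image_constant_conv intro: monoid.one_closed)
  ultimately show ?thesis using in_class_epi_image X G by blast
qed

lemma class_subgroup_trivial:
  assumes X: "complete_class \<XX>" and G: "group G"
  shows "class_subgroup \<XX> G {\<one>\<^bsub>G\<^esub>}"
proof -
  interpret group G by fact
  show ?thesis unfolding class_subgroup_def
    using in_class_trivial[OF X subgroup_imp_group[OF triv_subgroup]] triv_subgroup by simp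
qed

text \<open>Extension closure in the form that lifts a larger \<open>\<XX>\<close>-subgroup from a quotient.\<close>

lemma class_subgroup_extension:
  assumes X: "complete_class \<XX>" and f: "group_hom G K f" and fin: "finite (carrier G)"
    and Y: "subgroup Y G" "kernel G K f \<subseteq> Y"
    and ker: "class_subgroup \<XX> G (kernel G K f)"
    and img: "class_subgroup \<XX> K (f ` Y)"
  shows "class_subgroup \<XX> G Y"
proof -
  interpret group_hom G K f by fact
  have "group_hom (G\<lparr>carrier := Y\<rparr>) K f"
    using G.subgroup_imp_group[OF Y(1)] H.is_group homh subgroup.mem_carrier[OF Y(1)]
    by (auto simp: group_hom_def group_hom_axioms_def hom_def)
  moreover have "kernel (G\<lparr>carrier := Y\<rparr>) K f = kernel G K f"
    using Y subgroup.mem_carrier[OF Y(1)] by (auto simp: kernel_def)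
  ultimately have "in_class (G\<lparr>carrier := Y\<rparr>) \<XX>"
    using in_class_extension[OF X, of "G\<lparr>carrier := Y\<rparr>" K f] fin ker img
      finite_subset[OF subgroup.subset[OF Y(1)]]
    unfolding class_subgroup_def by simp
  then show ?thesis using Y(1) unfolding class_subgroup_def by simp
qed

lemma hom_coset_map:
  assumes "N \<lhd> G"
  shows "group_hom G (G Mod N) (\<lambda>x. N #>\<^bsub>G\<^esub> x)" and "kernel G (G Mod N) (\<lambda>x. N #>\<^bsub>G\<^esub> x) = N"
proof -
  interpret normal N G by fact
  show "group_hom G (G Mod N) (\<lambda>x. N #>\<^bsub>G\<^esub> x)"
    using factorgroup_is_group r_coset_hom_Mod is_group by (simp add: group_hom_def group_hom_axioms_def)
  show "kernel G (G Mod N) (\<lambda>x. N #>\<^bsub>G\<^esub> x) = N"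
    using subset coset_join1[OF _ _ subgroup_axioms] coset_join2[OF _ subgroup_axioms]
    unfolding kernel_def one_FactGroup by blast
qed

text \<open>Induction on the order of a group needs quotients over the same type as the group itself,
whereas the elements of a factor group are cosets.\<close>

lemma nat_quotient:
  fixes G :: "('a, 'b) monoid_scheme"
  assumes N: "N \<lhd> G" and fin: "finite (carrier G)"
  obtains K :: "nat monoid" and f where "group_hom G K f" "f ` carrier G = carrier K"
    "kernel G K f = N" "finite (carrier K)"
proof -
  interpret c: group_hom G "G Mod N" "\<lambda>x. N #>\<^bsub>G\<^esub> x" using hom_coset_map(1)[OF N] .
  have im: "(\<lambda>x. N #>\<^bsub>G\<^esub> x) ` carrier G = carrier (G Mod N)" by (simp add: carrier_FactGroup)
  have fM: "finite (carrier (G Mod N))" using im fin by (metis finite_imageI)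
  obtain K :: "nat monoid" where K: "group K" "finite (carrier K)" "G Mod N \<cong> K"
    using finite_group_nat_copy[OF c.H.is_group fM] by blast
  then obtain h where h: "h \<in> iso (G Mod N) K" unfolding is_iso_def by blast
  then have hh: "h \<in> hom (G Mod N) K" and bij: "bij_betw h (carrier (G Mod N)) (carrier K)"
    by (auto simp: iso_def)
  let ?f = "h \<circ> (\<lambda>x. N #>\<^bsub>G\<^esub> x)"
  have 1: "group_hom G K ?f"
    using K(1) hom_compose[OF c.homh hh] by (simp add: group_hom_def group_hom_axioms_def)
  have 2: "?f ` carrier G = carrier K" using bij im by (metis bij_betw_def image_comp)
  have "kernel G K ?f = kernel G (G Mod N) (\<lambda>x. N #>\<^bsub>G\<^esub> x)"
  proof -
    have "h (N #>\<^bsub>G\<^esub> x) = \<one>\<^bsub>K\<^esub> \<longleftrightarrow> N #>\<^bsub>G\<^esub> x = \<one>\<^bsub>G Mod N\<^esub>" if "x \<in> carrier G" for x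
      using bij hom_one[OF hh c.H.is_group K(1)] c.hom_closed[OF that] c.H.one_closed
      unfolding bij_betw_def by (metis inj_on_eq_iff)
    then show ?thesis unfolding kernel_def by auto
  qed
  then have 3: "kernel G K ?f = N" using hom_coset_map(2)[OF N] by simp
  show thesis using that[OF 1 2 3 K(2)] .
qed

text \<open>The product of \<open>M\<close> with a normal \<open>\<XX>\<close>-subgroup \<open>N\<close> is an extension of \<open>N\<close> by an image of \<open>M\<close>,
hence an \<open>\<XX>\<close>-subgroup, and maximality applies.\<close>

lemma maximal_class_subgroup_absorbs_normal:
  fixes G :: "('a, 'b) monoid_scheme" (structure)
  assumes X: "complete_class \<XX>" and fin: "finite (carrier G)"
    and M: "M \<in> maximal_class_subgroups \<XX> G" and N: "N \<lhd> G" and cN: "class_subgroup \<XX> G N"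
  shows "N \<subseteq> M"
proof -
  have gG: "group G" using N by (simp add: normal_def)
  interpret group G by fact
  have cM: "class_subgroup \<XX> G M" and mx: "\<And>K. class_subgroup \<XX> G K \<Longrightarrow> M \<subseteq> K \<Longrightarrow> K = M"
    using M unfolding maximal_class_subgroups_def by auto
  have sM: "subgroup M G" and sN: "subgroup N G"
    using cM cN unfolding class_subgroup_def by auto
  let ?f = "\<lambda>x. N #> x"
  interpret c: group_hom G "G Mod N" ?f using hom_coset_map(1)[OF N] .
  have ker: "kernel G (G Mod N) ?f = N" using hom_coset_map(2)[OF N] .
  have sub: "subgroup (N <#> M) G" using mult_norm_subgroup[OF N sM] .
  have N_le: "N \<subseteq> N <#> M"
    using subgroup.one_closed[OF sM] subgroup.mem_carrier[OF sN] unfolding set_mult_def by force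
  have M_le: "M \<subseteq> N <#> M"
    using subgroup.one_closed[OF sN] subgroup.mem_carrier[OF sM] unfolding set_mult_def by force
  have "N #> (n \<otimes> m) = N #> m" if "n \<in> N" "m \<in> M" for n m
    using that coset_mult_assoc[of N n m] subgroup.rcos_const[OF sN gG]
      subgroup.mem_carrier[OF sM] subgroup.mem_carrier[OF sN] subgroup.subset[OF sN] by simp
  then have "?f ` (N <#> M) \<subseteq> ?f ` M" by (auto simp: set_mult_def)
  then have "?f ` (N <#> M) = ?f ` M" using M_le by blast
  then have "class_subgroup \<XX> (G Mod N) (?f ` (N <#> M))"
    using class_subgroup_hom_image[OF X c.group_hom_axioms cM] by simp
  then have "class_subgroup \<XX> G (N <#> M)"
    using class_subgroup_extension[OF X c.group_hom_axioms fin sub] N_le cN ker by simp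
  then show ?thesis using mx M_le N_le by blast
qed

lemma maximal_class_subgroup_exists:
  assumes fin: "finite (carrier G)" and H: "class_subgroup \<XX> G H"
  obtains M where "M \<in> maximal_class_subgroups \<XX> G" "H \<subseteq> M"
proof -
  let ?S = "{K. class_subgroup \<XX> G K \<and> H \<subseteq> K}"
  have "?S \<subseteq> Pow (carrier G)"
    using subgroup.subset unfolding class_subgroup_def by blast
  then have "finite ?S" using fin by (meson finite_Pow_iff finite_subset)
  moreover have "H \<in> ?S" using H by simp
  ultimately obtain M where "M \<in> ?S" "H \<subseteq> M" "\<forall>K\<in>?S. M \<subseteq> K \<longrightarrow> M = K"
    using finite_has_maximal2[of ?S H] by blast
  then have "M \<in> maximal_class_subgroups \<XX> G" unfolding maximal_class_subgroups_def by auto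
  then show thesis using that \<open>H \<subseteq> M\<close> by blast
qed

lemma maximal_class_subgroup_in_subgroup:
  assumes G: "group G" and M: "M \<in> maximal_class_subgroups \<XX> G" and Y: "subgroup Y G" "M \<subseteq> Y"
  shows "M \<in> maximal_class_subgroups \<XX> (G\<lparr>carrier := Y\<rparr>)"
proof -
  have "class_subgroup \<XX> (G\<lparr>carrier := Y\<rparr>) K \<longleftrightarrow> class_subgroup \<XX> G K \<and> K \<subseteq> Y" for K
    using group.incl_subgroup[OF G Y(1)] group.subgroup_incl[OF G _ Y(1)]
      subgroup.subset[of K "G\<lparr>carrier := Y\<rparr>"]
    unfolding class_subgroup_def by auto
  then show ?thesis using M Y unfolding maximal_class_subgroups_def by auto
qed

lemma subgroup_vimage:
  assumes f: "group_hom G K f" and L: "subgroup L K"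
  shows "subgroup {x \<in> carrier G. f x \<in> L} G"
proof -
  interpret group_hom G K f by fact
  show ?thesis
    using subgroup.one_closed[OF L] subgroup.m_closed[OF L] subgroup.m_inv_closed[OF L]
    by (intro G.subgroupI) auto
qed

text \<open>Preimages of \<open>\<XX>\<close>-subgroups are \<open>\<XX>\<close>-subgroups here, so a larger \<open>\<XX>\<close>-subgroup of the image
would lift to one above \<open>M\<close>.\<close>

lemma maximal_class_subgroup_image:
  assumes X: "complete_class \<XX>" and f: "group_hom G K f" and fin: "finite (carrier G)"
    and surj: "f ` carrier G = carrier K"
    and ker: "class_subgroup \<XX> G (kernel G K f)"
    and M: "M \<in> maximal_class_subgroups \<XX> G"
  shows "f ` M \<in> maximal_class_subgroups \<XX> K"
proof -
  interpret group_hom G K f by fact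
  have cM: "class_subgroup \<XX> G M" and mx: "\<And>K. class_subgroup \<XX> G K \<Longrightarrow> M \<subseteq> K \<Longrightarrow> K = M"
    using M unfolding maximal_class_subgroups_def by auto
  have sM: "subgroup M G" using cM unfolding class_subgroup_def by auto
  show ?thesis unfolding maximal_class_subgroups_def
  proof (intro CollectI conjI allI impI)
    show "class_subgroup \<XX> K (f ` M)" by (rule class_subgroup_hom_image[OF X f cM])
  next
    fix L assume L: "class_subgroup \<XX> K L \<and> f ` M \<subseteq> L"
    have sL: "subgroup L K" using L unfolding class_subgroup_def by auto
    let ?Y = "{y \<in> carrier G. f y \<in> L}"
    have sY: "subgroup ?Y G" by (rule subgroup_vimage[OF f sL])
    have fY: "f ` ?Y = L"
    proof
      show "L \<subseteq> f ` ?Y"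
      proof
        fix l assume l: "l \<in> L"
        then obtain g where "g \<in> carrier G" "l = f g"
          using surj subgroup.subset[OF sL] by blast
        then show "l \<in> f ` ?Y" using l by blast
      qed
    qed blast
    have "kernel G K f \<subseteq> ?Y" using subgroup.one_closed[OF sL] by (auto simp: kernel_def)
    then have "class_subgroup \<XX> G ?Y"
      using class_subgroup_extension[OF X f fin sY] ker L fY by simp
    moreover have "M \<subseteq> ?Y" using L subgroup.subset[OF sM] by auto
    ultimately have "?Y = M" using mx by blast
    then show "L = f ` M" using fY by simp
  qed
qed

section \<open>Subnormal subgroups\<close>

lemma normal_in_subgroup_iff:
  fixes G (structure)
  assumes G: "group G" and K: "subgroup K G"
  shows "H \<lhd> G\<lparr>carrier := K\<rparr> \<longleftrightarrow>
    subgroup H G \<and> H \<subseteq> K \<and> (\<forall>k\<in>K. \<forall>h\<in>H. k \<otimes> h \<otimes> inv k \<in> H)"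
proof -
  interpret group G by fact
  have "subgroup H (G\<lparr>carrier := K\<rparr>) \<longleftrightarrow> subgroup H G \<and> H \<subseteq> K"
    using incl_subgroup[OF K] subgroup_incl[OF _ K] subgroup.subset[of H "G\<lparr>carrier := K\<rparr>"] by auto
  then show ?thesis
    using group.normal_inv_iff[OF subgroup_imp_group[OF K]] m_inv_consistent[OF K] by auto
qed

lemma subnormal_imp_subgroup:
  assumes "subnormal H G" and "group G"
  shows "subgroup H G"
  using assms
proof (induction rule: subnormal.induct)
  case (whole G)
  then show ?case by (rule group.subgroup_self)
next
  case (step K G H)
  then show ?case using normal_in_subgroup_iff[of G K H] by blast
qed

lemma subnormal_image:
  assumes "subnormal H G" and "group_hom G K f" and "f ` carrier G = carrier K"
  shows "subnormal (f ` H) K"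
  using assms
proof (induction rule: subnormal.induct)
  case (whole G)
  then show ?case using subnormal.whole[of K] by simp
next
  case (step L G H)
  interpret group_hom G K f by fact
  have L: "subgroup L G" using subnormal_imp_subgroup[OF step.hyps(1)] G.is_group by blast
  have H: "subgroup H G" "H \<subseteq> L" "\<And>k h. k \<in> L \<Longrightarrow> h \<in> H \<Longrightarrow> k \<otimes>\<^bsub>G\<^esub> h \<otimes>\<^bsub>G\<^esub> inv\<^bsub>G\<^esub> k \<in> H"
    using step.hyps(2) normal_in_subgroup_iff[OF G.is_group L, of H] by auto
  have "f k \<otimes>\<^bsub>K\<^esub> f h \<otimes>\<^bsub>K\<^esub> inv\<^bsub>K\<^esub> f k \<in> f ` H" if "k \<in> L" "h \<in> H" for k h
  proof -
    have "k \<in> carrier G" "h \<in> carrier G"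
      using that subgroup.mem_carrier[OF L] subgroup.mem_carrier[OF H(1)] by auto
    then have "f k \<otimes>\<^bsub>K\<^esub> f h \<otimes>\<^bsub>K\<^esub> inv\<^bsub>K\<^esub> f k = f (k \<otimes>\<^bsub>G\<^esub> h \<otimes>\<^bsub>G\<^esub> inv\<^bsub>G\<^esub> k)" by simp
    then show ?thesis using H(3)[OF that] by simp
  qed
  then have "f ` H \<lhd> K\<lparr>carrier := f ` L\<rparr>"
    using normal_in_subgroup_iff[OF H.is_group subgroup_img_is_subgroup[OF L]]
      subgroup_img_is_subgroup[OF H(1)] H(2) by auto
  then show ?case using step subnormal.step by blast
qed

text \<open>Applied to an inclusion this restricts subnormality to a subgroup; applied to the two
projections it gives subnormality of products.\<close>

lemma subnormal_vimage:
  assumes "subnormal H K" and "group_hom G K f"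
  shows "subnormal {x \<in> carrier G. f x \<in> H} G"
  using assms
proof (induction rule: subnormal.induct)
  case (whole K)
  interpret group_hom G K f by fact
  have "{x \<in> carrier G. f x \<in> carrier K} = carrier G" by auto
  then show ?case using subnormal.whole[of G] by simp
next
  case (step L K H)
  interpret group_hom G K f by fact
  have L: "subgroup L K" using subnormal_imp_subgroup[OF step.hyps(1)] H.is_group by blast
  have H: "subgroup H K" "H \<subseteq> L" "\<And>k h. k \<in> L \<Longrightarrow> h \<in> H \<Longrightarrow> k \<otimes>\<^bsub>K\<^esub> h \<otimes>\<^bsub>K\<^esub> inv\<^bsub>K\<^esub> k \<in> H"
    using step.hyps(2) normal_in_subgroup_iff[OF H.is_group L, of H] by auto
  have "{x \<in> carrier G. f x \<in> H} \<lhd> G\<lparr>carrier := {x \<in> carrier G. f x \<in> L}\<rparr>"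
    using normal_in_subgroup_iff[OF G.is_group subgroup_vimage[OF step.prems L]]
      subgroup_vimage[OF step.prems H(1)] H(2,3) by auto
  then show ?case using step subnormal.step by blast
qed

lemma group_hom_inclusion:
  assumes "group G" and "subgroup Y G"
  shows "group_hom (G\<lparr>carrier := Y\<rparr>) G (\<lambda>x. x)"
  using assms group.subgroup_imp_group subgroup.mem_carrier
  by (fastforce simp: group_hom_def group_hom_axioms_def hom_def)

lemma subnormal_Int_subgroup:
  assumes "group G" and "subnormal H G" and "subgroup Y G"
  shows "subnormal (H \<inter> Y) (G\<lparr>carrier := Y\<rparr>)"
  using subnormal_vimage[OF assms(2) group_hom_inclusion[OF assms(1,3)]]
  by (simp add: Collect_conj_eq Int_commute)

lemma subnormal_trans:
  assumes "group G" and "subnormal K G" and "subnormal H (G\<lparr>carrier := K\<rparr>)"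
  shows "subnormal H G"
  using assms(3)
proof (induction "G\<lparr>carrier := K\<rparr>" rule: subnormal.induct)
  case whole
  then show ?case using assms(2) by simp
next
  case (step L H)
  then show ?case using subnormal.step[of L G H] by simp
qed

lemma subnormal_Int:
  assumes "group G" and "subnormal H G" and "subnormal K G"
  shows "subnormal (H \<inter> K) G"
  using subnormal_trans[OF assms(1,3)] subnormal_Int_subgroup[OF assms(1,2)]
    subnormal_imp_subgroup[OF assms(3,1)] by blast

lemma (in group) coprime_exponents_imp_one:
  assumes x: "x \<in> carrier G" and "x [^] (k::nat) = \<one>" and "x [^] (l::nat) = \<one>" and "coprime k l"
  shows "x = \<one>"
proof -
  have "ord x dvd k" "ord x dvd l" using assms pow_eq_id by auto
  then have "ord x = 1" using assms(4) by (meson coprime_common_divisor_nat)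
  then show ?thesis using ord_eq_1 x by blast
qed

lemma (in group) pow_mult_normal:
  assumes N: "subgroup N G" and h: "h \<in> N" and m: "m \<in> carrier G"
    and inv: "\<And>x. x \<in> N \<Longrightarrow> m \<otimes> x \<otimes> inv m \<in> N"
  shows "\<exists>h'\<in>N. (h \<otimes> m) [^] (n::nat) = h' \<otimes> m [^] n"
proof (induction n)
  case 0
  then show ?case using subgroup.one_closed[OF N] by force
next
  case (Suc n)
  have hc: "h \<in> carrier G" using h subgroup.mem_carrier[OF N] by blast
  have conj: "m [^] k \<otimes> x \<otimes> inv (m [^] k) \<in> N" if "x \<in> N" for x and k :: nat
    using that
  proof (induction k arbitrary: x)
    case 0
    then show ?case using subgroup.mem_carrier[OF N] by simp
  next
    case (Suc k)
    have xc: "x \<in> carrier G" using Suc.prems subgroup.mem_carrier[OF N] by blast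
    have "m [^] k \<otimes> (m \<otimes> x \<otimes> inv m) \<otimes> inv (m [^] k) \<in> N"
      using Suc.IH[OF inv[OF Suc.prems]] .
    then show ?case using m xc by (simp add: m_assoc inv_mult_group)
  qed
  obtain h' where h': "h' \<in> N" "(h \<otimes> m) [^] n = h' \<otimes> m [^] n" using Suc by blast
  have h'c: "h' \<in> carrier G" using h'(1) subgroup.mem_carrier[OF N] by blast
  have "(h \<otimes> m) [^] Suc n = h' \<otimes> (m [^] n \<otimes> h \<otimes> inv (m [^] n)) \<otimes> m [^] Suc n"
    using h'(2) h'c hc m by (simp add: m_assoc inv_solve_left)
  moreover have "h' \<otimes> (m [^] n \<otimes> h \<otimes> inv (m [^] n)) \<in> N"
    using subgroup.m_closed[OF N h'(1) conj[OF h]] .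
  ultimately show ?case by blast
qed

text \<open>For \<open>H\<close> normal in \<open>K\<close> and \<open>x = h m \<in> K\<close> with \<open>h \<in> H\<close> and \<open>m \<in> M\<close>, the power of \<open>x\<close> with
exponent \<open>|M|\<close> lies in \<open>H\<close>; if the order of \<open>x\<close> is coprime to \<open>|M|\<close>, then \<open>x\<close> is a power of that
power. So \<open>x\<close> descends along the subnormal series of \<open>A\<close>.\<close>

lemma subnormal_contains_coprime_elements:
  fixes G (structure)
  assumes "subnormal A G" and "group G" and M: "M \<lhd> G" 
    and "x \<in> A <#> M" and "x [^] (k::nat) = \<one>" and "coprime k (card M)"
  shows "x \<in> A"
  using assms
proof (induction rule: subnormal.induct)
  case (whole G)
  then show ?case using subgroup.mem_carrier[OF normal_imp_subgroup[OF whole(2)]]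
    by (auto simp: set_mult_def group.is_monoid intro!: monoid.m_closed)
next
  case (step K G H)
  interpret group G by fact
  have sM: "subgroup M G" using step.prems by (simp add: normal_imp_subgroup)
  have K: "subgroup K G" using subnormal_imp_subgroup[OF step.hyps(1)] is_group by blast
  have H: "subgroup H G" "H \<subseteq> K" "\<And>k h. k \<in> K \<Longrightarrow> h \<in> H \<Longrightarrow> k \<otimes>\<^bsub>G\<^esub> h \<otimes>\<^bsub>G\<^esub> inv\<^bsub>G\<^esub> k \<in> H"
    using step.hyps(2) normal_in_subgroup_iff[OF is_group K, of H] by auto
  obtain h m where x: "x = h \<otimes>\<^bsub>G\<^esub> m" and h: "h \<in> H" and m: "m \<in> M"
    using step.prems(3) by (auto simp: set_mult_def)
  have "x \<in> K <#>\<^bsub>G\<^esub> M" using x h m H(2) by (auto simp: set_mult_def)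
  then have xK: "x \<in> K" using step by blast
  have hc: "h \<in> carrier G" and mc: "m \<in> carrier G"
    using h m subgroup.mem_carrier[OF H(1)] subgroup.mem_carrier[OF sM] by auto
  have "m = inv\<^bsub>G\<^esub> h \<otimes>\<^bsub>G\<^esub> x" using x hc mc by (simp add: m_assoc[symmetric])
  then have "m \<in> K" using xK h H(2) subgroup.m_closed[OF K] subgroup.m_inv_closed[OF K] by auto
  then obtain h' where h': "h' \<in> H" "x [^]\<^bsub>G\<^esub> card M = h' \<otimes>\<^bsub>G\<^esub> m [^]\<^bsub>G\<^esub> card M"
    using pow_mult_normal[OF H(1) h mc H(3)] x by blast
  have "m [^]\<^bsub>G\<^esub> card M = \<one>\<^bsub>G\<^esub>"
    using group.pow_order_eq_1[OF subgroup_imp_group[OF sM], of m] m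
    by (simp add: order_def nat_pow_consistent[symmetric])
  then have xp: "x [^]\<^bsub>G\<^esub> card M \<in> H" using h' subgroup.mem_carrier[OF H(1)] by simp
  have xc: "x \<in> carrier G" using x hc mc by simp
  obtain a b :: int where ab: "a * int k + b * int (card M) = 1"
    using step.prems(5) using bezout_int[of "int k" "int (card M)"] by auto
  have "x = x [^]\<^bsub>G\<^esub> (a * int k + b * int (card M))" using ab xc by (simp add: int_pow_1)
  also have "\<dots> = (x [^]\<^bsub>G\<^esub> int k) [^]\<^bsub>G\<^esub> a \<otimes>\<^bsub>G\<^esub> (x [^]\<^bsub>G\<^esub> int (card M)) [^]\<^bsub>G\<^esub> b"
    using xc by (simp add: int_pow_mult int_pow_pow mult.commute)
  also have "\<dots> = (x [^]\<^bsub>G\<^esub> card M) [^]\<^bsub>G\<^esub> b"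
    using step.prems(4) xc by (simp add: int_pow_int int_pow_one)
  also have "\<dots> \<in> H" 
    using xp H(1) by (simp add: subgroup_int_pow_closed)
  finally show ?case .
qed

section \<open>Complements of abelian normal subgroups of coprime index\<close>

lemma (in group) inv_mult_cancel_left:
  "x \<in> carrier G \<Longrightarrow> y \<in> carrier G \<Longrightarrow> inv x \<otimes> (x \<otimes> y) = y"
  "x \<in> carrier G \<Longrightarrow> y \<in> carrier G \<Longrightarrow> x \<otimes> (inv x \<otimes> y) = y"
  by (simp_all add: m_assoc[symmetric])

text \<open>A representative of a right coset of \<open>M\<close> is obtained from one representative \<open>t\<close> of each coset
of \<open>M U\<close>: since \<open>U \<inter> M\<close> is trivial, the coset of \<open>M\<close> contains exactly one element of the form
\<open>x t\<close> with \<open>x \<in> U\<close>. This choice commutes with left multiplication by elements of \<open>U\<close>.\<close>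

lemma equivariant_transversal:
  fixes G (structure)
  assumes G: "group G" and M: "M \<lhd> G" and U: "subgroup U G" and UM: "U \<inter> M = {\<one>}"
  obtains r where "r \<in> carrier G \<rightarrow> carrier G"
    and "\<And>g. g \<in> carrier G \<Longrightarrow> g \<otimes> inv (r g) \<in> M"
    and "\<And>m g. m \<in> M \<Longrightarrow> g \<in> carrier G \<Longrightarrow> r (m \<otimes> g) = r g"
    and "\<And>x g. x \<in> U \<Longrightarrow> g \<in> carrier G \<Longrightarrow> r (x \<otimes> g) = x \<otimes> r g"
proof -
  interpret group G by fact
  interpret M: normal M G by fact
  define P where "P = M <#> U"
  have P: "subgroup P G" unfolding P_def using mult_norm_subgroup[OF M U] .
  note Uc = subgroup.mem_carrier[OF U]
  have MP: "m \<in> P" if "m \<in> M" for m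
  proof -
    have "m \<otimes> \<one> \<in> P" unfolding P_def set_mult_def using that subgroup.one_closed[OF U] by blast
    then show ?thesis using M.mem_carrier[OF that] by simp
  qed
  have UP: "x \<in> P" if "x \<in> U" for x
  proof -
    have "\<one> \<otimes> x \<in> P" unfolding P_def set_mult_def using that M.one_closed by blast
    then show ?thesis using Uc[OF that] by simp
  qed
  define t where "t g = (SOME y. y \<in> P #> g)" for g
  have t: "t g \<in> P #> g" if "g \<in> carrier G" for g
    unfolding t_def using rcos_self[OF that P] by (rule someI)
  have tc: "t g \<in> carrier G" if "g \<in> carrier G" for g
    using t[OF that] r_coset_subset_G[OF subgroup.subset[OF P] that] by blast
  have tP: "t (p \<otimes> g) = t g" if "p \<in> P" "g \<in> carrier G" for p g
  proof -
    have "P #> (p \<otimes> g) = P #> p #> g"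
      using coset_mult_assoc[OF subgroup.subset[OF P] subgroup.mem_carrier[OF P that(1)] that(2)] by simp
    then show ?thesis unfolding t_def using subgroup.rcos_const[OF P G that(1)] by simp
  qed
  have uniq: "\<exists>!y. (\<exists>x\<in>U. y = x \<otimes> t g) \<and> g \<otimes> inv y \<in> M" if g: "g \<in> carrier G" for g
  proof -
    obtain p where p: "p \<in> P" "t g = p \<otimes> g" using t[OF g] by (auto simp: r_coset_def)
    have "inv p \<in> P" using P p(1) by (rule subgroup.m_inv_closed)
    then obtain m x where mx: "m \<in> M" "x \<in> U" "inv p = m \<otimes> x" by (auto simp: P_def set_mult_def)
    note c = M.mem_carrier[OF mx(1)] Uc[OF mx(2)] tc[OF g]
    have pc: "p \<in> carrier G" using p(1) subgroup.mem_carrier[OF P] by blast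
    have "g = inv p \<otimes> t g" using p(2) pc g by (simp add: inv_mult_cancel_left)
    then have ge: "g = m \<otimes> (x \<otimes> t g)" using mx(3) c by (simp add: m_assoc)
    show ?thesis
    proof (intro ex1I conjI)
      show "\<exists>x'\<in>U. x \<otimes> t g = x' \<otimes> t g" using mx(2) by blast
      have "g \<otimes> inv (x \<otimes> t g) = m \<otimes> (x \<otimes> t g) \<otimes> inv (x \<otimes> t g)" using ge by simp
      also have "\<dots> = m" using c by (simp add: m_assoc)
      finally show "g \<otimes> inv (x \<otimes> t g) \<in> M" using mx(1) by simp
    next
      fix y assume "(\<exists>x\<in>U. y = x \<otimes> t g) \<and> g \<otimes> inv y \<in> M"
      then obtain x' where x': "x' \<in> U" "y = x' \<otimes> t g" "g \<otimes> inv y \<in> M" by blast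
      note c' = Uc[OF x'(1)]
      have "g \<otimes> inv y = m \<otimes> (x \<otimes> inv x')"
      proof -
        have "g \<otimes> inv y = m \<otimes> (x \<otimes> t g) \<otimes> inv (x' \<otimes> t g)" using ge x'(2) by simp
        also have "\<dots> = m \<otimes> (x \<otimes> inv x')"
          using c c' by (simp add: m_assoc inv_mult_group inv_mult_cancel_left)
        finally show ?thesis .
      qed
      then have "x \<otimes> inv x' = inv m \<otimes> (g \<otimes> inv y)"
        using c c' by (simp add: inv_mult_cancel_left)
      then have "x \<otimes> inv x' \<in> M" using x'(3) mx(1) by simp
      moreover have "x \<otimes> inv x' \<in> U"
        using mx(2) x'(1) U by (simp add: subgroup.m_closed subgroup.m_inv_closed)
      ultimately have "x \<otimes> inv x' = \<one>" using UM by blast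
      then have "x = x'" using inv_equality[of x "inv x'"] c c' by simp
      then show "y = x \<otimes> t g" using x'(2) by simp
    qed
  qed
  define r where "r g = (THE y. (\<exists>x\<in>U. y = x \<otimes> t g) \<and> g \<otimes> inv y \<in> M)" for g
  have r: "(\<exists>x\<in>U. r g = x \<otimes> t g) \<and> g \<otimes> inv (r g) \<in> M" if "g \<in> carrier G" for g
    unfolding r_def using uniq[OF that] by (rule theI')
  have r_eq: "r g = y" if "g \<in> carrier G" "x \<in> U" "y = x \<otimes> t g" "g \<otimes> inv y \<in> M" for g x y
    using uniq[OF that(1)] r[OF that(1)] that by blast
  have rc: "r g \<in> carrier G" if "g \<in> carrier G" for g
    using r[OF that] tc[OF that] Uc by auto
  show thesis
  proof (rule that[of r])
    show "r \<in> carrier G \<rightarrow> carrier G" using rc by blast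
    show "g \<otimes> inv (r g) \<in> M" if "g \<in> carrier G" for g using r[OF that] by blast
    show "r (m \<otimes> g) = r g" if m: "m \<in> M" and g: "g \<in> carrier G" for m g
    proof -
      obtain x where x: "x \<in> U" "r g = x \<otimes> t g" using r[OF g] by blast
      have "m \<otimes> (g \<otimes> inv (r g)) \<in> M" using r[OF g] m by simp
      then have "m \<otimes> g \<otimes> inv (r g) \<in> M" using m g rc[OF g] by (simp add: m_assoc)
      then show ?thesis using r_eq[OF _ x(1)] x(2) tP[OF MP[OF m] g] m g by simp
    qed
    show "r (x \<otimes> g) = x \<otimes> r g" if x: "x \<in> U" and g: "g \<in> carrier G" for x g
    proof -
      obtain x' where x': "x' \<in> U" "r g = x' \<otimes> t g" using r[OF g] by blast
      have "x \<otimes> (g \<otimes> inv (r g)) \<otimes> inv x \<in> M"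
        using r[OF g] Uc[OF x] M.inv_op_closed2 by blast
      then have "x \<otimes> g \<otimes> inv (x \<otimes> r g) \<in> M"
        using Uc[OF x] g rc[OF g] by (simp add: m_assoc inv_mult_group)
      moreover have "x \<otimes> r g = (x \<otimes> x') \<otimes> t (x \<otimes> g)"
        using x'(2) tP[OF UP[OF x] g] Uc[OF x] Uc[OF x'(1)] tc[OF g] by (simp add: m_assoc)
      ultimately show ?thesis
        using r_eq[OF _ subgroup.m_closed[OF U x x'(1)]] Uc[OF x] g by simp
    qed
  qed
qed

text \<open>A transversal \<open>R\<close> of \<open>M\<close> defines the crossed homomorphism
\<open>E y = (\<Prod>\<rho>\<in>R. y \<rho> (r (y \<rho>))\<^sup>-\<^sup>1)\<close> from \<open>G\<close> to the abelian group \<open>M\<close>, where \<open>r\<close> sends an element to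
the representative of its coset. On \<open>M\<close> it is the power map with exponent \<open>|G : M|\<close>, a bijection by
coprimality, so the kernel of \<open>E\<close> is a complement. The choice of an equivariant transversal makes \<open>E\<close>
trivial on \<open>U\<close>, which puts \<open>U\<close> inside the complement.\<close>

lemma complement_above:
  fixes G (structure)
  assumes G: "group G" and fin: "finite (carrier G)" and M: "M \<lhd> G"
    and ab: "\<And>x y. x \<in> M \<Longrightarrow> y \<in> M \<Longrightarrow> x \<otimes> y = y \<otimes> x"
    and cop: "coprime (card M) (card (rcosets M))"
    and U: "subgroup U G" and UM: "U \<inter> M = {\<one>}"
  obtains T where "subgroup T G" "U \<subseteq> T" "T \<inter> M = {\<one>}"
    "\<And>g. g \<in> carrier G \<Longrightarrow> \<exists>m\<in>M. m \<otimes> g \<in> T"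
proof -
  interpret group G by fact
  interpret M: normal M G by fact
  let ?M = "G\<lparr>carrier := M\<rparr>"
  interpret A: comm_group ?M
    using ab subgroup_imp_group[OF M.subgroup_axioms] by (intro group.group_comm_groupI) auto
  obtain r where rc': "r \<in> carrier G \<rightarrow> carrier G"
    and rM: "\<And>g. g \<in> carrier G \<Longrightarrow> g \<otimes> inv (r g) \<in> M"
    and r_inv: "\<And>m g. m \<in> M \<Longrightarrow> g \<in> carrier G \<Longrightarrow> r (m \<otimes> g) = r g"
    and r_eqv: "\<And>x g. x \<in> U \<Longrightarrow> g \<in> carrier G \<Longrightarrow> r (x \<otimes> g) = x \<otimes> r g"
    using equivariant_transversal[OF G M U UM] by metis
  have rc: "r g \<in> carrier G" if "g \<in> carrier G" for g using rc' that by blast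
  define R where "R = r ` carrier G"
  have Rc: "\<rho> \<in> carrier G" if "\<rho> \<in> R" for \<rho> using that rc by (auto simp: R_def)
  have finR: "finite R" using fin by (simp add: R_def)
  have r_eq: "r g = r h" if "g \<in> carrier G" "h \<in> carrier G" "g \<otimes> inv h \<in> M" for g h
    using r_inv[OF that(3,2)] that by (simp add: m_assoc)
  have r_split: "g = (g \<otimes> inv (r g)) \<otimes> r g" if "g \<in> carrier G" for g
    using that rc by (simp add: m_assoc)
  have r_eqD: "g \<otimes> inv h \<in> M" if "g \<in> carrier G" "h \<in> carrier G" "r g = r h" for g h
  proof -
    have "(g \<otimes> inv (r g)) \<otimes> inv (h \<otimes> inv (r h)) \<in> M"
      using rM[OF that(1)] rM[OF that(2)] by (simp only: M.m_closed M.m_inv_closed)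
    then show ?thesis using that rc by (simp add: m_assoc inv_mult_group inv_mult_cancel_left)
  qed
  have r_idem: "r (r g) = r g" if g: "g \<in> carrier G" for g
  proof -
    have "r g \<otimes> inv g = inv (g \<otimes> inv (r g))" using g rc by (simp add: inv_mult_group)
    then have "r g \<otimes> inv g \<in> M" using rM[OF g] by simp
    then show ?thesis using r_eq[OF rc[OF g] g] by simp
  qed
  have rR: "r \<rho> = \<rho>" if "\<rho> \<in> R" for \<rho> using that r_idem by (auto simp: R_def)
  have cardR: "card R = card (rcosets M)"
  proof (rule bij_betw_same_card)
    have eq: "M #> g = M #> h \<longleftrightarrow> r g = r h" if "g \<in> carrier G" "h \<in> carrier G" for g h
    proof
      assume "M #> g = M #> h"
      then have "g \<in> M #> h" using rcos_self[OF that(1) M.subgroup_axioms] by simp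
      then show "r g = r h" using r_inv that by (auto simp: r_coset_def)
    next
      assume "r g = r h"
      then have "g \<otimes> inv h \<in> M" using r_eqD that by blast
      then have "g \<in> M #> h" using M.rcos_module[OF G that(2,1)] by simp
      then show "M #> g = M #> h" using repr_independence[OF _ that(2) M.subgroup_axioms] by simp
    qed
    show "bij_betw (\<lambda>\<rho>. M #> \<rho>) R (rcosets M)"
      unfolding bij_betw_def
    proof
      show "inj_on ((#>) M) R" using eq Rc rR by (auto intro!: inj_onI)
      have "M #> r g = M #> g" if "g \<in> carrier G" for g
        using eq[OF that rc[OF that]] r_idem[OF that] by simp
      then have "(\<lambda>g. M #> r g) ` carrier G = (#>) M ` carrier G" by simp
      then show "(#>) M ` R = rcosets M"
        unfolding R_def RCOSETS_def by (simp add: image_image) blast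
    qed
  qed
  define e where "e y \<rho> = y \<otimes> \<rho> \<otimes> inv (r (y \<otimes> \<rho>))" for y \<rho>
  have eM: "e y \<rho> \<in> M" if "y \<in> carrier G" "\<rho> \<in> R" for y \<rho>
    unfolding e_def using rM that Rc by simp
  define E where "E y = finprod ?M (e y) R" for y
  have perm: "inj_on (\<lambda>\<rho>. r (y \<otimes> \<rho>)) R" "(\<lambda>\<rho>. r (y \<otimes> \<rho>)) ` R = R" if y: "y \<in> carrier G" for y
  proof -
    show inj: "inj_on (\<lambda>\<rho>. r (y \<otimes> \<rho>)) R"
    proof (rule inj_onI)
      fix \<rho> \<sigma> assume h: "\<rho> \<in> R" "\<sigma> \<in> R" "r (y \<otimes> \<rho>) = r (y \<otimes> \<sigma>)"
      have "y \<otimes> \<rho> \<otimes> inv (y \<otimes> \<sigma>) \<in> M" using h y Rc by (intro r_eqD) auto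
      then have "inv y \<otimes> (y \<otimes> \<rho> \<otimes> inv (y \<otimes> \<sigma>)) \<otimes> y \<in> M" using y M.inv_op_closed1 by blast
      then have "\<rho> \<otimes> inv \<sigma> \<in> M"
        using h y Rc by (simp add: m_assoc inv_mult_group inv_mult_cancel_left)
      then show "\<rho> = \<sigma>" using r_eq h Rc rR by metis
    qed
    have "(\<lambda>\<rho>. r (y \<otimes> \<rho>)) ` R \<subseteq> R" using y Rc by (auto simp: R_def)
    then show "(\<lambda>\<rho>. r (y \<otimes> \<rho>)) ` R = R" using endo_inj_surj[OF finR _ inj] by blast
  qed
  have conj: "y \<otimes> a \<otimes> inv y \<in> M" if "y \<in> carrier G" "a \<in> M" for y a
    using that M.inv_op_closed2 by blast
  have fin_conj: "finprod ?M (\<lambda>\<rho>. y \<otimes> f \<rho> \<otimes> inv y) S = y \<otimes> finprod ?M f S \<otimes> inv y"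
    if y: "y \<in> carrier G" and "finite S" "f \<in> S \<rightarrow> M" for y f S
    using that(2,3)
  proof (induction S)
    case empty
    then show ?case using y by simp
  next
    case (insert s S)
    have "f s \<in> M" "finprod ?M f S \<in> M" using insert A.finprod_closed[of f S] by auto
    moreover have "(\<lambda>\<rho>. y \<otimes> f \<rho> \<otimes> inv y) \<in> S \<rightarrow> M" "y \<otimes> f s \<otimes> inv y \<in> M"
      using insert conj[OF y] by auto
    ultimately show ?case
      using insert y by (simp add: Pi_iff m_assoc inv_mult_cancel_left)
  qed
  have E_mult: "E (y \<otimes> z) = (y \<otimes> E z \<otimes> inv y) \<otimes> E y" if y: "y \<in> carrier G" and z: "z \<in> carrier G" for y z
  proof -
    have cocycle: "e (y \<otimes> z) \<rho> = (y \<otimes> e z \<rho> \<otimes> inv y) \<otimes> e y (r (z \<otimes> \<rho>))" if \<rho>: "\<rho> \<in> R" for \<rho>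
    proof -
      have "z \<otimes> \<rho> \<otimes> inv (r (z \<otimes> \<rho>)) \<in> M" using rM z Rc[OF \<rho>] by simp
      then have "y \<otimes> (z \<otimes> \<rho> \<otimes> inv (r (z \<otimes> \<rho>))) \<otimes> inv y \<in> M" using conj y by blast
      then have "(y \<otimes> z \<otimes> \<rho>) \<otimes> inv (y \<otimes> r (z \<otimes> \<rho>)) \<in> M"
        using y z Rc[OF \<rho>] rc by (simp add: m_assoc inv_mult_group)
      then have "r (y \<otimes> z \<otimes> \<rho>) = r (y \<otimes> r (z \<otimes> \<rho>))"
        using y z Rc[OF \<rho>] rc by (intro r_eq) auto
      then show ?thesis unfolding e_def using y z Rc[OF \<rho>] rc
        by (simp add: m_assoc inv_mult_cancel_left)
    qed
    have c1: "(\<lambda>\<rho>. y \<otimes> e z \<rho> \<otimes> inv y) \<in> R \<rightarrow> carrier ?M" using conj[OF y] eM[OF z] by simp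
    have c2: "(\<lambda>\<rho>. e y (r (z \<otimes> \<rho>))) \<in> R \<rightarrow> carrier ?M"
      using eM[OF y] perm(2)[OF z] by auto
    have "E (y \<otimes> z) = finprod ?M (\<lambda>\<rho>. (y \<otimes> e z \<rho> \<otimes> inv y) \<otimes> e y (r (z \<otimes> \<rho>))) R"
      unfolding E_def using c1 c2 cocycle by (intro A.finprod_cong') auto
    also have "\<dots> = finprod ?M (\<lambda>\<rho>. y \<otimes> e z \<rho> \<otimes> inv y) R \<otimes> finprod ?M (\<lambda>\<rho>. e y (r (z \<otimes> \<rho>))) R"
      using A.finprod_multf[OF c1 c2] by simp
    also have "finprod ?M (\<lambda>\<rho>. y \<otimes> e z \<rho> \<otimes> inv y) R = y \<otimes> E z \<otimes> inv y"
      unfolding E_def using fin_conj[OF y finR] eM[OF z] by simp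
    also have "finprod ?M (\<lambda>\<rho>. e y (r (z \<otimes> \<rho>))) R = E y"
      unfolding E_def using A.finprod_reindex[of "e y" "\<lambda>\<rho>. r (z \<otimes> \<rho>)" R] perm[OF z] eM[OF y] by simp
    finally show ?thesis .
  qed
  have E_M: "E y \<in> M" if "y \<in> carrier G" for y
    unfolding E_def using A.finprod_closed[of "e y" R] eM[OF that] by auto
  \<comment> \<open>Translating \<open>y\<close> by \<open>m\<close> leaves every \<open>r (y \<rho>)\<close> unchanged, so each factor gains one \<open>m\<close>.\<close>
  have E_tr: "E (m \<otimes> y) = m [^] card R \<otimes> E y" if m: "m \<in> M" and y: "y \<in> carrier G" for m y
  proof -
    have "e (m \<otimes> y) \<rho> = m \<otimes> e y \<rho>" if "\<rho> \<in> R" for \<rho>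
      unfolding e_def using m y that Rc rc r_inv[OF m, of "y \<otimes> \<rho>"] by (simp add: m_assoc)
    then have "E (m \<otimes> y) = finprod ?M (\<lambda>\<rho>. m \<otimes> e y \<rho>) R"
      unfolding E_def using m eM[OF y] by (intro A.finprod_cong') auto
    also have "\<dots> = finprod ?M (\<lambda>\<rho>. m) R \<otimes> E y"
      unfolding E_def using A.finprod_multf[of "\<lambda>\<rho>. m" R "e y"] m eM[OF y] by auto
    also have "finprod ?M (\<lambda>\<rho>. m) R = m [^] card R"
      using A.finprod_const[of m R] m by (simp add: nat_pow_consistent[symmetric])
    finally show ?thesis .
  qed
  \<comment> \<open>Equivariance makes every factor trivial.\<close>
  have E_U: "E x = \<one>" if x: "x \<in> U" for x
  proof -
    have "e x \<rho> = \<one>" if "\<rho> \<in> R" for \<rho>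
      unfolding e_def using r_eqv[OF x Rc[OF that]] rR[OF that] Rc[OF that] subgroup.mem_carrier[OF U x]
      by simp
    then show ?thesis unfolding E_def using A.finprod_one_eqI[of R "e x"] by simp
  qed
  have pow_inj: "m = \<one>" if m: "m \<in> M" "m [^] card R = \<one>" for m
  proof -
    have "m [^] card M = \<one>"
      using A.pow_order_eq_1[of m] m by (simp add: order_def nat_pow_consistent[symmetric])
    then show ?thesis
      using coprime_exponents_imp_one[OF M.mem_carrier[OF m(1)] _ m(2), of "card M"] cop cardR by simp
  qed
  have pow_surj: "\<exists>m\<in>M. m [^] card R = a" if "a \<in> M" for a
  proof -
    have pc: "m [^] card R \<in> M" if "m \<in> M" for m
      using A.nat_pow_closed[of m "card R"] that by (simp add: nat_pow_consistent[symmetric])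
    have "inj_on (\<lambda>m. m [^] card R) M"
    proof (rule inj_onI)
      fix m n assume h: "m \<in> M" "n \<in> M" "m [^] card R = n [^] card R"
      have "(m \<otimes> inv n) [^] card R = m [^] card R \<otimes> inv n [^] card R"
        using pow_mult_distrib[of m "inv n"] ab h by simp
      also have "\<dots> = \<one>" using h pc by (simp add: nat_pow_inv)
      finally have "m \<otimes> inv n = \<one>" using pow_inj h by simp
      then show "m = n" using inv_equality[of m "inv n"] h by simp
    qed
    then have "(\<lambda>m. m [^] card R) ` M = M"
      using endo_inj_surj[OF finite_subset[OF M.subset fin], of "\<lambda>m. m [^] card R"] pc by auto
    then have "a \<in> (\<lambda>m. m [^] card R) ` M" using that by simp
    then show ?thesis by blast
  qed
  define T where "T = {y \<in> carrier G. E y = \<one>}"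
  have sT: "subgroup T G"
  proof (rule subgroupI)
    have one: "\<one> \<in> T" using E_U[OF subgroup.one_closed[OF U]] by (simp add: T_def)
    then show "T \<noteq> {}" by blast
    show "a \<otimes> b \<in> T" if "a \<in> T" "b \<in> T" for a b
      using that E_mult by (simp add: T_def)
    show "inv a \<in> T" if "a \<in> T" for a
    proof -
      have a: "a \<in> carrier G" "E a = \<one>" using that by (auto simp: T_def)
      have "E (inv a \<otimes> a) = inv a \<otimes> E a \<otimes> a \<otimes> E (inv a)" using E_mult[of "inv a" a] a by simp
      then show ?thesis using a one E_M[of "inv a"] by (simp add: T_def)
    qed
  qed (auto simp: T_def)
  show thesis
  proof (rule that[OF sT])
    show "U \<subseteq> T" using E_U subgroup.mem_carrier[OF U] by (auto simp: T_def)
    have "E \<one> = \<one>" using E_U[OF subgroup.one_closed[OF U]] .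
    then have "m = \<one>" if "m \<in> M" "m \<in> T" for m
      using that E_tr[OF that(1), of \<one>] pow_inj by (simp add: T_def)
    then show "T \<inter> M = {\<one>}" using subgroup.one_closed[OF sT] by auto
    show "\<exists>m\<in>M. m \<otimes> g \<in> T" if g: "g \<in> carrier G" for g
    proof -
      obtain m where m: "m \<in> M" "m [^] card R = inv (E g)" using pow_surj[of "inv (E g)"] E_M[OF g] by auto
      then have "E (m \<otimes> g) = \<one>" using E_tr[OF m(1) g] E_M[OF g] by simp
      then show ?thesis using m(1) g by (auto simp: T_def)
    qed
  qed
qed

lemma coprime_class_subgroup:
  assumes cop: "\<And>C. C \<in> \<XX> \<Longrightarrow> coprime k (order C)" and H: "class_subgroup \<XX> G H"
  shows "coprime k (card H)"
proof -
  obtain C where "C \<in> \<XX>" "G\<lparr>carrier := H\<rparr> \<cong> C"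
    using H unfolding class_subgroup_def in_class_def by blast
  then show ?thesis using cop iso_same_card[of "G\<lparr>carrier := H\<rparr>" C] by (simp add: order_def)
qed

text \<open>Let \<open>L\<close> be an \<open>\<XX>\<close>-subgroup above the image of \<open>M\<close>. In the preimage of \<open>L\<close> the kernel has
a complement containing \<open>M\<close>; it is isomorphic to \<open>L\<close>, hence an \<open>\<XX>\<close>-subgroup, hence equal to
\<open>M\<close>.\<close>

lemma maximal_class_subgroup_coprime_image:
  assumes U: "complete_class \<XX>" and f: "group_hom G K f" and fin: "finite (carrier G)"
    and surj: "f ` carrier G = carrier K"
    and ab: "\<And>x y. x \<in> kernel G K f \<Longrightarrow> y \<in> kernel G K f \<Longrightarrow> x \<otimes>\<^bsub>G\<^esub> y = y \<otimes>\<^bsub>G\<^esub> x"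
    and cop: "\<And>C. C \<in> \<XX> \<Longrightarrow> coprime (card (kernel G K f)) (order C)"
    and M: "M \<in> maximal_class_subgroups \<XX> G"
  shows "f ` M \<in> maximal_class_subgroups \<XX> K"
proof -
  interpret group_hom G K f by fact
  let ?N = "kernel G K f"
  have cM: "class_subgroup \<XX> G M" and mx: "\<And>K. class_subgroup \<XX> G K \<Longrightarrow> M \<subseteq> K \<Longrightarrow> K = M"
    using M unfolding maximal_class_subgroups_def by auto
  have sM: "subgroup M G" using cM unfolding class_subgroup_def by auto
  have sN: "subgroup ?N G" by (rule subgroup_kernel)
  show ?thesis unfolding maximal_class_subgroups_def
  proof (intro CollectI conjI allI impI)
    show "class_subgroup \<XX> K (f ` M)" by (rule class_subgroup_hom_image[OF U f cM])
  next
    fix L assume L: "class_subgroup \<XX> K L \<and> f ` M \<subseteq> L"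
    have sL: "subgroup L K" using L unfolding class_subgroup_def by auto
    let ?Y = "{y \<in> carrier G. f y \<in> L}"
    let ?GY = "G\<lparr>carrier := ?Y\<rparr>"
    have sY: "subgroup ?Y G" by (rule subgroup_vimage[OF f sL])
    have fY: "f ` ?Y = L" using surj subgroup.subset[OF sL] by (auto simp: image_iff subset_iff set_eq_iff) (metis imageE)
    have NY: "?N \<subseteq> ?Y" using subgroup.one_closed[OF sL] by (auto simp: kernel_def)
    have MY: "M \<subseteq> ?Y" using L subgroup.subset[OF sM] by auto
    interpret Y: group ?GY by (rule G.subgroup_imp_group[OF sY])
    have homY: "group_hom ?GY (K\<lparr>carrier := L\<rparr>) f"
      using Y.is_group H.subgroup_imp_group[OF sL] by (auto simp: group_hom_def group_hom_axioms_def hom_def)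
    interpret hY: group_hom ?GY "K\<lparr>carrier := L\<rparr>" f by fact
    have kerY: "kernel ?GY (K\<lparr>carrier := L\<rparr>) f = ?N" using NY by (auto simp: kernel_def)
    have NnY: "?N \<lhd> ?GY" using hY.normal_kernel kerY by simp
    have "?GY Mod ?N \<cong> K\<lparr>carrier := L\<rparr>" using hY.FactGroup_iso kerY fY by simp
    then have idx: "card (rcosets\<^bsub>?GY\<^esub> ?N) = card L"
      using iso_same_card by (force simp: FactGroup_def)
    have copM: "coprime (card ?N) (card M)" and copL: "coprime (card ?N) (card L)"
      using coprime_class_subgroup[OF cop] cM L by auto
    have M_N: "x = \<one>\<^bsub>G\<^esub>" if x: "x \<in> M" "x \<in> ?N" for x
    proof -
      have "x [^]\<^bsub>G\<^esub> card M = \<one>\<^bsub>G\<^esub>" "x [^]\<^bsub>G\<^esub> card ?N = \<one>\<^bsub>G\<^esub>"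
        using group.pow_order_eq_1[OF G.subgroup_imp_group[OF sM], of x] x
          group.pow_order_eq_1[OF G.subgroup_imp_group[OF sN], of x]
        by (simp_all add: order_def G.nat_pow_consistent[symmetric])
      then show ?thesis
        using G.coprime_exponents_imp_one[of x "card ?N" "card M"] x subgroup.mem_carrier[OF sM] copM by simp
    qed
    have "\<one>\<^bsub>G\<^esub> \<in> M \<inter> ?N"
      using subgroup.one_closed[OF sM] subgroup.one_closed[OF sN] by blast
    then have "M \<inter> ?N = {\<one>\<^bsub>G\<^esub>}" using M_N by blast
    then have MN: "M \<inter> ?N = {\<one>\<^bsub>?GY\<^esub>}" by simp
    have finY: "finite (carrier ?GY)" using fin by simp
    obtain T where T: "subgroup T ?GY" "M \<subseteq> T" "T \<inter> ?N = {\<one>\<^bsub>?GY\<^esub>}"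
      "\<And>g. g \<in> carrier ?GY \<Longrightarrow> \<exists>m\<in>?N. m \<otimes>\<^bsub>?GY\<^esub> g \<in> T"
      using complement_above[OF Y.is_group finY NnY _ _ G.subgroup_incl[OF sM sY MY] MN] ab copL idx
      by auto
    have sT: "subgroup T G" using G.incl_subgroup[OF sY T(1)] .
    have TY: "T \<subseteq> ?Y" using subgroup.subset[OF T(1)] by simp
    have "f ` T = L"
    proof
      show "f ` T \<subseteq> L" using TY by auto
      show "L \<subseteq> f ` T"
      proof
        fix l assume "l \<in> L"
        then obtain y where y: "y \<in> ?Y" "l = f y" using fY by blast
        then obtain m where m: "m \<in> ?N" "m \<otimes>\<^bsub>G\<^esub> y \<in> T" using T(4)[of y] by auto
        then have "f (m \<otimes>\<^bsub>G\<^esub> y) = l" using y by (auto simp: kernel_def)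
        then show "l \<in> f ` T" using m(2) by blast
      qed
    qed
    moreover have "inj_on f T"
    proof (rule inj_onI)
      fix a b assume h: "a \<in> T" "b \<in> T" "f a = f b"
      have c: "a \<in> carrier G" "b \<in> carrier G" using h subgroup.mem_carrier[OF sT] by auto
      have "a \<otimes>\<^bsub>G\<^esub> inv\<^bsub>G\<^esub> b \<in> T \<inter> ?N"
        using h c subgroup.m_closed[OF sT] subgroup.m_inv_closed[OF sT] by (simp add: kernel_def)
      then have "a \<otimes>\<^bsub>G\<^esub> inv\<^bsub>G\<^esub> b = \<one>\<^bsub>G\<^esub>" using T(3) by simp
      then show "a = b" using G.inv_equality[of a "inv\<^bsub>G\<^esub> b"] c by simp
    qed
    ultimately have "f \<in> iso (G\<lparr>carrier := T\<rparr>) (K\<lparr>carrier := L\<rparr>)"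
      using subgroup.mem_carrier[OF sT] by (auto simp: iso_def hom_def bij_betw_def)
    then have "K\<lparr>carrier := L\<rparr> \<cong> G\<lparr>carrier := T\<rparr>"
      using group.iso_sym[OF G.subgroup_imp_group[OF sT]] is_isoI by blast
    then have "class_subgroup \<XX> G T"
      using in_class_iso[OF U _ G.subgroup_imp_group[OF sT]] L sT unfolding class_subgroup_def by blast
    then have "T = M" using mx T(2) by blast
    then show "L = f ` M" using \<open>f ` T = L\<close> by simp
  qed
qed

section \<open>Nonabelian minimal normal subgroups\<close>

text \<open>One notion covers the different kinds of minimality that are needed: with \<open>N = carrier G\<close> the
minimal invariant subgroups are the minimal normal subgroups of \<open>G\<close>, with \<open>S \<subseteq> N\<close> they are those of
\<open>N\<close>, and \<open>S\<close> is simple iff it is minimal invariant under itself.\<close>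

definition invariant_subgroup :: "('a, 'b) monoid_scheme \<Rightarrow> 'a set \<Rightarrow> 'a set \<Rightarrow> bool" where
  "invariant_subgroup G N S \<longleftrightarrow>
     subgroup S G \<and> (\<forall>n\<in>N. \<forall>s\<in>S. n \<otimes>\<^bsub>G\<^esub> s \<otimes>\<^bsub>G\<^esub> inv\<^bsub>G\<^esub> n \<in> S)"

definition minimal_invariant_subgroup :: "('a, 'b) monoid_scheme \<Rightarrow> 'a set \<Rightarrow> 'a set \<Rightarrow> bool" where
  "minimal_invariant_subgroup G N S \<longleftrightarrow>
     invariant_subgroup G N S \<and> S \<noteq> {\<one>\<^bsub>G\<^esub>} \<and>
     (\<forall>K. invariant_subgroup G N K \<and> K \<subseteq> S \<longrightarrow> K = {\<one>\<^bsub>G\<^esub>} \<or> K = S)"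

definition conjugate_set :: "('a, 'b) monoid_scheme \<Rightarrow> 'a \<Rightarrow> 'a set \<Rightarrow> 'a set" where
  "conjugate_set G g S = (\<lambda>s. g \<otimes>\<^bsub>G\<^esub> s \<otimes>\<^bsub>G\<^esub> inv\<^bsub>G\<^esub> g) ` S"

lemma minimal_invariant_subgroup_exists:
  assumes fin: "finite S" and S: "invariant_subgroup G N S" "S \<noteq> {\<one>\<^bsub>G\<^esub>}"
  obtains K where "minimal_invariant_subgroup G N K" "K \<subseteq> S"
proof -
  let ?F = "{K. invariant_subgroup G N K \<and> K \<noteq> {\<one>\<^bsub>G\<^esub>} \<and> K \<subseteq> S}"
  have "finite ?F" using fin by simp
  moreover have "S \<in> ?F" using S by simp
  ultimately obtain K where K: "K \<in> ?F" "\<forall>L\<in>?F. L \<subseteq> K \<longrightarrow> K = L"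
    using finite_has_minimal2[of ?F S] by blast
  then have "minimal_invariant_subgroup G N K" unfolding minimal_invariant_subgroup_def by blast
  then show thesis using that K(1) by blast
qed

lemma (in group) minimal_invariant_subgroups_eq_or_commute:
  assumes S: "minimal_invariant_subgroup G N S" "S \<subseteq> N" and T: "minimal_invariant_subgroup G N T" "T \<subseteq> N"
  shows "S = T \<or> (\<forall>s\<in>S. \<forall>t\<in>T. s \<otimes> t = t \<otimes> s)"
proof -
  have iS: "invariant_subgroup G N S" and iT: "invariant_subgroup G N T"
    using S T unfolding minimal_invariant_subgroup_def by auto
  then have sS: "subgroup S G" and sT: "subgroup T G" unfolding invariant_subgroup_def by auto
  have "invariant_subgroup G N (S \<inter> T)"
    using iS iT subgroups_Inter_pair unfolding invariant_subgroup_def by blast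
  then have "S \<inter> T = {\<one>} \<or> S = T"
    using S(1) T(1) unfolding minimal_invariant_subgroup_def by blast
  moreover have "s \<otimes> t = t \<otimes> s" if st: "S \<inter> T = {\<one>}" "s \<in> S" "t \<in> T" for s t
  proof -
    have c: "s \<in> carrier G" "t \<in> carrier G"
      using st subgroup.mem_carrier[OF sS] subgroup.mem_carrier[OF sT] by auto
    have "s \<otimes> t \<otimes> inv s \<otimes> inv t \<in> T"
      using iT st S(2) subgroup.m_closed[OF sT] subgroup.m_inv_closed[OF sT]
      unfolding invariant_subgroup_def by blast
    moreover have "s \<otimes> (t \<otimes> inv s \<otimes> inv t) \<in> S"
      using iS st T(2) subgroup.m_closed[OF sS] subgroup.m_inv_closed[OF sS]
      unfolding invariant_subgroup_def by blast
    moreover have "s \<otimes> (t \<otimes> inv s \<otimes> inv t) = s \<otimes> t \<otimes> inv s \<otimes> inv t" using c by (simp add: m_assoc)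
    ultimately have "s \<otimes> t \<otimes> inv s \<otimes> inv t = \<one>" using st(1) by auto
    then have "s \<otimes> t \<otimes> inv (t \<otimes> s) = \<one>" using c by (simp add: m_assoc inv_mult_group)
    then show ?thesis using c inv_equality[of "s \<otimes> t" "inv (t \<otimes> s)"] by simp
  qed
  ultimately show ?thesis by blast
qed

lemma (in group) conjugation_hom:
  assumes "g \<in> carrier G"
  shows "group_hom G G (\<lambda>s. g \<otimes> s \<otimes> inv g)"
proof -
  have "(\<lambda>s. g \<otimes> s \<otimes> inv g) \<in> hom G G"
    using assms by (auto simp: hom_def m_assoc inv_mult_cancel_left)
  then show ?thesis using is_group by (simp add: group_hom_def group_hom_axioms_def)
qed

lemma (in group) conjugate_set_subgroup:
  assumes "subgroup S G" and "g \<in> carrier G"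
  shows "subgroup (conjugate_set G g S) G"
  unfolding conjugate_set_def
  using group_hom.subgroup_img_is_subgroup[OF conjugation_hom[OF assms(2)] assms(1)] .

lemma (in group) conjugate_set_mult:
  assumes "S \<subseteq> carrier G" and "g \<in> carrier G" and "h \<in> carrier G"
  shows "conjugate_set G g (conjugate_set G h S) = conjugate_set G (g \<otimes> h) S"
proof -
  have "g \<otimes> (h \<otimes> s \<otimes> inv h) \<otimes> inv g = g \<otimes> h \<otimes> s \<otimes> inv (g \<otimes> h)" if "s \<in> S" for s
    using that assms by (auto simp: m_assoc inv_mult_group)
  then show ?thesis unfolding conjugate_set_def image_image by (rule image_cong[OF refl])
qed

lemma (in group) conjugate_set_one:
  "S \<subseteq> carrier G \<Longrightarrow> conjugate_set G \<one> S = S"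
  unfolding conjugate_set_def by (force simp: subset_iff)

lemma (in group) invariant_subgroup_conjugate:
  assumes N: "invariant_subgroup G (carrier G) N" and S: "invariant_subgroup G N S" and g: "g \<in> carrier G"
  shows "invariant_subgroup G N (conjugate_set G g S)"
proof -
  have sS: "subgroup S G" and sN: "subgroup N G" using S N unfolding invariant_subgroup_def by auto
  have "n \<otimes> (g \<otimes> s \<otimes> inv g) \<otimes> inv n \<in> conjugate_set G g S" if n: "n \<in> N" and s: "s \<in> S" for n s
  proof -
    have c: "n \<in> carrier G" "s \<in> carrier G"
      using n s subgroup.mem_carrier[OF sN] subgroup.mem_carrier[OF sS] by auto
    have "inv g \<otimes> n \<otimes> inv (inv g) \<in> N" using N n g unfolding invariant_subgroup_def by blast
    then have "(inv g \<otimes> n \<otimes> g) \<otimes> s \<otimes> inv (inv g \<otimes> n \<otimes> g) \<in> S"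
      using S s g unfolding invariant_subgroup_def by simp
    moreover have "n \<otimes> (g \<otimes> s \<otimes> inv g) \<otimes> inv n
        = g \<otimes> ((inv g \<otimes> n \<otimes> g) \<otimes> s \<otimes> inv (inv g \<otimes> n \<otimes> g)) \<otimes> inv g"
      using c g by (simp add: m_assoc inv_mult_group inv_mult_cancel_left)
    ultimately show ?thesis unfolding conjugate_set_def by blast
  qed
  then show ?thesis
    using conjugate_set_subgroup[OF sS g] unfolding invariant_subgroup_def conjugate_set_def by auto
qed

lemma (in group) minimal_invariant_subgroup_conjugate:
  assumes N: "invariant_subgroup G (carrier G) N" and S: "minimal_invariant_subgroup G N S"
    and g: "g \<in> carrier G"
  shows "minimal_invariant_subgroup G N (conjugate_set G g S)"
proof -
  have iS: "invariant_subgroup G N S" and S1: "S \<noteq> {\<one>}"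
    and Smin: "\<And>K. invariant_subgroup G N K \<Longrightarrow> K \<subseteq> S \<Longrightarrow> K = {\<one>} \<or> K = S"
    using S unfolding minimal_invariant_subgroup_def by auto
  have sS: "subgroup S G" using iS unfolding invariant_subgroup_def by auto
  have conj_inv: "conjugate_set G (inv g) (conjugate_set G g K) = K" "conjugate_set G g (conjugate_set G (inv g) K) = K"
    if "K \<subseteq> carrier G" for K
    using conjugate_set_mult[OF that] conjugate_set_one[OF that] g by simp_all
  have one: "conjugate_set G h {\<one>} = {\<one>}" if "h \<in> carrier G" for h
    using that by (simp add: conjugate_set_def)
  show ?thesis unfolding minimal_invariant_subgroup_def
  proof (intro conjI allI impI)
    show "invariant_subgroup G N (conjugate_set G g S)" using invariant_subgroup_conjugate[OF N iS g] .
    show "conjugate_set G g S \<noteq> {\<one>}"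
      using conj_inv(1)[OF subgroup.subset[OF sS]] one[of "inv g"] g S1 by auto
  next
    fix K assume K: "invariant_subgroup G N K \<and> K \<subseteq> conjugate_set G g S"
    then have Kc: "K \<subseteq> carrier G" unfolding invariant_subgroup_def using subgroup.subset by blast
    have "conjugate_set G (inv g) K \<subseteq> conjugate_set G (inv g) (conjugate_set G g S)"
      using K by (auto simp: conjugate_set_def)
    then have "conjugate_set G (inv g) K \<subseteq> S" using conj_inv(1)[OF subgroup.subset[OF sS]] by simp
    then have "conjugate_set G (inv g) K = {\<one>} \<or> conjugate_set G (inv g) K = S"
      using Smin invariant_subgroup_conjugate[OF N] K g by blast
    then show "K = {\<one>} \<or> K = conjugate_set G g S"
      using conj_inv(2)[OF Kc] one[OF g] by metis
  qed
qed

lemma (in group) centralizer_subgroup: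
  assumes W: "W \<subseteq> carrier G"
  shows "subgroup {x \<in> carrier G. \<forall>w\<in>W. x \<otimes> w = w \<otimes> x} G"
proof (rule subgroupI)
  have "\<one> \<in> {x \<in> carrier G. \<forall>w\<in>W. x \<otimes> w = w \<otimes> x}" using W by auto
  then show "{x \<in> carrier G. \<forall>w\<in>W. x \<otimes> w = w \<otimes> x} \<noteq> {}" by blast
  fix a assume a: "a \<in> {x \<in> carrier G. \<forall>w\<in>W. x \<otimes> w = w \<otimes> x}"
  have "inv a \<otimes> w = w \<otimes> inv a" if w: "w \<in> W" for w
  proof -
    have c: "a \<in> carrier G" "w \<in> carrier G" "a \<otimes> w = w \<otimes> a" using a w W by auto
    then have "inv a \<otimes> (a \<otimes> w) \<otimes> inv a = inv a \<otimes> (w \<otimes> a) \<otimes> inv a" by simp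
    then show ?thesis using c(1,2) by (simp add: m_assoc inv_mult_cancel_left)
  qed
  then show "inv a \<in> {x \<in> carrier G. \<forall>w\<in>W. x \<otimes> w = w \<otimes> x}" using a by auto
  fix b assume b: "b \<in> {x \<in> carrier G. \<forall>w\<in>W. x \<otimes> w = w \<otimes> x}"
  have "a \<otimes> b \<otimes> w = w \<otimes> (a \<otimes> b)" if w: "w \<in> W" for w
  proof -
    have c: "a \<in> carrier G" "b \<in> carrier G" "w \<in> carrier G" "a \<otimes> w = w \<otimes> a" "b \<otimes> w = w \<otimes> b"
      using a b w W by auto
    have "a \<otimes> b \<otimes> w = a \<otimes> (b \<otimes> w)" using c by (simp add: m_assoc)
    also have "\<dots> = a \<otimes> w \<otimes> b" using c(1-3) by (simp add: c(5) m_assoc)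
    also have "\<dots> = w \<otimes> (a \<otimes> b)" using c(1-3) by (simp add: c(4) m_assoc)
    finally show ?thesis .
  qed
  then show "a \<otimes> b \<in> {x \<in> carrier G. \<forall>w\<in>W. x \<otimes> w = w \<otimes> x}" using a b by auto
qed auto

lemma (in group) generate_commute:
  assumes U: "U \<subseteq> carrier G" and V: "V \<subseteq> carrier G"
    and comm: "\<And>u v. u \<in> U \<Longrightarrow> v \<in> V \<Longrightarrow> u \<otimes> v = v \<otimes> u"
    and x: "x \<in> generate G U" and y: "y \<in> generate G V"
  shows "x \<otimes> y = y \<otimes> x"
proof -
  have "U \<subseteq> {x \<in> carrier G. \<forall>w\<in>V. x \<otimes> w = w \<otimes> x}" using U comm by auto
  then have "generate G U \<subseteq> {x \<in> carrier G. \<forall>w\<in>V. x \<otimes> w = w \<otimes> x}"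
    using generate_subgroup_incl centralizer_subgroup[OF V] by blast
  then have xc: "x \<in> carrier G" "\<forall>v\<in>V. x \<otimes> v = v \<otimes> x" using x by auto
  then have "V \<subseteq> {y \<in> carrier G. \<forall>w\<in>{x}. y \<otimes> w = w \<otimes> y}" using V by auto
  then have "generate G V \<subseteq> {y \<in> carrier G. \<forall>w\<in>{x}. y \<otimes> w = w \<otimes> y}"
    using generate_subgroup_incl centralizer_subgroup[of "{x}"] xc(1) by blast
  then show ?thesis using y by auto
qed

lemma (in group) minimal_normal_eq_generate_conjugates:
  assumes N: "minimal_invariant_subgroup G (carrier G) N"
    and S: "minimal_invariant_subgroup G N S" "S \<subseteq> N"
  shows "N = generate G (\<Union>g\<in>carrier G. conjugate_set G g S)"
proof -
  let ?U = "\<Union>g\<in>carrier G. conjugate_set G g S"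
  have iN: "invariant_subgroup G (carrier G) N" and sN: "subgroup N G"
    using N unfolding minimal_invariant_subgroup_def invariant_subgroup_def by auto
  have sS: "subgroup S G" and S1: "S \<noteq> {\<one>}"
    using S unfolding minimal_invariant_subgroup_def invariant_subgroup_def by auto
  have UN: "?U \<subseteq> N" using iN S(2) by (auto simp: invariant_subgroup_def conjugate_set_def)
  then have Uc: "?U \<subseteq> carrier G" using subgroup.subset[OF sN] by blast
  have "g \<otimes> u \<otimes> inv g \<in> ?U" if u: "u \<in> ?U" and g: "g \<in> carrier G" for u g
  proof -
    obtain h where h: "h \<in> carrier G" "u \<in> conjugate_set G h S" using u by blast
    then have "g \<otimes> u \<otimes> inv g \<in> conjugate_set G g (conjugate_set G h S)"
      by (auto simp: conjugate_set_def)
    then show ?thesis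
      using conjugate_set_mult[OF subgroup.subset[OF sS] g h(1)] m_closed[OF g h(1)] by blast
  qed
  then have "generate G ?U \<lhd> G" by (intro normal_generateI[OF Uc]) auto
  then have "invariant_subgroup G (carrier G) (generate G ?U)"
    using normal_inv_iff unfolding invariant_subgroup_def by auto
  moreover have "generate G ?U \<subseteq> N" using generate_subgroup_incl[OF UN sN] .
  moreover have "generate G ?U \<noteq> {\<one>}"
  proof -
    have "conjugate_set G \<one> S \<subseteq> ?U" by (rule UN_upper[OF one_closed])
    then have "S \<subseteq> ?U" using conjugate_set_one[OF subgroup.subset[OF sS]] by simp
    then have "S \<subseteq> generate G ?U" using generate.incl[of _ ?U G] by (meson subset_iff)
    then show ?thesis using S1 subgroup.one_closed[OF sS] by auto
  qed
  ultimately show ?thesis using N unfolding minimal_invariant_subgroup_def by blast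
qed

text \<open>Distinct conjugates of \<open>S\<close> commute. If \<open>S\<close> were abelian, then so would be the group \<open>N\<close> they generate.
For the same reason a normal subgroup of \<open>S\<close> is normalized by all conjugates of \<open>S\<close>, hence by
\<open>N\<close>, and minimality of \<open>S\<close> in \<open>N\<close> shows that \<open>S\<close> is simple.\<close>

lemma (in group) minimal_normal_factor:
  assumes N: "minimal_invariant_subgroup G (carrier G) N"
    and nonab: "\<not> (\<forall>x\<in>N. \<forall>y\<in>N. x \<otimes> y = y \<otimes> x)"
    and S: "minimal_invariant_subgroup G N S" "S \<subseteq> N"
  shows "\<not> (\<forall>x\<in>S. \<forall>y\<in>S. x \<otimes> y = y \<otimes> x)"
    and "minimal_invariant_subgroup G S S"
proof -
  let ?T = "\<lambda>g. conjugate_set G g S"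
  let ?U = "\<Union>g\<in>carrier G. ?T g"
  have iN: "invariant_subgroup G (carrier G) N" and sN: "subgroup N G"
    using N unfolding minimal_invariant_subgroup_def invariant_subgroup_def by auto
  have iS: "invariant_subgroup G N S" and sS: "subgroup S G"
    using S unfolding minimal_invariant_subgroup_def invariant_subgroup_def by auto
  have TN: "?T g \<subseteq> N" if "g \<in> carrier G" for g
    using that iN S(2) by (auto simp: invariant_subgroup_def conjugate_set_def)
  have Tm: "minimal_invariant_subgroup G N (?T g)" if "g \<in> carrier G" for g
    using minimal_invariant_subgroup_conjugate[OF iN S(1) that] .
  have gen: "N = generate G ?U" using minimal_normal_eq_generate_conjugates[OF N S] .
  have Uc: "?U \<subseteq> carrier G" using TN subgroup.subset[OF sN] by blast
  show "\<not> (\<forall>x\<in>S. \<forall>y\<in>S. x \<otimes> y = y \<otimes> x)"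
  proof
    assume ab: "\<forall>x\<in>S. \<forall>y\<in>S. x \<otimes> y = y \<otimes> x"
    have Tab: "x \<otimes> y = y \<otimes> x" if g: "g \<in> carrier G" and xy: "x \<in> ?T g" "y \<in> ?T g" for g x y
    proof -
      obtain s t where st: "s \<in> S" "t \<in> S" "x = g \<otimes> s \<otimes> inv g" "y = g \<otimes> t \<otimes> inv g"
        using xy unfolding conjugate_set_def by blast
      then have c: "s \<in> carrier G" "t \<in> carrier G" using subgroup.mem_carrier[OF sS] by auto
      have "x \<otimes> y = g \<otimes> (s \<otimes> t) \<otimes> inv g"
        using c g st by (simp add: m_assoc inv_mult_cancel_left)
      also have "\<dots> = g \<otimes> (t \<otimes> s) \<otimes> inv g" using ab st by simp
      also have "\<dots> = y \<otimes> x" using c g st by (simp add: m_assoc inv_mult_cancel_left)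
      finally show ?thesis .
    qed
    have "x \<otimes> y = y \<otimes> x" if xy: "x \<in> ?U" "y \<in> ?U" for x y
    proof -
      obtain g h where gh: "g \<in> carrier G" "h \<in> carrier G" "x \<in> ?T g" "y \<in> ?T h" using xy by blast
      then show ?thesis
        using minimal_invariant_subgroups_eq_or_commute[OF Tm[OF gh(1)] TN[OF gh(1)] Tm[OF gh(2)] TN[OF gh(2)]]
          Tab[OF gh(1), of x y] by blast
    qed
    then have "x \<otimes> y = y \<otimes> x" if "x \<in> generate G ?U" "y \<in> generate G ?U" for x y
      using generate_commute[OF Uc Uc _ that] by blast
    then show False using nonab gen by blast
  qed
  show "minimal_invariant_subgroup G S S"
    unfolding minimal_invariant_subgroup_def
  proof (intro conjI allI impI)
    show "invariant_subgroup G S S" using iS S(2) unfolding invariant_subgroup_def by blast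
    show "S \<noteq> {\<one>}" using S(1) unfolding minimal_invariant_subgroup_def by blast
  next
    fix K assume K: "invariant_subgroup G S K \<and> K \<subseteq> S"
    have sK: "subgroup K G" using K unfolding invariant_subgroup_def by blast
    have inU: "u \<otimes> k \<otimes> inv u \<in> K" if u: "u \<in> ?U" and k: "k \<in> K" for u k
    proof -
      obtain g where g: "g \<in> carrier G" "u \<in> ?T g" using u by blast
      consider "?T g = S" | "\<forall>s\<in>?T g. \<forall>t\<in>S. s \<otimes> t = t \<otimes> s"
        using minimal_invariant_subgroups_eq_or_commute[OF Tm[OF g(1)] TN[OF g(1)] S] by blast
      then show ?thesis
      proof cases
        case 1
        then show ?thesis using K g k unfolding invariant_subgroup_def by blast
      next
        case 2
        have c: "u \<in> carrier G" "k \<in> carrier G"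
          using u Uc k subgroup.mem_carrier[OF sK] by auto
        have "u \<otimes> k = k \<otimes> u" using 2 g K k by blast
        then show ?thesis using c k by (simp add: m_assoc)
      qed
    qed
    have inU': "inv u \<in> ?U" if "u \<in> ?U" for u
      using that subgroup.m_inv_closed[OF conjugate_set_subgroup[OF sS]] by blast
    have "n \<otimes> k \<otimes> inv n \<in> K" if "n \<in> generate G ?U" "k \<in> K" for n k
      using that
    proof (induction n arbitrary: k rule: generate.induct)
      case one
      then show ?case using subgroup.mem_carrier[OF sK] by simp
    next
      case (incl h)
      then show ?case using inU by blast
    next
      case (inv h)
      then show ?case using inU[OF inU'] by blast
    next
      case (eng h1 h2)
      have c: "h1 \<in> carrier G" "h2 \<in> carrier G" "k \<in> carrier G"
        using eng generate_in_carrier[OF Uc] subgroup.mem_carrier[OF sK] by auto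
      have "h1 \<otimes> (h2 \<otimes> k \<otimes> inv h2) \<otimes> inv h1 \<in> K" using eng by blast
      then show ?case using c by (simp add: m_assoc inv_mult_group)
    qed
    then have "invariant_subgroup G N K" using sK gen unfolding invariant_subgroup_def by blast
    then show "K = {\<one>} \<or> K = S" using S(1) K unfolding minimal_invariant_subgroup_def by blast
  qed
qed

text \<open>Descent along the subnormal series of \<open>A\<close>. Suppose \<open>S \<subseteq> K\<close> and \<open>H\<close> is normal in \<open>K\<close>; by
simplicity the only case of interest is that \<open>S \<inter> H\<close> is trivial. Let \<open>g \<in> H\<close>. If \<open>g\<close> normalizes \<open>S\<close>,
then commutators of \<open>g\<close> with elements of \<open>S\<close> lie in \<open>S \<inter> H\<close>, so \<open>g\<close> centralizes \<open>S\<close>. Otherwise the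
conjugate of \<open>S\<close> by \<open>g\<close> commutes with \<open>S\<close>, and the commutator of two elements of \<open>S\<close> can be
rewritten as an element of \<open>H\<close>, so \<open>S\<close> would be abelian.\<close>

lemma simple_factor_le_or_centralizes_subnormal:
  fixes G (structure)
  assumes "subnormal A G" and "group G"
    and S: "minimal_invariant_subgroup G S S" and nonab: "\<not> (\<forall>x\<in>S. \<forall>y\<in>S. x \<otimes> y = y \<otimes> x)"
    and conj: "\<And>g. g \<in> carrier G \<Longrightarrow>
      conjugate_set G g S = S \<or> (\<forall>s\<in>conjugate_set G g S. \<forall>t\<in>S. s \<otimes> t = t \<otimes> s)"
  shows "S \<subseteq> A \<or> (\<forall>s\<in>S. \<forall>a\<in>A. s \<otimes> a = a \<otimes> s)"
  using assms
proof (induction rule: subnormal.induct)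
  case (whole G)
  then show ?case
    using subgroup.subset unfolding minimal_invariant_subgroup_def invariant_subgroup_def by blast
next
  case (step K G H)
  interpret group G by fact
  have iS: "invariant_subgroup G S S" and sS: "subgroup S G"
    using step.prems(2) unfolding minimal_invariant_subgroup_def invariant_subgroup_def by auto
  have K: "subgroup K G" using subnormal_imp_subgroup[OF step.hyps(1)] is_group by blast
  have H: "subgroup H G" "H \<subseteq> K" "\<And>k h. k \<in> K \<Longrightarrow> h \<in> H \<Longrightarrow> k \<otimes>\<^bsub>G\<^esub> h \<otimes>\<^bsub>G\<^esub> inv\<^bsub>G\<^esub> k \<in> H"
    using step.hyps(2) normal_in_subgroup_iff[OF is_group K, of H] by auto
  have "S \<subseteq> K \<or> (\<forall>s\<in>S. \<forall>a\<in>K. s \<otimes>\<^bsub>G\<^esub> a = a \<otimes>\<^bsub>G\<^esub> s)"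
    using step.IH step.prems by blast
  then show ?case
  proof
    assume "\<forall>s\<in>S. \<forall>a\<in>K. s \<otimes>\<^bsub>G\<^esub> a = a \<otimes>\<^bsub>G\<^esub> s"
    then show ?thesis using H(2) by blast
  next
    assume SK: "S \<subseteq> K"
    have "invariant_subgroup G S (S \<inter> H)"
      using iS H(3) SK subgroups_Inter_pair[OF sS H(1)] unfolding invariant_subgroup_def by blast
    then have "S \<inter> H = {\<one>\<^bsub>G\<^esub>} \<or> S \<inter> H = S"
      using step.prems(2) unfolding minimal_invariant_subgroup_def by blast
    then show ?thesis
    proof
      assume "S \<inter> H = S"
      then show ?thesis by blast
    next
      assume SH: "S \<inter> H = {\<one>\<^bsub>G\<^esub>}"
      note mS = subgroup.m_closed[OF sS] and iiS = subgroup.m_inv_closed[OF sS]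
        and mH = subgroup.m_closed[OF H(1)] and iH = subgroup.m_inv_closed[OF H(1)]
      have nH: "inv\<^bsub>G\<^esub> s \<otimes>\<^bsub>G\<^esub> h \<otimes>\<^bsub>G\<^esub> s \<in> H" if "s \<in> S" "h \<in> H" for s h
        using H(3)[of "inv\<^bsub>G\<^esub> s" h] that SK iiS subgroup.mem_carrier[OF sS] by auto
      have "s \<otimes>\<^bsub>G\<^esub> g = g \<otimes>\<^bsub>G\<^esub> s" if s: "s \<in> S" and g: "g \<in> H" for s g
      proof -
        have c: "s \<in> carrier G" "g \<in> carrier G"
          using s g subgroup.mem_carrier[OF sS] subgroup.mem_carrier[OF H(1)] by auto
        have "conjugate_set G g S = S"
        proof (rule ccontr)
          assume "conjugate_set G g S \<noteq> S"
          then have comm: "\<forall>u\<in>conjugate_set G g S. \<forall>t\<in>S. u \<otimes>\<^bsub>G\<^esub> t = t \<otimes>\<^bsub>G\<^esub> u"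
            using step.prems(4)[OF c(2)] by blast
          have "a \<otimes>\<^bsub>G\<^esub> t = t \<otimes>\<^bsub>G\<^esub> a" if a: "a \<in> S" and t: "t \<in> S" for a t
          proof -
            have c': "a \<in> carrier G" "t \<in> carrier G" using a t subgroup.mem_carrier[OF sS] by auto
            \<comment> \<open>As \<open>u\<close> commutes with \<open>t\<close>, it drops out of the commutator of \<open>t\<close> with \<open>a\<^sup>-\<^sup>1 u \<in> H\<close>.\<close>
            define u where "u = g \<otimes>\<^bsub>G\<^esub> a \<otimes>\<^bsub>G\<^esub> inv\<^bsub>G\<^esub> g"
            have uc: "u \<in> carrier G" using c c' by (simp add: u_def)
            have "u \<otimes>\<^bsub>G\<^esub> t = t \<otimes>\<^bsub>G\<^esub> u"
              using comm a t unfolding u_def conjugate_set_def by blast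
            have "inv\<^bsub>G\<^esub> a \<otimes>\<^bsub>G\<^esub> g \<otimes>\<^bsub>G\<^esub> a \<otimes>\<^bsub>G\<^esub> inv\<^bsub>G\<^esub> g \<in> H" using mH[OF nH[OF a g] iH[OF g]] .
            then have zH: "inv\<^bsub>G\<^esub> a \<otimes>\<^bsub>G\<^esub> u \<in> H" using c c' by (simp add: u_def m_assoc)
            have "inv\<^bsub>G\<^esub> t \<otimes>\<^bsub>G\<^esub> (inv\<^bsub>G\<^esub> a \<otimes>\<^bsub>G\<^esub> u) \<otimes>\<^bsub>G\<^esub> t \<otimes>\<^bsub>G\<^esub> inv\<^bsub>G\<^esub> (inv\<^bsub>G\<^esub> a \<otimes>\<^bsub>G\<^esub> u) \<in> H"
              using mH[OF nH[OF t zH] iH[OF zH]] .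
            moreover have "inv\<^bsub>G\<^esub> t \<otimes>\<^bsub>G\<^esub> (inv\<^bsub>G\<^esub> a \<otimes>\<^bsub>G\<^esub> u) \<otimes>\<^bsub>G\<^esub> t \<otimes>\<^bsub>G\<^esub> inv\<^bsub>G\<^esub> (inv\<^bsub>G\<^esub> a \<otimes>\<^bsub>G\<^esub> u)
                = inv\<^bsub>G\<^esub> t \<otimes>\<^bsub>G\<^esub> inv\<^bsub>G\<^esub> a \<otimes>\<^bsub>G\<^esub> (u \<otimes>\<^bsub>G\<^esub> t) \<otimes>\<^bsub>G\<^esub> inv\<^bsub>G\<^esub> u \<otimes>\<^bsub>G\<^esub> a"
              using c' uc by (simp add: m_assoc inv_mult_group)
            moreover have "\<dots> = inv\<^bsub>G\<^esub> t \<otimes>\<^bsub>G\<^esub> inv\<^bsub>G\<^esub> a \<otimes>\<^bsub>G\<^esub> t \<otimes>\<^bsub>G\<^esub> a"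
              using c' uc by (simp add: \<open>u \<otimes>\<^bsub>G\<^esub> t = t \<otimes>\<^bsub>G\<^esub> u\<close> m_assoc inv_mult_cancel_left)
            ultimately have "inv\<^bsub>G\<^esub> t \<otimes>\<^bsub>G\<^esub> inv\<^bsub>G\<^esub> a \<otimes>\<^bsub>G\<^esub> t \<otimes>\<^bsub>G\<^esub> a \<in> H" by simp
            moreover have "inv\<^bsub>G\<^esub> t \<otimes>\<^bsub>G\<^esub> inv\<^bsub>G\<^esub> a \<otimes>\<^bsub>G\<^esub> t \<otimes>\<^bsub>G\<^esub> a \<in> S"
              using mS[OF mS[OF mS[OF iiS[OF t] iiS[OF a]] t] a] .
            ultimately have "inv\<^bsub>G\<^esub> t \<otimes>\<^bsub>G\<^esub> inv\<^bsub>G\<^esub> a \<otimes>\<^bsub>G\<^esub> t \<otimes>\<^bsub>G\<^esub> a = \<one>\<^bsub>G\<^esub>" using SH by blast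
            then have "inv\<^bsub>G\<^esub> (a \<otimes>\<^bsub>G\<^esub> t) \<otimes>\<^bsub>G\<^esub> (t \<otimes>\<^bsub>G\<^esub> a) = \<one>\<^bsub>G\<^esub>"
              using c' by (simp add: m_assoc inv_mult_group)
            then have "(a \<otimes>\<^bsub>G\<^esub> t) \<otimes>\<^bsub>G\<^esub> (inv\<^bsub>G\<^esub> (a \<otimes>\<^bsub>G\<^esub> t) \<otimes>\<^bsub>G\<^esub> (t \<otimes>\<^bsub>G\<^esub> a)) = a \<otimes>\<^bsub>G\<^esub> t" using c' by simp
            then show ?thesis using c' inv_mult_cancel_left(2)[of "a \<otimes>\<^bsub>G\<^esub> t" "t \<otimes>\<^bsub>G\<^esub> a"] by simp
          qed
          then show False using step.prems(3) by blast
        qed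
        then have "g \<otimes>\<^bsub>G\<^esub> s \<otimes>\<^bsub>G\<^esub> inv\<^bsub>G\<^esub> g \<in> S" using s unfolding conjugate_set_def by blast
        then have "g \<otimes>\<^bsub>G\<^esub> s \<otimes>\<^bsub>G\<^esub> inv\<^bsub>G\<^esub> g \<otimes>\<^bsub>G\<^esub> inv\<^bsub>G\<^esub> s \<in> S" using s iiS mS by blast
        moreover have "g \<otimes>\<^bsub>G\<^esub> (s \<otimes>\<^bsub>G\<^esub> inv\<^bsub>G\<^esub> g \<otimes>\<^bsub>G\<^esub> inv\<^bsub>G\<^esub> s) \<in> H"
          using H(3)[of s "inv\<^bsub>G\<^esub> g"] s g SK iH mH by blast
        moreover have "g \<otimes>\<^bsub>G\<^esub> (s \<otimes>\<^bsub>G\<^esub> inv\<^bsub>G\<^esub> g \<otimes>\<^bsub>G\<^esub> inv\<^bsub>G\<^esub> s) = g \<otimes>\<^bsub>G\<^esub> s \<otimes>\<^bsub>G\<^esub> inv\<^bsub>G\<^esub> g \<otimes>\<^bsub>G\<^esub> inv\<^bsub>G\<^esub> s"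
          using c by (simp add: m_assoc)
        ultimately have "g \<otimes>\<^bsub>G\<^esub> s \<otimes>\<^bsub>G\<^esub> inv\<^bsub>G\<^esub> g \<otimes>\<^bsub>G\<^esub> inv\<^bsub>G\<^esub> s = \<one>\<^bsub>G\<^esub>" using SH by auto
        then have "g \<otimes>\<^bsub>G\<^esub> s \<otimes>\<^bsub>G\<^esub> inv\<^bsub>G\<^esub> (s \<otimes>\<^bsub>G\<^esub> g) = \<one>\<^bsub>G\<^esub>"
          using c by (simp add: m_assoc inv_mult_group)
        then show ?thesis using c inv_equality[of "g \<otimes>\<^bsub>G\<^esub> s" "inv\<^bsub>G\<^esub> (s \<otimes>\<^bsub>G\<^esub> g)"] by simp
      qed
      then show ?thesis by blast
    qed
  qed
qed

text \<open>A maximal \<open>\<XX>\<close>-subgroup contains all the generating subgroups, so it is the whole group.\<close>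

lemma in_class_if_generated_by_normal_class_subgroups:
  fixes G (structure)
  assumes X: "complete_class \<XX>" and G: "group G" and fin: "finite (carrier G)"
    and gen: "carrier G = generate G (\<Union>F)"
    and F: "\<And>T. T \<in> F \<Longrightarrow> T \<lhd> G \<and> class_subgroup \<XX> G T"
  shows "in_class G \<XX>"
proof -
  interpret group G by fact
  obtain M where M: "M \<in> maximal_class_subgroups \<XX> G"
    using maximal_class_subgroup_exists[OF fin class_subgroup_trivial[OF X G]] by blast
  then have cM: "class_subgroup \<XX> G M" unfolding maximal_class_subgroups_def by blast
  then have sM: "subgroup M G" unfolding class_subgroup_def by blast
  have "\<Union>F \<subseteq> M"
    using maximal_class_subgroup_absorbs_normal[OF X fin M] F by blast
  then have "carrier G \<subseteq> M" using generate_subgroup_incl[OF _ sM] gen by simp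
  then have "M = carrier G" using subgroup.subset[OF sM] by blast
  then show ?thesis using cM unfolding class_subgroup_def by simp
qed

text \<open>A nonabelian simple \<open>T\<close> has trivial centre, so an element of \<open>Q\<close> acts on \<open>T\<close> like at most one element of
\<open>T\<close>. Sending it to that element is a homomorphism from a subgroup of \<open>Q\<close> onto \<open>T\<close>.\<close>

lemma class_subgroup_if_inner_action_realized:
  fixes G (structure)
  assumes X: "complete_class \<XX>" and G: "group G" and Q: "class_subgroup \<XX> G Q"
    and T: "minimal_invariant_subgroup G T T" and nonab: "\<not> (\<forall>x\<in>T. \<forall>y\<in>T. x \<otimes> y = y \<otimes> x)"
    and act: "\<And>s. s \<in> T \<Longrightarrow> \<exists>x\<in>Q. \<forall>t\<in>T. s \<otimes> t \<otimes> inv s = x \<otimes> t \<otimes> inv x"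
  shows "class_subgroup \<XX> G T"
proof -
  interpret group G by fact
  have sT: "subgroup T G" using T unfolding minimal_invariant_subgroup_def invariant_subgroup_def by blast
  have sQ: "subgroup Q G" using Q unfolding class_subgroup_def by blast
  note Tc = subgroup.mem_carrier[OF sT] and Qc = subgroup.mem_carrier[OF sQ]
    and mT = subgroup.m_closed[OF sT] and iT = subgroup.m_inv_closed[OF sT]
  have "invariant_subgroup G T {z \<in> T. \<forall>t\<in>T. z \<otimes> t = t \<otimes> z}"
  proof -
    have "{z \<in> T. \<forall>t\<in>T. z \<otimes> t = t \<otimes> z} = T \<inter> {z \<in> carrier G. \<forall>t\<in>T. z \<otimes> t = t \<otimes> z}"
      using Tc by blast
    then have "subgroup {z \<in> T. \<forall>t\<in>T. z \<otimes> t = t \<otimes> z} G"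
      using subgroups_Inter_pair[OF sT centralizer_subgroup[OF subgroup.subset[OF sT]]] by simp
    moreover have "n \<otimes> z \<otimes> inv n = z" if "n \<in> T" "z \<in> T" "\<forall>t\<in>T. z \<otimes> t = t \<otimes> z" for n z
    proof -
      have "n \<otimes> z = z \<otimes> n" using that by simp
      then have "n \<otimes> z \<otimes> inv n = z \<otimes> n \<otimes> inv n" by simp
      then show ?thesis using Tc[OF that(1)] Tc[OF that(2)] by (simp add: m_assoc)
    qed
    ultimately show ?thesis unfolding invariant_subgroup_def by auto
  qed
  then have "{z \<in> T. \<forall>t\<in>T. z \<otimes> t = t \<otimes> z} = {\<one>} \<or> {z \<in> T. \<forall>t\<in>T. z \<otimes> t = t \<otimes> z} = T"
    using T unfolding minimal_invariant_subgroup_def by blast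
  then have centre: "{z \<in> T. \<forall>t\<in>T. z \<otimes> t = t \<otimes> z} = {\<one>}" using nonab by blast
  define same where "same x s \<longleftrightarrow> s \<in> T \<and> (\<forall>t\<in>T. s \<otimes> t \<otimes> inv s = x \<otimes> t \<otimes> inv x)" for x s
  have same_mult: "same (x \<otimes> y) (s \<otimes> s')" if "same x s" "same y s'" "x \<in> Q" "y \<in> Q" for x y s s'
    unfolding same_def
  proof (intro conjI ballI)
    show "s \<otimes> s' \<in> T" using that mT unfolding same_def by blast
    fix t assume t: "t \<in> T"
    have s: "s \<in> T" "s' \<in> T" using that unfolding same_def by auto
    have u: "s' \<otimes> t \<otimes> inv s' \<in> T" using s t mT iT by blast
    have "(s \<otimes> s') \<otimes> t \<otimes> inv (s \<otimes> s') = s \<otimes> (s' \<otimes> t \<otimes> inv s') \<otimes> inv s"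
      using s t Tc by (simp add: m_assoc inv_mult_group)
    also have "\<dots> = x \<otimes> (y \<otimes> t \<otimes> inv y) \<otimes> inv x"
      using that u t unfolding same_def by auto
    also have "\<dots> = (x \<otimes> y) \<otimes> t \<otimes> inv (x \<otimes> y)"
      using that(3,4) t Tc Qc by (simp add: m_assoc inv_mult_group)
    finally show "s \<otimes> s' \<otimes> t \<otimes> inv (s \<otimes> s') = x \<otimes> y \<otimes> t \<otimes> inv (x \<otimes> y)" .
  qed
  have same_inv: "same (inv x) (inv s)" if "same x s" "x \<in> Q" for x s
    unfolding same_def
  proof (intro conjI ballI)
    have s: "s \<in> T" using that unfolding same_def by auto
    then show "inv s \<in> T" using iT by blast
    fix t assume t: "t \<in> T"
    let ?u = "inv s \<otimes> t \<otimes> inv (inv s)"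
    have u: "?u \<in> T" using mT[OF mT[OF iT[OF s] t] iT[OF iT[OF s]]] .
    have "t = s \<otimes> ?u \<otimes> inv s" using s t Tc by (simp add: m_assoc inv_mult_cancel_left)
    also have "\<dots> = x \<otimes> ?u \<otimes> inv x" using that u unfolding same_def by blast
    finally have t_eq: "t = x \<otimes> ?u \<otimes> inv x" .
    have "inv x \<otimes> t \<otimes> inv (inv x) = inv x \<otimes> (x \<otimes> ?u \<otimes> inv x) \<otimes> inv (inv x)" using t_eq by simp
    also have "\<dots> = ?u" using Tc[OF u] Qc[OF that(2)] by (simp add: m_assoc inv_mult_cancel_left del: inv_inv)
    finally show "?u = inv x \<otimes> t \<otimes> inv (inv x)" by simp
  qed
  have same_one: "same \<one> \<one>" using subgroup.one_closed[OF sT] Tc unfolding same_def by simp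
  have same_unique: "s = s'" if "same x s" "same x s'" for x s s'
  proof -
    have s: "s \<in> T" "s' \<in> T" using that unfolding same_def by auto
    have "inv s' \<otimes> s \<in> {z \<in> T. \<forall>t\<in>T. z \<otimes> t = t \<otimes> z}"
    proof (intro CollectI conjI ballI)
      show "inv s' \<otimes> s \<in> T" using s mT iT by blast
      fix t assume t: "t \<in> T"
      have eq: "s \<otimes> t \<otimes> inv s = s' \<otimes> t \<otimes> inv s'" using that t unfolding same_def by simp
      have "inv s' \<otimes> s \<otimes> t = inv s' \<otimes> (s \<otimes> t \<otimes> inv s) \<otimes> s" using s t Tc by (simp add: m_assoc)
      also have "\<dots> = t \<otimes> (inv s' \<otimes> s)"
        unfolding eq using s t Tc by (simp add: m_assoc inv_mult_cancel_left)
      finally show "inv s' \<otimes> s \<otimes> t = t \<otimes> (inv s' \<otimes> s)" .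
    qed
    then have "inv s' \<otimes> s = \<one>" using centre by blast
    then show ?thesis using s Tc inv_mult_cancel_left(2)[of s' s] by simp
  qed
  define P where "P = {x \<in> Q. \<exists>s. same x s}"
  have sP: "subgroup P G"
  proof (rule subgroupI)
    show "P \<noteq> {}" using same_one subgroup.one_closed[OF sQ] unfolding P_def by blast
    show "inv a \<in> P" if "a \<in> P" for a
      using that same_inv subgroup.m_inv_closed[OF sQ] unfolding P_def by blast
    show "a \<otimes> b \<in> P" if "a \<in> P" "b \<in> P" for a b
      using that same_mult subgroup.m_closed[OF sQ] unfolding P_def by blast
  qed (use Qc in \<open>auto simp: P_def\<close>)
  have cP: "class_subgroup \<XX> G P"
    using class_subgroup_mono[OF X G Q sP] by (auto simp: P_def)
  define \<eta> where "\<eta> x = (THE s. same x s)" for x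
  have \<eta>: "\<eta> x = s" if "same x s" for x s
    unfolding \<eta>_def using that same_unique by blast
  have \<eta>s: "same x (\<eta> x)" if "x \<in> P" for x
    using that \<eta> unfolding P_def by auto
  have "\<eta> \<in> hom (G\<lparr>carrier := P\<rparr>) (G\<lparr>carrier := T\<rparr>)"
  proof (rule homI)
    show "\<eta> x \<in> carrier (G\<lparr>carrier := T\<rparr>)" if "x \<in> carrier (G\<lparr>carrier := P\<rparr>)" for x
      using \<eta>s that unfolding same_def by simp
    show "\<eta> (x \<otimes>\<^bsub>G\<lparr>carrier := P\<rparr>\<^esub> y) = \<eta> x \<otimes>\<^bsub>G\<lparr>carrier := T\<rparr>\<^esub> \<eta> y"
      if "x \<in> carrier (G\<lparr>carrier := P\<rparr>)" "y \<in> carrier (G\<lparr>carrier := P\<rparr>)" for x y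
      using \<eta>[OF same_mult[OF \<eta>s \<eta>s]] that by (simp add: P_def)
  qed
  moreover have "\<eta> ` P = T"
  proof
    show "\<eta> ` P \<subseteq> T" using \<eta>s unfolding same_def by blast
    show "T \<subseteq> \<eta> ` P"
    proof
      fix s assume s: "s \<in> T"
      then obtain x where "x \<in> Q" "same x s" using act unfolding same_def by blast
      then show "s \<in> \<eta> ` P" using \<eta>[of x s] unfolding P_def by blast
    qed
  qed
  ultimately have "\<eta> \<in> epi (G\<lparr>carrier := P\<rparr>) (G\<lparr>carrier := T\<rparr>)" by (simp add: epi_def)
  then have "in_class (G\<lparr>carrier := T\<rparr>) \<XX>"
    using in_class_epi_image[OF X _ subgroup_imp_group[OF sT]] cP unfolding class_subgroup_def by blast
  then show ?thesis using sT unfolding class_subgroup_def by blast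
qed

text \<open>On each conjugate of the simple factor \<open>S\<close>, the element \<open>a\<close> acts as an element of \<open>Q\<close>: if \<open>A\<close>
contains the conjugate then \<open>B\<close> centralizes it and \<open>a\<close> acts as \<open>a b\<close>, and otherwise \<open>a\<close> acts trivially.
Elements of \<open>Q\<close> permute the conjugates, so this property passes to the group generated by \<open>Q\<close> and \<open>a\<close>,
that is, to \<open>G\<close>, in particular to the elements of \<open>S\<close> itself.\<close>

lemma nonabelian_minimal_normal_in_class:
  fixes G (structure)
  assumes X: "complete_class \<XX>" and G: "group G" and fin: "finite (carrier G)"
    and N: "minimal_invariant_subgroup G (carrier G) N"
    and nonab: "\<not> (\<forall>x\<in>N. \<forall>y\<in>N. x \<otimes> y = y \<otimes> x)"
    and Q: "class_subgroup \<XX> G Q" and gen: "generate G (insert a Q) = carrier G"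
    and A: "subnormal A G" and B: "subnormal B G"
    and comm: "\<And>x y. x \<in> A \<Longrightarrow> y \<in> B \<Longrightarrow> x \<otimes> y = y \<otimes> x"
    and a: "a \<in> A" and b: "b \<in> B" and ab: "a \<otimes> b \<in> Q"
  shows "class_subgroup \<XX> G N"
proof -
  interpret group G by fact
  have iN: "invariant_subgroup G (carrier G) N" and N1: "N \<noteq> {\<one>}"
    using N unfolding minimal_invariant_subgroup_def by auto
  then have sN: "subgroup N G" unfolding invariant_subgroup_def by blast
  have sQ: "subgroup Q G" using Q unfolding class_subgroup_def by blast
  have ac: "a \<in> carrier G" and bc: "b \<in> carrier G"
    using a b subgroup.mem_carrier[OF subnormal_imp_subgroup[OF A G]]
      subgroup.mem_carrier[OF subnormal_imp_subgroup[OF B G]] by auto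
  have "invariant_subgroup G N N"
    using iN subgroup.mem_carrier[OF sN] unfolding invariant_subgroup_def by blast
  then obtain S where S: "minimal_invariant_subgroup G N S" "S \<subseteq> N"
    using minimal_invariant_subgroup_exists[of N G N] N1 finite_subset[OF subgroup.subset[OF sN] fin] by blast
  have sS: "subgroup S G" using S unfolding minimal_invariant_subgroup_def invariant_subgroup_def by blast
  let ?T = "\<lambda>g. conjugate_set G g S"
  have TN: "?T g \<subseteq> N" if "g \<in> carrier G" for g
    using that iN S(2) by (auto simp: invariant_subgroup_def conjugate_set_def)
  have Tm: "minimal_invariant_subgroup G N (?T g)" if "g \<in> carrier G" for g
    using minimal_invariant_subgroup_conjugate[OF iN S(1) that] .
  have sT: "subgroup (?T g) G" if "g \<in> carrier G" for g using conjugate_set_subgroup[OF sS that] .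
  have TT: "conjugate_set G h (?T g) = ?T (h \<otimes> g)" if "g \<in> carrier G" "h \<in> carrier G" for g h
    using conjugate_set_mult[OF subgroup.subset[OF sS] that(2,1)] .
  have dichotomy: "?T g \<subseteq> D \<or> (\<forall>s\<in>?T g. \<forall>d\<in>D. s \<otimes> d = d \<otimes> s)"
    if D: "subnormal D G" and g: "g \<in> carrier G" for D g
  proof (rule simple_factor_le_or_centralizes_subnormal[OF D G])
    show "minimal_invariant_subgroup G (?T g) (?T g)" 
      using minimal_normal_factor(2)[OF N nonab Tm[OF g] TN[OF g]] .
    show "\<not> (\<forall>x\<in>?T g. \<forall>y\<in>?T g. x \<otimes> y = y \<otimes> x)"
      using minimal_normal_factor(1)[OF N nonab Tm[OF g] TN[OF g]] .
    fix h assume h: "h \<in> carrier G"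
    show "conjugate_set G h (?T g) = ?T g \<or>
        (\<forall>s\<in>conjugate_set G h (?T g). \<forall>t\<in>?T g. s \<otimes> t = t \<otimes> s)"
      using minimal_invariant_subgroups_eq_or_commute[of N "?T (h \<otimes> g)" "?T g"] Tm TN TT[OF g h] g h
      by simp
  qed
  have act_a: "\<exists>x\<in>Q. \<forall>t\<in>?T g. a \<otimes> t \<otimes> inv a = x \<otimes> t \<otimes> inv x"
    and act_inv_a: "\<exists>x\<in>Q. \<forall>t\<in>?T g. inv a \<otimes> t \<otimes> inv (inv a) = x \<otimes> t \<otimes> inv x"
    if g: "g \<in> carrier G" for g
  proof -
    consider "?T g \<subseteq> A" | "\<forall>s\<in>?T g. \<forall>d\<in>A. s \<otimes> d = d \<otimes> s" using dichotomy[OF A g] by blast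
    then have "(\<exists>x\<in>Q. \<forall>t\<in>?T g. a \<otimes> t \<otimes> inv a = x \<otimes> t \<otimes> inv x) \<and>
      (\<exists>x\<in>Q. \<forall>t\<in>?T g. inv a \<otimes> t \<otimes> inv (inv a) = x \<otimes> t \<otimes> inv x)"
    proof cases
      case 1
      have "a \<otimes> t \<otimes> inv a = (a \<otimes> b) \<otimes> t \<otimes> inv (a \<otimes> b)
          \<and> inv a \<otimes> t \<otimes> inv (inv a) = inv (a \<otimes> b) \<otimes> t \<otimes> inv (inv (a \<otimes> b))" if t: "t \<in> ?T g" for t
      proof -
        have tc: "t \<in> carrier G" using t subgroup.mem_carrier[OF sT[OF g]] by blast
        have tb: "t \<otimes> b = b \<otimes> t" using comm 1 t b by blast
        have "b \<otimes> t \<otimes> inv b = t" using tb[symmetric] tc bc by (simp add: m_assoc)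
        then have "a \<otimes> t \<otimes> inv a = a \<otimes> (b \<otimes> t \<otimes> inv b) \<otimes> inv a" by simp
        then have 1: "a \<otimes> t \<otimes> inv a = (a \<otimes> b) \<otimes> t \<otimes> inv (a \<otimes> b)"
          using tc ac bc by (simp add: m_assoc inv_mult_group)
        have "inv b \<otimes> (t \<otimes> b) = t" unfolding tb using tc bc by (simp add: inv_mult_cancel_left)
        then have "inv a \<otimes> t \<otimes> inv (inv a) = inv a \<otimes> (inv b \<otimes> t \<otimes> b) \<otimes> a"
          using tc ac bc by (simp add: m_assoc)
        also have "\<dots> = inv (b \<otimes> a) \<otimes> t \<otimes> (b \<otimes> a)"
          using tc ac bc by (simp add: m_assoc inv_mult_group)
        also have "b \<otimes> a = a \<otimes> b" using comm[OF a b] by simp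
        finally show ?thesis using 1 ac bc by simp
      qed
      then show ?thesis using ab subgroup.m_inv_closed[OF sQ ab] by blast
    next
      case 2
      have "a \<otimes> t \<otimes> inv a = \<one> \<otimes> t \<otimes> inv \<one> \<and> inv a \<otimes> t \<otimes> inv (inv a) = \<one> \<otimes> t \<otimes> inv \<one>"
        if t: "t \<in> ?T g" for t
      proof -
        have tc: "t \<in> carrier G" using t subgroup.mem_carrier[OF sT[OF g]] by blast
        have ta: "t \<otimes> a = a \<otimes> t" using 2 t a by blast
        have "a \<otimes> t \<otimes> inv a = t" using ta[symmetric] tc ac by (simp add: m_assoc)
        moreover have "inv a \<otimes> t \<otimes> a = t" using ta tc ac by (simp add: m_assoc inv_mult_cancel_left)
        ultimately show ?thesis using tc ac by simp
      qed
      then show ?thesis using subgroup.one_closed[OF sQ] by blast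
    qed
    then show "\<exists>x\<in>Q. \<forall>t\<in>?T g. a \<otimes> t \<otimes> inv a = x \<otimes> t \<otimes> inv x"
      and "\<exists>x\<in>Q. \<forall>t\<in>?T g. inv a \<otimes> t \<otimes> inv (inv a) = x \<otimes> t \<otimes> inv x" by auto
  qed
  have aQ: "insert a Q \<subseteq> carrier G" using ac subgroup.subset[OF sQ] by blast
  have act: "\<exists>x\<in>Q. \<forall>t\<in>?T g. h \<otimes> t \<otimes> inv h = x \<otimes> t \<otimes> inv x"
    if "h \<in> generate G (insert a Q)" and "g \<in> carrier G" for h g
    using that
  proof (induction h arbitrary: g rule: generate.induct)
    case one
    then show ?case using subgroup.one_closed[OF sQ] by blast
  next
    case (incl h)
    then show ?case using act_a by blast
  next
    case (inv h)
    then show ?case using act_inv_a subgroup.m_inv_closed[OF sQ] by blast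
  next
    case (eng h1 h2)
    have c: "h1 \<in> carrier G" "h2 \<in> carrier G" using eng generate_in_carrier[OF aQ] by auto
    obtain x2 where x2: "x2 \<in> Q" "\<forall>t\<in>?T g. h2 \<otimes> t \<otimes> inv h2 = x2 \<otimes> t \<otimes> inv x2"
      using eng.IH(2)[OF eng.prems] by blast
    have x2c: "x2 \<in> carrier G" using x2(1) subgroup.mem_carrier[OF sQ] by blast
    \<comment> \<open>\<open>h2\<close> moves the conjugate by \<open>g\<close> to the conjugate by \<open>x2 g\<close>, where \<open>h1\<close> has to be imitated.\<close>
    obtain x1 where x1: "x1 \<in> Q" "\<forall>t\<in>?T (x2 \<otimes> g). h1 \<otimes> t \<otimes> inv h1 = x1 \<otimes> t \<otimes> inv x1"
      using eng.IH(1)[OF m_closed[OF x2c eng.prems]] by blast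
    have x1c: "x1 \<in> carrier G" using x1(1) subgroup.mem_carrier[OF sQ] by blast
    have "h1 \<otimes> h2 \<otimes> t \<otimes> inv (h1 \<otimes> h2) = x1 \<otimes> x2 \<otimes> t \<otimes> inv (x1 \<otimes> x2)" if t: "t \<in> ?T g" for t
    proof -
      have tc: "t \<in> carrier G" using t subgroup.mem_carrier[OF sT[OF eng.prems]] by blast
      have "x2 \<otimes> t \<otimes> inv x2 \<in> conjugate_set G x2 (?T g)" using t by (auto simp: conjugate_set_def)
      then have u: "x2 \<otimes> t \<otimes> inv x2 \<in> ?T (x2 \<otimes> g)" using TT[OF eng.prems x2c] by simp
      have "h1 \<otimes> h2 \<otimes> t \<otimes> inv (h1 \<otimes> h2) = h1 \<otimes> (h2 \<otimes> t \<otimes> inv h2) \<otimes> inv h1"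
        using c tc by (simp add: m_assoc inv_mult_group)
      also have "\<dots> = h1 \<otimes> (x2 \<otimes> t \<otimes> inv x2) \<otimes> inv h1" using x2(2) t by simp
      also have "\<dots> = x1 \<otimes> (x2 \<otimes> t \<otimes> inv x2) \<otimes> inv x1" using x1(2) u by blast
      also have "\<dots> = x1 \<otimes> x2 \<otimes> t \<otimes> inv (x1 \<otimes> x2)" 
        using x1c x2c tc by (simp add: m_assoc inv_mult_group)
      finally show ?thesis .
    qed
    then show ?case using subgroup.m_closed[OF sQ x1(1) x2(1)] by blast
  qed
  have cT: "class_subgroup \<XX> G (?T g)" if g: "g \<in> carrier G" for g
  proof (rule class_subgroup_if_inner_action_realized[OF X G Q])
    show "minimal_invariant_subgroup G (?T g) (?T g)" 
      using minimal_normal_factor(2)[OF N nonab Tm[OF g] TN[OF g]] .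
    show "\<not> (\<forall>x\<in>?T g. \<forall>y\<in>?T g. x \<otimes> y = y \<otimes> x)"
      using minimal_normal_factor(1)[OF N nonab Tm[OF g] TN[OF g]] .
    show "\<exists>x\<in>Q. \<forall>t\<in>?T g. s \<otimes> t \<otimes> inv s = x \<otimes> t \<otimes> inv x" if s: "s \<in> ?T g" for s
      using act[OF _ g] gen subgroup.mem_carrier[OF sT[OF g] s] by simp
  qed
  let ?GN = "G\<lparr>carrier := N\<rparr>" and ?F = "?T ` carrier G"
  have "carrier ?GN = generate ?GN (\<Union>?F)"
    using minimal_normal_eq_generate_conjugates[OF N S] generate_consistent[OF _ sN, of "\<Union>?F"] TN by auto
  moreover have "T \<lhd> ?GN \<and> class_subgroup \<XX> ?GN T" if T: "T \<in> ?F" for T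
  proof -
    obtain g where g: "g \<in> carrier G" "T = ?T g" using T by blast
    have "invariant_subgroup G N T" using Tm[OF g(1)] g(2) unfolding minimal_invariant_subgroup_def by blast
    then have "T \<lhd> ?GN" 
      using normal_in_subgroup_iff[OF G sN] TN[OF g(1)] g(2) unfolding invariant_subgroup_def by blast
    then show ?thesis
      using cT[OF g(1)] g(2) normal_imp_subgroup unfolding class_subgroup_def by auto
  qed
  moreover have "finite (carrier ?GN)" using finite_subset[OF subgroup.subset[OF sN] fin] by simp
  ultimately have "in_class ?GN \<XX>"
    using in_class_if_generated_by_normal_class_subgroups[OF X subgroup_imp_group[OF sN], of ?F] by blast
  then show ?thesis using sN unfolding class_subgroup_def by blast
qed

section \<open>Abelian minimal normal subgroups\<close>

lemma prime_order_element:
  fixes G (structure)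
  assumes G: "group G" and fin: "finite (carrier G)" and q: "Factorial_Ring.prime (q::nat)" "q dvd order G"
  obtains x where "x \<in> carrier G" "group.ord G x = q"
proof -
  interpret group G by fact
  obtain m where "order G = q ^ 1 * m" using q(2) by auto
  then obtain H where H: "subgroup H G" "card H = q ^ 1" using sylow_thm[OF q(1) G _ fin] by blast
  have "\<not> H \<subseteq> {\<one>}"
  proof
    assume "H \<subseteq> {\<one>}"
    then have "card H \<le> 1" using card_mono[of "{\<one>}" H] by simp
    then show False using H(2) prime_gt_1_nat[OF q(1)] by simp
  qed
  then obtain x where x: "x \<in> H" "x \<noteq> \<one>" by blast
  have xc: "x \<in> carrier G" using subgroup.mem_carrier[OF H(1) x(1)] .
  have "x [^] q = \<one>"
    using group.pow_order_eq_1[OF subgroup_imp_group[OF H(1)], of x] x H(2)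
    by (simp add: order_def nat_pow_consistent[symmetric])
  then have "ord x dvd q" using pow_eq_id xc by blast
  moreover have "ord x \<noteq> 1" using x(2) xc ord_eq_1 by blast
  ultimately have "ord x = q" using q(1) by (metis prime_nat_iff)
  then show thesis using that xc by blast
qed

text \<open>The group \<open>C\<close> has a subgroup of order \<open>q\<close>, and it maps onto every cyclic group whose order divides
\<open>q\<close>.\<close>

lemma class_subgroup_cyclic_prime:
  fixes G (structure)
  assumes X: "complete_class \<XX>" and G: "group G" and q: "Factorial_Ring.prime (q::nat)" and C: "C \<in> \<XX>" "q dvd order C"
    and x: "x \<in> carrier G" "x [^] q = \<one>"
  shows "class_subgroup \<XX> G (generate G {x})"
proof -
  interpret group G by fact
  have gC: "group C" and fC: "finite (carrier C)" using X C(1) unfolding complete_class_def by blast+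
  interpret C: group C by fact
  obtain c where c: "c \<in> carrier C" "C.ord c = q" using prime_order_element[OF gC fC q C(2)] .
  have sx: "subgroup (generate G {x}) G" using generate_is_subgroup x by simp
  have sc: "subgroup (generate C {c}) C" using C.generate_is_subgroup c by simp
  have "ord x dvd q" using x pow_eq_id by blast
  then have pow_eq: "x [^] i = x [^] j" if "c [^]\<^bsub>C\<^esub> i = c [^]\<^bsub>C\<^esub> j" for i j :: int
  proof -
    have "int q dvd j - i" using that c C.int_pow_eq by blast
    moreover have "int (ord x) dvd int q" using \<open>ord x dvd q\<close> by simp
    ultimately show ?thesis using int_pow_eq[OF x(1)] dvd_trans by blast
  qed
  define \<phi> where "\<phi> y = x [^] (SOME i::int. y = c [^]\<^bsub>C\<^esub> i)" for y
  have \<phi>: "\<phi> (c [^]\<^bsub>C\<^esub> i) = x [^] i" for i :: int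
  proof -
    have "c [^]\<^bsub>C\<^esub> i = c [^]\<^bsub>C\<^esub> (SOME j::int. c [^]\<^bsub>C\<^esub> i = c [^]\<^bsub>C\<^esub> j)" by (rule someI[of _ i]) simp
    then show ?thesis unfolding \<phi>_def using pow_eq by metis
  qed
  have gx: "generate G {x} = range (\<lambda>i::int. x [^] i)" using generate_pow[OF x(1)] by auto
  have gc: "generate C {c} = range (\<lambda>i::int. c [^]\<^bsub>C\<^esub> i)" using C.generate_pow[OF c(1)] by auto
  have "\<phi> \<in> hom (C\<lparr>carrier := generate C {c}\<rparr>) (G\<lparr>carrier := generate G {x}\<rparr>)"
  proof (rule homI)
    fix y assume "y \<in> carrier (C\<lparr>carrier := generate C {c}\<rparr>)"
    then obtain i :: int where i: "y = c [^]\<^bsub>C\<^esub> i" using gc by auto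
    then show "\<phi> y \<in> carrier (G\<lparr>carrier := generate G {x}\<rparr>)" using \<phi> gx by simp
    fix z assume "z \<in> carrier (C\<lparr>carrier := generate C {c}\<rparr>)"
    then obtain j :: int where j: "z = c [^]\<^bsub>C\<^esub> j" using gc by auto
    have "y \<otimes>\<^bsub>C\<^esub> z = c [^]\<^bsub>C\<^esub> (i + j)" using i j c(1) by (simp add: C.int_pow_mult)
    then show "\<phi> (y \<otimes>\<^bsub>C\<lparr>carrier := generate C {c}\<rparr>\<^esub> z) = \<phi> y \<otimes>\<^bsub>G\<lparr>carrier := generate G {x}\<rparr>\<^esub> \<phi> z"
      using i j \<phi> x(1) by (simp add: int_pow_mult)
  qed
  moreover have "\<phi> ` generate C {c} = generate G {x}"
    unfolding gx gc image_image using \<phi> by simp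
  ultimately have "\<phi> \<in> epi (C\<lparr>carrier := generate C {c}\<rparr>) (G\<lparr>carrier := generate G {x}\<rparr>)"
    by (simp add: epi_def)
  moreover have "in_class (C\<lparr>carrier := generate C {c}\<rparr>) \<XX>"
    using in_class_subgroup[OF X _ sc] in_class_nat_iff[OF X] C(1) by blast
  ultimately have "in_class (G\<lparr>carrier := generate G {x}\<rparr>) \<XX>"
    using in_class_epi_image[OF X _ subgroup_imp_group[OF sx]] by blast
  then show ?thesis using sx unfolding class_subgroup_def by blast
qed

text \<open>The elements of \<open>N\<close> with trivial \<open>q\<close>-th power form a characteristic subgroup, nontrivial by
Cauchy's theorem, which is \<open>N\<close> by minimality. So \<open>N\<close> is generated by subgroups of order \<open>q\<close>, all of them normal in \<open>N\<close> and in the class.\<close>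

lemma abelian_minimal_normal_in_class:
  fixes G (structure)
  assumes X: "complete_class \<XX>" and G: "group G" and fin: "finite (carrier G)"
    and N: "minimal_invariant_subgroup G (carrier G) N"
    and ab: "\<And>x y. x \<in> N \<Longrightarrow> y \<in> N \<Longrightarrow> x \<otimes> y = y \<otimes> x"
    and q: "Factorial_Ring.prime (q::nat)" "q dvd card N" and C: "C \<in> \<XX>" "q dvd order C"
  shows "class_subgroup \<XX> G N"
proof -
  interpret group G by fact
  have iN: "invariant_subgroup G (carrier G) N" using N unfolding minimal_invariant_subgroup_def by blast
  then have sN: "subgroup N G" unfolding invariant_subgroup_def by blast
  note Nc = subgroup.mem_carrier[OF sN]
  let ?K = "{x \<in> N. x [^] q = \<one>}" and ?GN = "G\<lparr>carrier := N\<rparr>"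
  have finN: "finite (carrier ?GN)" using finite_subset[OF subgroup.subset[OF sN] fin] by simp
  interpret N: comm_group ?GN
    using subgroup_imp_group[OF sN] ab by (intro group.group_comm_groupI) auto
  have "subgroup ?K G"
  proof (rule subgroupI)
    show "?K \<noteq> {}" using subgroup.one_closed[OF sN] by force
    show "inv a \<in> ?K" if "a \<in> ?K" for a
      using that Nc subgroup.m_inv_closed[OF sN] by (simp add: nat_pow_inv)
    show "a \<otimes> b \<in> ?K" if "a \<in> ?K" "b \<in> ?K" for a b
      using that Nc subgroup.m_closed[OF sN] ab pow_mult_distrib[of a b q] by simp
  qed (use Nc in auto)
  moreover have "(g \<otimes> x \<otimes> inv g) [^] q = \<one>" if g: "g \<in> carrier G" and x: "x \<in> ?K" for g x
  proof -
    have "(g \<otimes> x \<otimes> inv g) [^] q = g \<otimes> (x [^] q) \<otimes> inv g"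
      using group_hom.hom_nat_pow[OF conjugation_hom[OF g], of x q] Nc x by simp
    then show ?thesis using x g by simp
  qed
  ultimately have "invariant_subgroup G (carrier G) ?K"
    using iN unfolding invariant_subgroup_def by auto
  moreover have "?K \<noteq> {\<one>}"
  proof -
    obtain x where x: "x \<in> carrier ?GN" "N.ord x = q"
      using prime_order_element[OF N.is_group finN q(1)] q(2) by (auto simp: order_def)
    have "x [^] q = \<one>" using N.pow_ord_eq_1[OF x(1)] x(2) by (simp add: nat_pow_consistent[symmetric])
    moreover have "x \<noteq> \<one>" using x N.ord_eq_1[OF x(1)] prime_gt_1_nat[OF q(1)] by auto
    ultimately show ?thesis using x(1) by auto
  qed
  ultimately have K: "?K = N" using N unfolding minimal_invariant_subgroup_def by blast
  let ?F = "(\<lambda>x. generate G {x}) ` N"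
  have sub: "generate G {x} \<subseteq> N" if "x \<in> N" for x using generate_subgroup_incl[OF _ sN] that by simp
  have "\<Union>?F \<subseteq> N" using sub by blast
  moreover have "N \<subseteq> \<Union>?F" using generate.incl by fastforce
  ultimately have "\<Union>?F = N" by blast
  then have "carrier ?GN = generate ?GN (\<Union>?F)"
    using N.generate_incl[of N] generate.incl[of _ N ?GN] by auto
  moreover have "T \<lhd> ?GN \<and> class_subgroup \<XX> ?GN T" if T: "T \<in> ?F" for T
  proof -
    obtain x where x: "x \<in> N" "T = generate G {x}" using T by blast
    have c: "class_subgroup \<XX> G T"
      using class_subgroup_cyclic_prime[OF X G q(1) C Nc[OF x(1)]] K x by blast
    then have "subgroup T ?GN" using subgroup_incl[OF _ sN] sub[OF x(1)] x(2) unfolding class_subgroup_def by blast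
    then show ?thesis using N.subgroup_imp_normal c unfolding class_subgroup_def by simp
  qed
  ultimately have "in_class ?GN \<XX>"
    using in_class_if_generated_by_normal_class_subgroups[OF X N.is_group finN, of ?F] by blast
  then show ?thesis using sN unfolding class_subgroup_def by blast
qed

section \<open>Factors of elements of a maximal subgroup\<close>

text \<open>The condition on \<open>a\<close> makes its order coprime to \<open>|N|\<close> when \<open>|N|\<close> is coprime to the orders of all
\<open>\<XX>\<close>-groups. It is phrased with the order of a fixed member \<open>C\<close> because in this form it passes
unchanged to subgroups and quotients.\<close>

lemma factor_of_product_in_maximal_class_subgroup:
  fixes G :: "nat monoid" (structure)
  assumes X: "complete_class \<XX>" and C: "C \<in> \<XX>"
    and "group G" and "finite (carrier G)" and "M \<in> maximal_class_subgroups \<XX> G"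
    and "subnormal A G" and "subnormal B G"
    and "\<And>x y. x \<in> A \<Longrightarrow> y \<in> B \<Longrightarrow> x \<otimes> y = y \<otimes> x"
    and "a \<in> A" and "b \<in> B" and "a \<otimes> b \<in> M" and "a [^] order C = \<one>"
  shows "a \<in> M"
  using assms(3-)
proof (induction "card (carrier G)" arbitrary: G A B M a b rule: less_induct)
  case (less G A B M a b)
  note G = less.prems(1) and fin = less.prems(2) and M = less.prems(3)
    and A = less.prems(4) and B = less.prems(5) and comm = less.prems(6)
    and a = less.prems(7) and b = less.prems(8) and ab = less.prems(9) and apow = less.prems(10)
  interpret group G by fact
  have cM: "class_subgroup \<XX> G M" using M unfolding maximal_class_subgroups_def by blast
  then have sM: "subgroup M G" unfolding class_subgroup_def by blast
  have sA: "subgroup A G" and sB: "subgroup B G" using subnormal_imp_subgroup A B G by auto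
  note Mc = subgroup.mem_carrier[OF sM]
  have ac: "a \<in> carrier G" and bc: "b \<in> carrier G"
    using a b subgroup.mem_carrier[OF sA] subgroup.mem_carrier[OF sB] by auto
  define Y where "Y = generate G (insert a M)"
  have aM: "insert a M \<subseteq> carrier G" using ac Mc by blast
  have sY: "subgroup Y G" unfolding Y_def by (rule generate_is_subgroup[OF aM])
  have MY: "insert a M \<subseteq> Y" unfolding Y_def using generate.incl[of _ "insert a M" G] by blast
  show ?case
  proof (cases "Y = carrier G")
    case False
    then have "Y \<subset> carrier G" using subgroup.subset[OF sY] by blast
    then have lt: "card (carrier (G\<lparr>carrier := Y\<rparr>)) < card (carrier G)"
      using psubset_card_mono[OF fin] by simp
    have Y: "a \<in> Y" "a \<otimes>\<^bsub>G\<^esub> b \<in> Y" using MY ab by auto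
    have "inv\<^bsub>G\<^esub> a \<otimes>\<^bsub>G\<^esub> (a \<otimes>\<^bsub>G\<^esub> b) \<in> Y"
      by (rule subgroup.m_closed[OF sY subgroup.m_inv_closed[OF sY Y(1)] Y(2)])
    then have bY: "b \<in> Y" using ac bc by (simp add: inv_mult_cancel_left)
    show ?thesis
    proof (rule less.hyps[OF lt])
      show "group (G\<lparr>carrier := Y\<rparr>)" by (rule subgroup_imp_group[OF sY])
      show "finite (carrier (G\<lparr>carrier := Y\<rparr>))" using finite_subset[OF subgroup.subset[OF sY] fin] by simp
      show "M \<in> maximal_class_subgroups \<XX> (G\<lparr>carrier := Y\<rparr>)"
        using maximal_class_subgroup_in_subgroup[OF G M sY] MY by blast
      show "subnormal (A \<inter> Y) (G\<lparr>carrier := Y\<rparr>)" "subnormal (B \<inter> Y) (G\<lparr>carrier := Y\<rparr>)"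
        using subnormal_Int_subgroup[OF G _ sY] A B by auto
      show "a [^]\<^bsub>G\<lparr>carrier := Y\<rparr>\<^esub> order C = \<one>\<^bsub>G\<lparr>carrier := Y\<rparr>\<^esub>"
        using apow by (simp add: nat_pow_consistent[symmetric])
    qed (use a b ab comm MY bY in auto)
  next
    case True
    show ?thesis
    proof (cases "carrier G = {\<one>\<^bsub>G\<^esub>}")
      case True
      then show ?thesis using ac subgroup.one_closed[OF sM] by auto
    next
      case False
      have "invariant_subgroup G (carrier G) (carrier G)"
        using subgroup_self unfolding invariant_subgroup_def by auto
      then obtain N where N: "minimal_invariant_subgroup G (carrier G) N"
        using minimal_invariant_subgroup_exists[OF fin _ False] by blast
      then have iN: "invariant_subgroup G (carrier G) N" and N1: "N \<noteq> {\<one>\<^bsub>G\<^esub>}"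
        unfolding minimal_invariant_subgroup_def by auto
      have nN: "N \<lhd> G" using iN normal_inv_iff unfolding invariant_subgroup_def by blast
      have sN: "subgroup N G" by (rule normal_imp_subgroup[OF nN])
      obtain K :: "nat monoid" and f where f: "group_hom G K f" and surj: "f ` carrier G = carrier K"
        and ker: "kernel G K f = N" and finK: "finite (carrier K)"
        using nat_quotient[OF nN fin] .
      interpret f: group_hom G K f by fact
      have lt: "card (carrier K) < card (carrier G)"
      proof -
        have "\<not> inj_on f (carrier G)" using f.inj_iff_trivial_ker ker N1 by simp
        then have "card (f ` carrier G) \<noteq> card (carrier G)" using fin eq_card_imp_inj_on by blast
        then show ?thesis using card_image_le[OF fin, of f] surj by simp
      qed
      have step: "f a \<in> f ` M" if "f ` M \<in> maximal_class_subgroups \<XX> K"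
      proof (rule less.hyps[OF lt f.H.is_group finK that])
        show "subnormal (f ` A) K" "subnormal (f ` B) K" using subnormal_image[OF _ f surj] A B by auto
        show "f a \<in> f ` A" "f b \<in> f ` B" using a b by auto
        show "f a \<otimes>\<^bsub>K\<^esub> f b \<in> f ` M" using ab ac bc by (metis f.hom_mult imageI)
        show "f a [^]\<^bsub>K\<^esub> order C = \<one>\<^bsub>K\<^esub>" using apow ac by (metis f.hom_nat_pow f.hom_one)
        fix x y assume "x \<in> f ` A" "y \<in> f ` B"
        then obtain u v where "u \<in> A" "v \<in> B" "x = f u" "y = f v" by blast
        then show "x \<otimes>\<^bsub>K\<^esub> y = y \<otimes>\<^bsub>K\<^esub> x"
          using comm[of u v] subgroup.mem_carrier[OF sA] subgroup.mem_carrier[OF sB]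
          by (metis f.hom_mult)
      qed
      have ker_mem: "inv\<^bsub>G\<^esub> x \<otimes>\<^bsub>G\<^esub> a \<in> N" if "x \<in> M" "f a = f x" for x
      proof -
        have "f (inv\<^bsub>G\<^esub> x \<otimes>\<^bsub>G\<^esub> a) = \<one>\<^bsub>K\<^esub>" using that ac Mc by simp
        then show ?thesis using that ac Mc ker by (auto simp: kernel_def)
      qed
      show ?thesis
      proof (cases "class_subgroup \<XX> G N")
        case True
        have "f ` M \<in> maximal_class_subgroups \<XX> K"
          using maximal_class_subgroup_image[OF X f fin surj _ M] ker True by simp
        then obtain x where x: "x \<in> M" "f a = f x" using step by blast
        have "inv\<^bsub>G\<^esub> x \<otimes>\<^bsub>G\<^esub> a \<in> M"
          using ker_mem[OF x] maximal_class_subgroup_absorbs_normal[OF X fin M nN True] by blast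
        then have "x \<otimes>\<^bsub>G\<^esub> (inv\<^bsub>G\<^esub> x \<otimes>\<^bsub>G\<^esub> a) \<in> M" using subgroup.m_closed[OF sM x(1)] by blast
        then show ?thesis using ac Mc[OF x(1)] by (simp add: inv_mult_cancel_left)
      next
        case False
        have N_ab: "x \<otimes>\<^bsub>G\<^esub> y = y \<otimes>\<^bsub>G\<^esub> x" if "x \<in> N" "y \<in> N" for x y
          using nonabelian_minimal_normal_in_class[OF X G fin N _ cM _ A B comm a b ab]
            \<open>Y = carrier G\<close> False that unfolding Y_def by blast
        have cop: "coprime (card N) (order C')" if C': "C' \<in> \<XX>" for C'
        proof (rule ccontr)
          assume "\<not> coprime (card N) (order C')"
          then have "gcd (card N) (order C') \<noteq> 1" by (simp add: coprime_iff_gcd_eq_1)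
          then obtain q :: nat where "Factorial_Ring.prime q" "q dvd gcd (card N) (order C')"
            using prime_factor_nat by blast
          then show False
            using abelian_minimal_normal_in_class[OF X G fin N N_ab _ _ C'] False by auto
        qed
        have "f ` M \<in> maximal_class_subgroups \<XX> K"
          using maximal_class_subgroup_coprime_image[OF X f fin surj _ _ M] N_ab cop ker by simp
        then obtain x where x: "x \<in> M" "f a = f x" using step by blast
        note xc = Mc[OF x(1)]
        define m where "m = inv\<^bsub>G\<^esub> x \<otimes>\<^bsub>G\<^esub> a"
        have mN: "m \<in> N" unfolding m_def by (rule ker_mem[OF x])
        then have mc: "m \<in> carrier G" using subgroup.mem_carrier[OF sN] by blast
        have a_eq: "a = x \<otimes>\<^bsub>G\<^esub> m" unfolding m_def using xc ac by (simp add: inv_mult_cancel_left)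
        have copM: "coprime (card M) (card N)"
          using coprime_class_subgroup[OF cop cM] by (simp add: coprime_commute)
        have M_pow: "z [^]\<^bsub>G\<^esub> card M = \<one>\<^bsub>G\<^esub>" if "z \<in> M" for z
          using group.pow_order_eq_1[OF subgroup_imp_group[OF sM], of z] that
          by (simp add: order_def nat_pow_consistent[symmetric])
        have "x = a \<otimes>\<^bsub>G\<^esub> inv\<^bsub>G\<^esub> m" using a_eq xc mc by (simp add: m_assoc)
        then have "x \<in> A <#>\<^bsub>G\<^esub> N"
          using a subgroup.m_inv_closed[OF sN mN] unfolding set_mult_def by blast
        then have xA: "x \<in> A"
          using subnormal_contains_coprime_elements[OF A G nN _ M_pow[OF x(1)] copM] by blast
        \<comment> \<open>\<open>y\<close> plays for \<open>b\<close> the part that \<open>x\<close> plays for \<open>a\<close>: it lies in \<open>M\<close> and in \<open>B N\<close>.\<close>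
        define y where "y = inv\<^bsub>G\<^esub> x \<otimes>\<^bsub>G\<^esub> (a \<otimes>\<^bsub>G\<^esub> b)"
        have yM: "y \<in> M" unfolding y_def
          by (rule subgroup.m_closed[OF sM subgroup.m_inv_closed[OF sM x(1)] ab])
        have y_eq: "y = m \<otimes>\<^bsub>G\<^esub> b" unfolding y_def m_def using xc ac bc by (simp add: m_assoc)
        have "y = b \<otimes>\<^bsub>G\<^esub> (inv\<^bsub>G\<^esub> b \<otimes>\<^bsub>G\<^esub> m \<otimes>\<^bsub>G\<^esub> b)"
          using y_eq bc mc by (simp add: m_assoc inv_mult_cancel_left)
        moreover have "inv\<^bsub>G\<^esub> b \<otimes>\<^bsub>G\<^esub> m \<otimes>\<^bsub>G\<^esub> b \<in> N" using normal.inv_op_closed1[OF nN bc mN] .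
        ultimately have "y \<in> B <#>\<^bsub>G\<^esub> N" using b unfolding set_mult_def by blast
        then have yB: "y \<in> B"
          using subnormal_contains_coprime_elements[OF B G nN _ M_pow[OF yM] copM] by blast
        have "m = y \<otimes>\<^bsub>G\<^esub> inv\<^bsub>G\<^esub> b" using y_eq bc mc by (simp add: m_assoc)
        then have mB: "m \<in> B" using yB b subgroup.m_closed[OF sB] subgroup.m_inv_closed[OF sB] by simp
        have xm: "x \<otimes>\<^bsub>G\<^esub> m = m \<otimes>\<^bsub>G\<^esub> x" using comm[OF xA mB] .
        \<comment> \<open>The exponent annihilates \<open>a\<close> and \<open>x\<close>, hence \<open>m\<close>, and it is coprime to \<open>|N|\<close>.\<close>
        let ?k = "order C * card M"
        have "a [^]\<^bsub>G\<^esub> ?k = x [^]\<^bsub>G\<^esub> ?k \<otimes>\<^bsub>G\<^esub> m [^]\<^bsub>G\<^esub> ?k"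
          unfolding a_eq using pow_mult_distrib[OF xm xc mc] .
        moreover have "a [^]\<^bsub>G\<^esub> ?k = \<one>\<^bsub>G\<^esub>"
          using apow ac by (simp add: nat_pow_pow[symmetric])
        moreover have "x [^]\<^bsub>G\<^esub> ?k = \<one>\<^bsub>G\<^esub>"
          using M_pow[OF x(1)] xc by (simp add: mult.commute[of "order C"] nat_pow_pow[symmetric])
        ultimately have "m [^]\<^bsub>G\<^esub> ?k = \<one>\<^bsub>G\<^esub>" using mc by simp
        moreover have "m [^]\<^bsub>G\<^esub> card N = \<one>\<^bsub>G\<^esub>"
          using group.pow_order_eq_1[OF subgroup_imp_group[OF sN], of m] mN
          by (simp add: order_def nat_pow_consistent[symmetric])
        moreover have "coprime ?k (card N)"
          using copM cop[OF C] by (simp add: coprime_commute)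
        ultimately have "m = \<one>\<^bsub>G\<^esub>" using coprime_exponents_imp_one[OF mc] by blast
        then show ?thesis using a_eq x(1) xc by simp
      qed
    qed
  qed
qed

section \<open>Submaximal subgroups and normal factors\<close>

lemma subnormal_image_of_normal:
  fixes G (structure)
  assumes f: "group_hom G K f" and sub: "subnormal (f ` carrier G) K" and D: "D \<lhd> G"
  shows "subnormal (f ` D) K"
proof -
  interpret group_hom G K f by fact
  have sD: "subgroup D G" by (rule normal_imp_subgroup[OF D])
  have "f g \<otimes>\<^bsub>K\<^esub> f d \<otimes>\<^bsub>K\<^esub> inv\<^bsub>K\<^esub> f g \<in> f ` D" if "g \<in> carrier G" "d \<in> D" for g d
  proof -
    have "f g \<otimes>\<^bsub>K\<^esub> f d \<otimes>\<^bsub>K\<^esub> inv\<^bsub>K\<^esub> f g = f (g \<otimes> d \<otimes> inv g)"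
      using that subgroup.mem_carrier[OF sD] by simp
    then show ?thesis using normal.inv_op_closed2[OF D that] by simp
  qed
  then have "f ` D \<lhd> K\<lparr>carrier := f ` carrier G\<rparr>"
    using normal_in_subgroup_iff[OF H.is_group img_is_subgroup] subgroup_img_is_subgroup[OF sD]
      subgroup.subset[OF sD] by auto
  then show ?thesis by (rule subnormal.step[OF sub])
qed

text \<open>As \<open>A \<inter> B\<close> is trivial, the order of \<open>a\<close> divides that of \<open>a b\<close> and hence the order of the
\<open>\<XX>\<close>-group \<open>M\<close>.\<close>

lemma submaximal_contains_factors:
  fixes G :: "('a, 'b) monoid_scheme" (structure)
  assumes X: "complete_class \<XX>" and G: "group G"
    and H: "H \<in> submaximal_class_subgroups \<XX> G"
    and A: "A \<lhd> G" and B: "B \<lhd> G" and AB: "A \<inter> B = {\<one>}"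
    and a: "a \<in> A" and b: "b \<in> B" and ab: "a \<otimes> b \<in> H"
  shows "a \<in> H"
proof -
  interpret group G by fact
  obtain G' :: "nat monoid" and \<phi> M where sH: "subgroup H G" and G': "group G'" "finite (carrier G')"
    and \<phi>: "\<phi> \<in> mon G G'" and sub: "subnormal (\<phi> ` carrier G) G'"
    and M: "M \<in> maximal_class_subgroups \<XX> G'" and HM: "\<phi> ` H = M \<inter> \<phi> ` carrier G"
    using H unfolding submaximal_class_subgroups_def by blast
  have \<phi>h: "\<phi> \<in> hom G G'" and inj: "inj_on \<phi> (carrier G)" using \<phi> by (auto simp: mon_def)
  interpret \<phi>: group_hom G G' \<phi> using G' \<phi>h G by (simp add: group_hom_def group_hom_axioms_def)
  note Ac = subgroup.mem_carrier[OF normal_imp_subgroup[OF A]]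
    and Bc = subgroup.mem_carrier[OF normal_imp_subgroup[OF B]]
  have comm: "x \<otimes> y = y \<otimes> x" if "x \<in> A" "y \<in> B" for x y
    using normal_imp_commuting[OF A B _ that] AB by simp
  have cM: "class_subgroup \<XX> G' M" using M unfolding maximal_class_subgroups_def by blast
  then have sM: "subgroup M G'" unfolding class_subgroup_def by blast
  define C where "C = G'\<lparr>carrier := M\<rparr>"
  have C: "C \<in> \<XX>" using cM in_class_nat_iff[OF X] unfolding class_subgroup_def C_def by blast
  note subN = subnormal_image_of_normal[OF \<phi>.group_hom_axioms sub]
  have ac: "a \<in> carrier G" and bc: "b \<in> carrier G" using a b Ac Bc by auto
  have "\<phi> (a \<otimes> b) \<in> M" using HM ab by blast
  then have "\<phi> (a \<otimes> b) [^]\<^bsub>G'\<^esub> order C = \<one>\<^bsub>G'\<^esub>"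
    using group.pow_order_eq_1[OF \<phi>.H.subgroup_imp_group[OF sM], of "\<phi> (a \<otimes> b)"]
    by (simp add: C_def \<phi>.H.nat_pow_consistent[symmetric])
  then have "\<phi> ((a \<otimes> b) [^] order C) = \<phi> \<one>" using ac bc \<phi>.hom_nat_pow[of "a \<otimes> b" "order C"] by simp
  then have "(a \<otimes> b) [^] order C = \<one>" using inj ac bc by (meson inj_onD m_closed nat_pow_closed one_closed)
  then have prod1: "a [^] order C \<otimes> b [^] order C = \<one>" using pow_mult_distrib[OF comm[OF a b] ac bc] by simp
  have pow_in: "d [^] n \<in> D" if "D \<lhd> G" "d \<in> D" for d D and n :: nat
    using monoid.nat_pow_closed[OF group.is_monoid[OF subgroup_imp_group[OF normal_imp_subgroup[OF that(1)]]], of d n]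
      that(2) by (simp add: nat_pow_consistent[symmetric])
  have "a [^] order C = inv (b [^] order C)" using prod1 ac bc inv_equality by auto
  then have "a [^] order C \<in> B"
    using pow_in[OF B b] subgroup.m_inv_closed[OF normal_imp_subgroup[OF B]] by simp
  then have a_pow: "a [^] order C = \<one>" using pow_in[OF A a, of "order C"] AB by blast
  have "\<phi> a \<in> M"
  proof (rule factor_of_product_in_maximal_class_subgroup[OF X C G' M subN[OF A] subN[OF B]])
    show "\<phi> a \<in> \<phi> ` A" "\<phi> b \<in> \<phi> ` B" using a b by auto
    show "\<phi> a \<otimes>\<^bsub>G'\<^esub> \<phi> b \<in> M" using \<open>\<phi> (a \<otimes> b) \<in> M\<close> ac bc by simp
    show "\<phi> a [^]\<^bsub>G'\<^esub> order C = \<one>\<^bsub>G'\<^esub>" using \<phi>.hom_nat_pow[OF ac, of "order C"] a_pow by simp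
    fix x y assume "x \<in> \<phi> ` A" "y \<in> \<phi> ` B"
    then obtain u v where uv: "u \<in> A" "v \<in> B" "x = \<phi> u" "y = \<phi> v" by blast
    then have "\<phi> (u \<otimes> v) = \<phi> (v \<otimes> u)" using comm[of u v] by simp
    then show "x \<otimes>\<^bsub>G'\<^esub> y = y \<otimes>\<^bsub>G'\<^esub> x" using uv Ac Bc by simp
  qed
  then have "\<phi> a \<in> \<phi> ` H" using HM ac by blast
  then show ?thesis using inj ac subgroup.mem_carrier[OF sH] by (metis (no_types) imageE inj_onD)
qed

lemma submaximal_Int_normal:
  fixes G :: "('a, 'b) monoid_scheme" (structure)
  assumes G: "group G" and H: "H \<in> submaximal_class_subgroups \<XX> G" and D: "D \<lhd> G"
  shows "H \<inter> D \<in> submaximal_class_subgroups \<XX> (G\<lparr>carrier := D\<rparr>)"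
proof -
  interpret group G by fact
  obtain G' :: "nat monoid" and \<phi> M where sH: "subgroup H G" and G': "group G'" "finite (carrier G')"
    and \<phi>: "\<phi> \<in> mon G G'" and sub: "subnormal (\<phi> ` carrier G) G'"
    and M: "M \<in> maximal_class_subgroups \<XX> G'" and HM: "\<phi> ` H = M \<inter> \<phi> ` carrier G"
    using H unfolding submaximal_class_subgroups_def by blast
  have \<phi>h: "\<phi> \<in> hom G G'" and inj: "inj_on \<phi> (carrier G)" using \<phi> by (auto simp: mon_def)
  interpret \<phi>: group_hom G G' \<phi> using G' \<phi>h G by (simp add: group_hom_def group_hom_axioms_def)
  have sD: "subgroup D G" by (rule normal_imp_subgroup[OF D])
  note Dc = subgroup.subset[OF sD] and Hc = subgroup.subset[OF sH]
  show ?thesis unfolding submaximal_class_subgroups_def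
  proof (intro CollectI conjI exI)
    show "subgroup (H \<inter> D) (G\<lparr>carrier := D\<rparr>)"
      using subgroup_incl[OF subgroups_Inter_pair[OF sH sD] sD] by blast
    show "group G'" "finite (carrier G')" "M \<in> maximal_class_subgroups \<XX> G'" by fact+
    show "\<phi> \<in> mon (G\<lparr>carrier := D\<rparr>) G'"
      using \<phi>h Dc inj_on_subset[OF inj Dc] by (auto simp: mon_def hom_def subset_iff)
    show "subnormal (\<phi> ` carrier (G\<lparr>carrier := D\<rparr>)) G'"
      using subnormal_image_of_normal[OF \<phi>.group_hom_axioms sub D] by simp
    have "\<phi> ` (H \<inter> D) = \<phi> ` H \<inter> \<phi> ` D" using inj_on_image_Int[OF inj Hc Dc] .
    also have "\<dots> = M \<inter> \<phi> ` D" using HM Dc by blast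
    finally show "\<phi> ` (H \<inter> D) = M \<inter> \<phi> ` carrier (G\<lparr>carrier := D\<rparr>)" by simp
  qed
qed

section \<open>Submaximal subgroups of direct products\<close>

text \<open>The overgroup may live over any type, such as a product type.\<close>

lemma submaximalI:
  fixes G :: "('a, 'b) monoid_scheme" and G' :: "('c, 'd) monoid_scheme"
  assumes X: "complete_class \<XX>" and H: "subgroup H G" and G': "group G'" "finite (carrier G')"
    and G: "group G" and \<phi>: "\<phi> \<in> mon G G'" and sub: "subnormal (\<phi> ` carrier G) G'"
    and M: "M \<in> maximal_class_subgroups \<XX> G'" and HM: "\<phi> ` H = M \<inter> \<phi> ` carrier G"
  shows "H \<in> submaximal_class_subgroups \<XX> G"
proof -
  obtain N :: "nat monoid" where N: "group N" "finite (carrier N)" "G' \<cong> N"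
    using finite_group_nat_copy[OF G'] by blast
  then obtain h where h: "h \<in> iso G' N" unfolding is_iso_def by blast
  have bij: "bij_betw h (carrier G') (carrier N)" and hm: "h \<in> mon G' N" and hh: "h \<in> hom G' N"
    using h by (auto simp: iso_def mon_def bij_betw_def)
  have gh: "group_hom G' N h" using G' N hh by (simp add: group_hom_def group_hom_axioms_def)
  interpret h: group_hom G' N h by fact
  have surj: "h ` carrier G' = carrier N" and inj: "inj_on h (carrier G')"
    using bij by (auto simp: bij_betw_def)
  have ker: "kernel G' N h = {\<one>\<^bsub>G'\<^esub>}" using inj h.inj_iff_trivial_ker by simp
  have im: "\<phi> ` carrier G \<subseteq> carrier G'" using \<phi> by (auto simp: mon_def hom_def)
  have Mc: "M \<subseteq> carrier G'"
    using M subgroup.subset unfolding maximal_class_subgroups_def class_subgroup_def by blast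
  show ?thesis unfolding submaximal_class_subgroups_def
  proof (intro CollectI conjI exI)
    show "subgroup H G" "group N" "finite (carrier N)" by fact+
    show "h \<circ> \<phi> \<in> mon G N" using mon_compose[OF \<phi> hm] .
    show "subnormal ((h \<circ> \<phi>) ` carrier G) N"
      using subnormal_image[OF sub gh surj] by (simp add: image_comp)
    show "h ` M \<in> maximal_class_subgroups \<XX> N"
      using maximal_class_subgroup_image[OF X gh G'(2) surj _ M] ker class_subgroup_trivial[OF X G'(1)]
      by simp
    have "(h \<circ> \<phi>) ` H = h ` (M \<inter> \<phi> ` carrier G)" unfolding image_comp[symmetric] HM ..
    also have "\<dots> = h ` M \<inter> h ` \<phi> ` carrier G" using inj_on_image_Int[OF inj Mc im] .
    finally show "(h \<circ> \<phi>) ` H = h ` M \<inter> (h \<circ> \<phi>) ` carrier G" by (simp add: image_comp)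
  qed
qed

lemma submaximal_iso:
  fixes G :: "('a, 'b) monoid_scheme" and K :: "('c, 'd) monoid_scheme"
  assumes X: "complete_class \<XX>" and G: "group G" and K: "group K" and \<theta>: "\<theta> \<in> iso G K"
    and H: "H \<in> submaximal_class_subgroups \<XX> G"
  shows "\<theta> ` H \<in> submaximal_class_subgroups \<XX> K"
proof -
  obtain G' :: "nat monoid" and \<phi> M where sH: "subgroup H G" and G': "group G'" "finite (carrier G')"
    and \<phi>: "\<phi> \<in> mon G G'" and sub: "subnormal (\<phi> ` carrier G) G'"
    and M: "M \<in> maximal_class_subgroups \<XX> G'" and HM: "\<phi> ` H = M \<inter> \<phi> ` carrier G"
    using H unfolding submaximal_class_subgroups_def by blast
  let ?i = "inv_into (carrier G) \<theta>"
  have inv: "?i \<in> iso K G" using group.iso_set_sym[OF G \<theta>] .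
  then have im: "?i ` carrier K = carrier G" and im': "?i ` \<theta> ` H = H" and mon: "?i \<in> mon K G"
    using \<theta> subgroup.subset[OF sH]
    by (auto simp: iso_def bij_betw_def mon_def inv_into_image_cancel)
  show ?thesis
  proof (rule submaximalI[OF X _ G' K _ _ M])
    show "subgroup (\<theta> ` H) K" using subgroup.iso_subgroup[OF sH G K \<theta>] .
    show "\<phi> \<circ> ?i \<in> mon K G'" using mon_compose[OF mon \<phi>] .
    show "subnormal ((\<phi> \<circ> ?i) ` carrier K) G'" using sub unfolding image_comp[symmetric] im .
    show "(\<phi> \<circ> ?i) ` \<theta> ` H = M \<inter> (\<phi> \<circ> ?i) ` carrier K"
      using HM unfolding image_comp[symmetric] im im' .
  qed
qed

lemma group_hom_fst_snd:
  assumes "group G" and "group K"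
  shows "group_hom (G \<times>\<times> K) G fst" and "group_hom (G \<times>\<times> K) K snd"
  using assms DirProd_group[OF assms] by (auto simp: group_hom_def group_hom_axioms_def hom_def)

lemma subnormal_DirProd:
  assumes G: "group G" and K: "group K" and A: "subnormal A G" and B: "subnormal B K"
  shows "subnormal (A \<times> B) (G \<times>\<times> K)"
proof -
  have "A \<subseteq> carrier G" "B \<subseteq> carrier K"
    using subgroup.subset subnormal_imp_subgroup A B G K by blast+
  then have "{x \<in> carrier (G \<times>\<times> K). fst x \<in> A} \<inter> {x \<in> carrier (G \<times>\<times> K). snd x \<in> B} = A \<times> B" by auto
  then show ?thesis
    using subnormal_Int[OF DirProd_group[OF G K] subnormal_vimage[OF A group_hom_fst_snd(1)[OF G K]]
        subnormal_vimage[OF B group_hom_fst_snd(2)[OF G K]]] by simp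
qed

text \<open>An \<open>\<XX>\<close>-subgroup above \<open>M \<times> N\<close> projects onto \<open>\<XX>\<close>-subgroups above \<open>M\<close> and \<open>N\<close>, so its projections
are \<open>M\<close> and \<open>N\<close>.\<close>

lemma maximal_class_subgroup_DirProd:
  assumes X: "complete_class \<XX>" and G: "group G" and K: "group K"
    and M: "M \<in> maximal_class_subgroups \<XX> G" and N: "N \<in> maximal_class_subgroups \<XX> K"
  shows "M \<times> N \<in> maximal_class_subgroups \<XX> (G \<times>\<times> K)"
proof -
  have cM: "class_subgroup \<XX> G M" and mM: "\<And>L. class_subgroup \<XX> G L \<Longrightarrow> M \<subseteq> L \<Longrightarrow> L = M"
    and cN: "class_subgroup \<XX> K N" and mN: "\<And>L. class_subgroup \<XX> K L \<Longrightarrow> N \<subseteq> L \<Longrightarrow> L = N"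
    using M N unfolding maximal_class_subgroups_def by auto
  have sM: "subgroup M G" and sN: "subgroup N K" using cM cN unfolding class_subgroup_def by auto
  let ?M = "G\<lparr>carrier := M\<rparr>" and ?N = "K\<lparr>carrier := N\<rparr>"
  have gM: "group ?M" and gN: "group ?N" using group.subgroup_imp_group G K sM sN by auto
  let ?P = "?M \<times>\<times> ?N"
  interpret P: group ?P by (rule DirProd_group[OF gM gN])
  have "class_subgroup \<XX> ?P ((\<lambda>y. (\<one>\<^bsub>G\<^esub>, y)) ` N)"
  proof (rule class_subgroup_hom_image[OF X])
    show "group_hom ?N ?P (\<lambda>y. (\<one>\<^bsub>G\<^esub>, y))"
      using gN P.is_group group.is_monoid[OF G] subgroup.one_closed[OF sM]
      by (auto simp: group_hom_def group_hom_axioms_def hom_def monoid.l_one)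
    show "class_subgroup \<XX> ?N N"
      using cN group.subgroup_self[OF gN] unfolding class_subgroup_def by simp
  qed
  moreover have "kernel ?P ?M fst = (\<lambda>y. (\<one>\<^bsub>G\<^esub>, y)) ` N"
    using subgroup.one_closed[OF sM] by (auto simp: kernel_def)
  moreover have "fst ` carrier ?P = M" using subgroup.one_closed[OF sN] by force
  moreover have "finite (carrier ?P)"
    using class_subgroup_finite[OF cM] class_subgroup_finite[OF cN] by simp
  ultimately have "in_class ?P \<XX>"
    using in_class_extension[OF X group_hom_fst_snd(1)[OF gM gN]] cM unfolding class_subgroup_def by simp
  moreover have "?P = (G \<times>\<times> K)\<lparr>carrier := M \<times> N\<rparr>" by (simp add: DirProd_def)
  moreover have "subgroup (M \<times> N) (G \<times>\<times> K)" using DirProd_subgroups[OF G sM K sN] .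
  ultimately have "class_subgroup \<XX> (G \<times>\<times> K) (M \<times> N)" unfolding class_subgroup_def by simp
  moreover have "L = M \<times> N" if L: "class_subgroup \<XX> (G \<times>\<times> K) L" "M \<times> N \<subseteq> L" for L
  proof -
    have "M \<subseteq> fst ` L" "N \<subseteq> snd ` L"
      using L(2) subgroup.one_closed[OF sM] subgroup.one_closed[OF sN] by force+
    then have "fst ` L = M" "snd ` L = N"
      using mM mN class_subgroup_hom_image[OF X group_hom_fst_snd(1)[OF G K] L(1)]
        class_subgroup_hom_image[OF X group_hom_fst_snd(2)[OF G K] L(1)] by auto
    then show ?thesis using L(2) by force
  qed
  ultimately show ?thesis unfolding maximal_class_subgroups_def by blast
qed

lemma submaximal_DirProd:
  fixes G :: "('a, 'b) monoid_scheme" and K :: "('c, 'd) monoid_scheme"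
  assumes X: "complete_class \<XX>" and G: "group G" and K: "group K"
    and H: "H \<in> submaximal_class_subgroups \<XX> G" and L: "L \<in> submaximal_class_subgroups \<XX> K"
  shows "H \<times> L \<in> submaximal_class_subgroups \<XX> (G \<times>\<times> K)"
proof -
  obtain G' :: "nat monoid" and \<phi> M where sH: "subgroup H G" and G': "group G'" "finite (carrier G')"
    and \<phi>: "\<phi> \<in> mon G G'" and sub: "subnormal (\<phi> ` carrier G) G'"
    and M: "M \<in> maximal_class_subgroups \<XX> G'" and HM: "\<phi> ` H = M \<inter> \<phi> ` carrier G"
    using H unfolding submaximal_class_subgroups_def by blast
  obtain K' :: "nat monoid" and \<psi> N where sL: "subgroup L K" and K': "group K'" "finite (carrier K')"
    and \<psi>: "\<psi> \<in> mon K K'" and sub': "subnormal (\<psi> ` carrier K) K'"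
    and N: "N \<in> maximal_class_subgroups \<XX> K'" and LN: "\<psi> ` L = N \<inter> \<psi> ` carrier K"
    using L unfolding submaximal_class_subgroups_def by blast
  have im: "map_prod \<phi> \<psi> ` (A \<times> B) = \<phi> ` A \<times> \<psi> ` B" for A B by (auto simp: map_prod_def image_iff)
  show ?thesis
  proof (rule submaximalI[OF X])
    show "subgroup (H \<times> L) (G \<times>\<times> K)" using DirProd_subgroups[OF G sH K sL] .
    show "group (G' \<times>\<times> K')" "group (G \<times>\<times> K)" using DirProd_group G G' K K' by auto
    show "finite (carrier (G' \<times>\<times> K'))" using G' K' by simp
    show "map_prod \<phi> \<psi> \<in> mon (G \<times>\<times> K) (G' \<times>\<times> K')"
      using \<phi> \<psi> by (auto simp: mon_def hom_def intro!: inj_onI dest: inj_onD)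
    show "subnormal (map_prod \<phi> \<psi> ` carrier (G \<times>\<times> K)) (G' \<times>\<times> K')"
      using subnormal_DirProd[OF G'(1) K'(1) sub sub'] im by simp
    show "M \<times> N \<in> maximal_class_subgroups \<XX> (G' \<times>\<times> K')"
      using maximal_class_subgroup_DirProd[OF X G'(1) K'(1) M N] .
    show "map_prod \<phi> \<psi> ` (H \<times> L) = (M \<times> N) \<inter> map_prod \<phi> \<psi> ` carrier (G \<times>\<times> K)"
      using HM LN by (simp add: im Times_Int_Times)
  qed
qed

lemma submaximal_internal_product:
  fixes G :: "('a, 'b) monoid_scheme" (structure)
  assumes X: "complete_class \<XX>" and G: "group G" and A: "subgroup A G" and B: "subgroup B G"
    and comm: "\<And>x y. x \<in> A \<Longrightarrow> y \<in> B \<Longrightarrow> x \<otimes> y = y \<otimes> x" and AB: "A \<inter> B = {\<one>}"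
    and gen: "carrier G = A <#> B"
    and H: "H \<in> submaximal_class_subgroups \<XX> (G\<lparr>carrier := A\<rparr>)"
    and L: "L \<in> submaximal_class_subgroups \<XX> (G\<lparr>carrier := B\<rparr>)"
  shows "H <#> L \<in> submaximal_class_subgroups \<XX> G"
proof -
  interpret group G by fact
  interpret group_disjoint_sum G A B using G A B by (simp add: group_disjoint_sum_def)
  let ?P = "G\<lparr>carrier := A\<rparr> \<times>\<times> G\<lparr>carrier := B\<rparr>" and ?\<theta> = "\<lambda>(x, y). x \<otimes> y"
  have gA: "group (G\<lparr>carrier := A\<rparr>)" and gB: "group (G\<lparr>carrier := B\<rparr>)"
    using subgroup_imp_group A B by auto
  note c = subgroup.mem_carrier[OF A] subgroup.mem_carrier[OF B]
  have "?\<theta> \<in> hom ?P G"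
  proof (rule homI)
    show "?\<theta> p \<in> carrier G" if "p \<in> carrier ?P" for p using that c by auto
    fix p q assume "p \<in> carrier ?P" "q \<in> carrier ?P"
    then obtain x y u v where pq: "p = (x, y)" "q = (u, v)" "x \<in> A" "y \<in> B" "u \<in> A" "v \<in> B"
      by auto
    have "x \<otimes> u \<otimes> (y \<otimes> v) = x \<otimes> (u \<otimes> y) \<otimes> v" using pq c by (simp add: m_assoc)
    also have "u \<otimes> y = y \<otimes> u" using comm pq by blast
    finally show "?\<theta> (p \<otimes>\<^bsub>?P\<^esub> q) = ?\<theta> p \<otimes> ?\<theta> q" using pq c by (simp add: m_assoc)
  qed
  moreover have "inj_on ?\<theta> (carrier ?P)"
    using cancel AB by (auto simp: inj_on_def)
  moreover have "?\<theta> ` carrier ?P = carrier G"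
    unfolding gen set_mult_def by (auto simp: image_iff)
  ultimately have \<theta>: "?\<theta> \<in> iso ?P G" by (simp add: iso_def bij_betw_def)
  have "?\<theta> ` (H \<times> L) \<in> submaximal_class_subgroups \<XX> G"
    using submaximal_iso[OF X DirProd_group[OF gA gB] G \<theta>] submaximal_DirProd[OF X gA gB H L] by blast
  moreover have "?\<theta> ` (H \<times> L) = H <#> L" unfolding set_mult_def by (auto simp: image_iff)
  ultimately show ?thesis by simp
qed

text \<open>Used both for the factors of a direct product and for the submaximal subgroups inside
them.\<close>

lemma (in group) generate_Un_commuting:
  assumes P: "subgroup P G" and Q: "Q \<subseteq> carrier G"
    and comm: "\<And>x y. x \<in> P \<Longrightarrow> y \<in> generate G Q \<Longrightarrow> x \<otimes> y = y \<otimes> x"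
  shows "generate G (P \<union> Q) = P <#> generate G Q"
proof
  have sQ: "subgroup (generate G Q) G" by (rule generate_is_subgroup[OF Q])
  note c = subgroup.mem_carrier[OF P] subgroup.mem_carrier[OF sQ]
  have U: "P \<union> Q \<subseteq> carrier G" using subgroup.subset[OF P] Q by blast
  have "subgroup (P <#> generate G Q) G"
  proof (rule subgroupI)
    show "P <#> generate G Q \<subseteq> carrier G" unfolding set_mult_def using c by blast
    show "P <#> generate G Q \<noteq> {}"
      unfolding set_mult_def using subgroup.one_closed[OF P] generate.one[of G Q] by blast
    fix u assume "u \<in> P <#> generate G Q"
    then obtain p q where u: "p \<in> P" "q \<in> generate G Q" "u = p \<otimes> q" unfolding set_mult_def by blast
    have inv: "inv p \<in> P" "inv q \<in> generate G Q"
      using u subgroup.m_inv_closed[OF P] subgroup.m_inv_closed[OF sQ] by auto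
    have "inv u = inv p \<otimes> inv q"
      using comm[OF inv] u c by (simp add: inv_mult_group)
    then show "inv u \<in> P <#> generate G Q" unfolding set_mult_def using inv by blast
    fix v assume "v \<in> P <#> generate G Q"
    then obtain p' q' where v: "p' \<in> P" "q' \<in> generate G Q" "v = p' \<otimes> q'" unfolding set_mult_def by blast
    have "u \<otimes> v = p \<otimes> (q \<otimes> p') \<otimes> q'" using u v c by (simp add: m_assoc)
    also have "q \<otimes> p' = p' \<otimes> q" using comm[OF v(1) u(2)] by simp
    finally have "u \<otimes> v = (p \<otimes> p') \<otimes> (q \<otimes> q')" using u v c by (simp add: m_assoc)
    moreover have "p \<otimes> p' \<in> P" "q \<otimes> q' \<in> generate G Q"
      using u v subgroup.m_closed[OF P] subgroup.m_closed[OF sQ] by auto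
    ultimately show "u \<otimes> v \<in> P <#> generate G Q" unfolding set_mult_def by blast
  qed
  moreover have "P \<subseteq> P <#> generate G Q"
  proof
    fix x assume "x \<in> P"
    then have "x \<otimes> \<one> \<in> P <#> generate G Q" unfolding set_mult_def using generate.one by blast
    then show "x \<in> P <#> generate G Q" using c(1)[OF \<open>x \<in> P\<close>] by simp
  qed
  moreover have "Q \<subseteq> P <#> generate G Q"
  proof
    fix x assume x: "x \<in> Q"
    then have "\<one> \<otimes> x \<in> P <#> generate G Q"
      unfolding set_mult_def using generate.incl[OF x, of G] subgroup.one_closed[OF P] by blast
    then show "x \<in> P <#> generate G Q" using Q x by auto
  qed
  ultimately show "generate G (P \<union> Q) \<subseteq> P <#> generate G Q"
    using generate_subgroup_incl by blast
  have "x \<otimes> y \<in> generate G (P \<union> Q)" if "x \<in> P" "y \<in> generate G Q" for x y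
  proof (rule generate.eng)
    show "x \<in> generate G (P \<union> Q)" using that(1) by (intro generate.incl) blast
    show "y \<in> generate G (P \<union> Q)" using that(2) mono_generate[of Q "P \<union> Q"] by blast
  qed
  then show "P <#> generate G Q \<subseteq> generate G (P \<union> Q)" unfolding set_mult_def by blast
qed

lemma submaximal_trivial:
  fixes G :: "('a, 'b) monoid_scheme"
  assumes X: "complete_class \<XX>" and G: "group G" and tr: "carrier G = {\<one>\<^bsub>G\<^esub>}"
  shows "{\<one>\<^bsub>G\<^esub>} \<in> submaximal_class_subgroups \<XX> G"
proof (rule submaximalI[OF X _ G _ G])
  show "subgroup {\<one>\<^bsub>G\<^esub>} G" using group.triv_subgroup[OF G] .
  show "finite (carrier G)" using tr by simp
  show "(\<lambda>x. x) \<in> mon G G" by (simp add: mon_def hom_def Pi_def)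
  show "subnormal ((\<lambda>x. x) ` carrier G) G" using subnormal.whole by simp
  show "{\<one>\<^bsub>G\<^esub>} \<in> maximal_class_subgroups \<XX> G"
    using class_subgroup_trivial[OF X G] subgroup.subset[of _ G] tr
    unfolding maximal_class_subgroups_def class_subgroup_def by blast
  show "(\<lambda>x. x) ` {\<one>\<^bsub>G\<^esub>} = {\<one>\<^bsub>G\<^esub>} \<inter> (\<lambda>x. x) ` carrier G" using tr by simp
qed

text \<open>The step of the inductions over the index set, which split off one factor at a time.\<close>

lemma internal_direct_product_partial:
  fixes G :: "('a, 'b) monoid_scheme" (structure)
  assumes G: "group G" and D: "internal_direct_product G I D" and J: "J \<subseteq> I - {j}" and j: "j \<in> I"
  shows "D j \<lhd> G" and "generate G (\<Union>i\<in>J. D i) \<lhd> G" and "D j \<inter> generate G (\<Union>i\<in>J. D i) = {\<one>}"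
    and "generate G (\<Union>i\<in>insert j J. D i) = D j <#> generate G (\<Union>i\<in>J. D i)"
proof -
  interpret group G by fact
  have nD: "D i \<lhd> G" if "i \<in> I" for i using D that unfolding internal_direct_product_def by blast
  then have sD: "subgroup (D i) G" if "i \<in> I" for i using normal_imp_subgroup that by blast
  show nDj: "D j \<lhd> G" using nD j .
  have Jc: "(\<Union>i\<in>J. D i) \<subseteq> carrier G" using sD J subgroup.subset by blast
  show nJ: "generate G (\<Union>i\<in>J. D i) \<lhd> G"
  proof (rule normal_generateI[OF Jc])
    fix h g assume "h \<in> (\<Union>i\<in>J. D i)" "g \<in> carrier G"
    then show "g \<otimes> h \<otimes> inv g \<in> (\<Union>i\<in>J. D i)" using normal.inv_op_closed2[OF nD] J by blast
  qed
  have "generate G (\<Union>i\<in>J. D i) \<subseteq> generate G (\<Union>i\<in>I - {j}. D i)" using J by (intro mono_generate) blast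
  moreover have "D j \<inter> generate G (\<Union>i\<in>I - {j}. D i) = {\<one>}"
    using D j unfolding internal_direct_product_def by blast
  ultimately show int: "D j \<inter> generate G (\<Union>i\<in>J. D i) = {\<one>}"
    using subgroup.one_closed[OF sD[OF j]] generate.one by blast
  show "generate G (\<Union>i\<in>insert j J. D i) = D j <#> generate G (\<Union>i\<in>J. D i)"
    using generate_Un_commuting[OF sD[OF j] Jc normal_imp_commuting[OF nDj nJ]] int by simp
qed

theorem corollary2:
  fixes G :: "('a, 'b) monoid_scheme"
    and D :: "nat \<Rightarrow> 'a set"
    and n :: nat
    and \<XX> :: "nat monoid set"
  assumes "group G" and "finite (carrier G)"
    and "internal_direct_product G {1..n} D"
    and "complete_class \<XX>"
  shows "submaximal_class_subgroups \<XX> G =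
           {generate G (\<Union>i\<in>{1..n}. H i) | H.
              \<forall>i\<in>{1..n}. H i \<in> submaximal_class_subgroups \<XX> (G\<lparr>carrier := D i\<rparr>)}"
    (is "_ = ?R")
proof
  interpret group G by fact
  let ?I = "{1..n}"
  note D = assms(3) and X = assms(4)
  note part = internal_direct_product_partial[OF \<open>group G\<close> D]
  have nD: "D i \<lhd> G" if "i \<in> ?I" for i using D that unfolding internal_direct_product_def by blast
  have all: "generate G (\<Union>i\<in>?I. D i) = carrier G" using D unfolding internal_direct_product_def by blast
  have split: "J \<subseteq> ?I - {j} \<and> j \<in> ?I \<and> J \<subseteq> ?I" if "insert j J \<subseteq> ?I" "j \<notin> J" for j J
    using that by blast
  show "submaximal_class_subgroups \<XX> G \<subseteq> ?R"
  proof
    fix H assume H: "H \<in> submaximal_class_subgroups \<XX> G"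
    then have sH: "subgroup H G" unfolding submaximal_class_subgroups_def by blast
    have "h \<in> generate G (\<Union>i\<in>J. H \<inter> D i)"
      if "finite J" "J \<subseteq> ?I" "h \<in> H" "h \<in> generate G (\<Union>i\<in>J. D i)" for J h
      using that
    proof (induction J arbitrary: h rule: finite_induct)
      case empty
      then show ?case by simp
    next
      case (insert j J)
      have J: "J \<subseteq> ?I - {j}" "j \<in> ?I" "J \<subseteq> ?I" using split insert by auto
      note p = part[OF J(1,2)]
      obtain d b where db: "d \<in> D j" "b \<in> generate G (\<Union>i\<in>J. D i)" "h = d \<otimes>\<^bsub>G\<^esub> b"
        using insert.prems(3) p(4) by (auto simp: set_mult_def)
      have c: "d \<in> carrier G" "b \<in> carrier G"
        using subgroup.mem_carrier[OF normal_imp_subgroup[OF p(1)] db(1)]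
          subgroup.mem_carrier[OF normal_imp_subgroup[OF p(2)] db(2)] by auto
      have dH: "d \<in> H"
        using submaximal_contains_factors[OF X \<open>group G\<close> H p(1-3) db(1,2)] db(3) insert.prems(2) by simp
      then have "inv\<^bsub>G\<^esub> d \<otimes>\<^bsub>G\<^esub> h \<in> H"
        using subgroup.m_closed[OF sH subgroup.m_inv_closed[OF sH dH] insert.prems(2)] by simp
      then have "b \<in> H" using db(3) c by (simp add: inv_mult_cancel_left)
      then have "b \<in> generate G (\<Union>i\<in>J. H \<inter> D i)" using insert.IH[OF J(3) _ db(2)] by blast
      moreover have "(\<Union>i\<in>J. H \<inter> D i) \<subseteq> (\<Union>i\<in>insert j J. H \<inter> D i)" by blast
      ultimately have "b \<in> generate G (\<Union>i\<in>insert j J. H \<inter> D i)" using mono_generate by blast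
      moreover have "d \<in> generate G (\<Union>i\<in>insert j J. H \<inter> D i)"
        using dH db(1) by (intro generate.incl) blast
      ultimately show ?case unfolding db(3) by (intro generate.eng)
    qed
    then have "H \<subseteq> generate G (\<Union>i\<in>?I. H \<inter> D i)" using all subgroup.mem_carrier[OF sH] by blast
    moreover have "generate G (\<Union>i\<in>?I. H \<inter> D i) \<subseteq> H" by (rule generate_subgroup_incl[OF _ sH]) blast
    ultimately have "H = generate G (\<Union>i\<in>?I. H \<inter> D i)" by blast
    moreover have "\<forall>i\<in>?I. H \<inter> D i \<in> submaximal_class_subgroups \<XX> (G\<lparr>carrier := D i\<rparr>)"
      using submaximal_Int_normal[OF \<open>group G\<close> H nD] by blast
    ultimately show "H \<in> ?R" by (intro CollectI exI[of _ "\<lambda>i. H \<inter> D i"]) simp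
  qed
  show "?R \<subseteq> submaximal_class_subgroups \<XX> G"
  proof
    fix K assume "K \<in> ?R"
    then obtain H where K: "K = generate G (\<Union>i\<in>?I. H i)"
      and H: "\<And>i. i \<in> ?I \<Longrightarrow> H i \<in> submaximal_class_subgroups \<XX> (G\<lparr>carrier := D i\<rparr>)" by blast
    have sHD: "subgroup (H i) G" "H i \<subseteq> D i" if i: "i \<in> ?I" for i
    proof -
      have "subgroup (H i) (G\<lparr>carrier := D i\<rparr>)" using H[OF i] unfolding submaximal_class_subgroups_def by blast
      then show "subgroup (H i) G" "H i \<subseteq> D i"
        using incl_subgroup[OF normal_imp_subgroup[OF nD[OF i]]] subgroup.subset by fastforce+
    qed
    have "generate G (\<Union>i\<in>J. H i) \<in>
        submaximal_class_subgroups \<XX> (G\<lparr>carrier := generate G (\<Union>i\<in>J. D i)\<rparr>)"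
      if "finite J" "J \<subseteq> ?I" for J
      using that
    proof (induction J rule: finite_induct)
      case empty
      have "generate G {} = {\<one>\<^bsub>G\<^esub>}" by (rule generate_empty)
      then show ?case
        using submaximal_trivial[OF X subgroup_imp_group[OF triv_subgroup]] by simp
    next
      case (insert j J)
      have J: "J \<subseteq> ?I - {j}" "j \<in> ?I" "J \<subseteq> ?I" using split insert by auto
      note p = part[OF J(1,2)]
      let ?B = "generate G (\<Union>i\<in>J. D i)" and ?C = "generate G (\<Union>i\<in>insert j J. D i)"
      have sA: "subgroup (D j) G" and sB: "subgroup ?B G" using p(1,2) normal_imp_subgroup by auto
      have comm: "x \<otimes>\<^bsub>G\<^esub> y = y \<otimes>\<^bsub>G\<^esub> x" if "x \<in> D j" "y \<in> ?B" for x y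
        using normal_imp_commuting[OF p(1,2) _ that] p(3) by simp
      have HJ: "(\<Union>i\<in>J. H i) \<subseteq> (\<Union>i\<in>J. D i)" using sHD(2) J(3) by blast
      have HJc: "(\<Union>i\<in>J. H i) \<subseteq> carrier G" using sHD(1) J(3) subgroup.subset by blast
      have eq: "generate G (\<Union>i\<in>insert j J. H i) = H j <#>\<^bsub>G\<^esub> generate G (\<Union>i\<in>J. H i)"
        using generate_Un_commuting[OF sHD(1)[OF J(2)] HJc] comm sHD(2)[OF J(2)] mono_generate[OF HJ] by auto
      have sC: "subgroup ?C G" unfolding p(4) using mult_norm_subgroup[OF p(1) sB] .
      have AC: "D j \<subseteq> ?C" using generate.incl[of _ "\<Union>i\<in>insert j J. D i" G] by blast
      have BC: "?B \<subseteq> ?C" by (intro mono_generate) blast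
      have "H j <#>\<^bsub>G\<lparr>carrier := ?C\<rparr>\<^esub> generate G (\<Union>i\<in>J. H i)
          \<in> submaximal_class_subgroups \<XX> (G\<lparr>carrier := ?C\<rparr>)"
      proof (rule submaximal_internal_product[OF X subgroup_imp_group[OF sC]
            subgroup_incl[OF sA sC AC] subgroup_incl[OF sB sC BC]])
        show "D j \<inter> ?B = {\<one>\<^bsub>G\<lparr>carrier := ?C\<rparr>\<^esub>}" using p(3) by simp
        show "carrier (G\<lparr>carrier := ?C\<rparr>) = D j <#>\<^bsub>G\<lparr>carrier := ?C\<rparr>\<^esub> ?B" using p(4) by simp
        show "H j \<in> submaximal_class_subgroups \<XX> (G\<lparr>carrier := ?C, carrier := D j\<rparr>)"
          using H[OF J(2)] by simp
        show "generate G (\<Union>i\<in>J. H i) \<in> submaximal_class_subgroups \<XX> (G\<lparr>carrier := ?C, carrier := ?B\<rparr>)"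
          using insert.IH[OF J(3)] by simp
      qed (use comm in simp)
      then show ?case unfolding eq by simp
    qed
    then show "K \<in> submaximal_class_subgroups \<XX> G" using K all by force
  qed
qed

end
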